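(* (Existence of $N_K=N$ SUSY vertex algebras.) Let $V$ be a vector superspace, $|0\rangle\in V$ an even vector, $T$ an even endomorphism of $V$ and $S^i$, $i=1,\dots,N$, odd endomorphisms of $V$ satisfying $[S^i,S^j]=2\delta_{ij}T$. Suppose moreover that $S^i|0\rangle=0$. Let $\mathcal F$ be a family of $\mathrm{End}(V)$-valued fields $$a^\alpha(Z)=\sum_{(j|J)}Z^{-1-j|N\setminus J}a^\alpha_{(j|J)},$$ indexed by $\alpha\in A$, such that (1) $a^\alpha(Z)|0\rangle\big|_{Z=0}=a^\alpha\in V$ (in particular $a^\alpha(Z)|0\rangle\in V[[Z]]$); (2) $[S^i,a^\alpha(Z)]=\overline D^{\,i}_Za^\alpha(Z)$; (3) all pairs $(a^\alpha(Z),a^\beta(Z))$ are local; (4) the vectors $a^{\alpha_s}_{(j_s|J_s)}\cdots a^{\alpha_1}_{(j_1|J_1)}|0\rangle$ span $V$. Then the formula $$Y\bigl(a^{\alpha_s}_{(j_s|J_s)}\cdots a^{\alpha_1}_{(j_1|J_1)}|0\rangle,Z\bigr)=\prod_i\sigma(J_i)\;a^{\alpha_s}(Z)_{(j_s|J_s)}\Bigl(\cdots a^{\alpha_2}(Z)_{(j_2|J_2)}\bigl(a^{\alpha_1}(Z)_{(j_1|J_1)}\mathrm{Id}\bigr)\cdots\Bigr)$$ defines a structure of an $N_K=N$ SUSY vertex algebra on $V$, with vacuum vector $|0\rangle$, translation operators $S^i$, and such that $Y(a^\alpha,Z)=a^\alpha(Z)$ for all $\alpha\in A$. Such a structure is 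unique.
   Context: Ground field $\mathbb C$; $N\ge1$ a fixed integer. $Z=(z,\theta^1,\dots,\theta^N)$, $W=(w,\zeta^1,\dots,\zeta^N)$, $z,w$ even, $\theta^i,\zeta^i$ odd; odd variables anticommute with each other and supercommute with elements of superspaces; $[\ ,\ ]$ is the supercommutator. For $J=\{j_1<\dots<j_k\}\subset\{1,\dots,N\}$, $\theta^J=\theta^{j_1}\cdots\theta^{j_k}$, $Z^{j|J}=z^j\theta^J$, $N\setminus J=\{1,\dots,N\}\setminus J$; $\sigma(J)=\pm1$ is defined by $\theta^J\theta^{N\setminus J}=\sigma(J)\theta^1\cdots\theta^N$. $V[[Z]]=V[[z]][\theta^1,\dots,\theta^N]$, $V((Z))=V((z))[\theta^1,\dots,\theta^N]$. $\overline D^{\,i}_Z=\partial_{\theta^i}-\theta^i\partial_z$. An $\mathrm{End}(V)$-valued field is a formal sum $a(Z)=\sum_{n\in\mathbb Z,I}Z^{n|I}a_{n|I}$, $a_{n|I}\in\mathrm{End}(V)$, with $a(Z)v\in V((Z))$ for all $v$; fields are homogeneous: parity $p(a)$ means $a_{n|I}$ has parity $p(a)+\#I$. A pair $(a(Z),b(Z))$ is local if $(z-w)^n[a(Z),b(W)]=0$ for some $n\in\mathbb Z_{\ge0}$. $\mathrm{res}_Z$ is the coefficient of $z^{-1}\theta^1\cdots\theta^N$ (written to the right of it). For fields and all $j\in\mathbb Z$, $J\subset\{1,\dots,N\}$, the $(j|J)$-product is $$a(W)_{(j|J)}b(W)=\mathrm{res}_Z\bigl(i_{z,w}(Z-W)^{j|J}a(Z)b(W)-(-1)^{p(a)p(b)}i_{w,z}(Z-W)^{j|J}b(W)a(Z)\bigr),$$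 where $(Z-W)^{j|J}=\bigl(z-w-\sum_i\theta^i\zeta^i\bigr)^j\prod_{i\in J}(\theta^i-\zeta^i)$ (increasing order; for $j<0$ expanded as a finite sum in powers of $\sum_i\theta^i\zeta^i$) and $i_{z,w}$, $i_{w,z}$ are the expansions in the domains $|z|>|w|$, $|w|>|z|$. An $N_K=N$ SUSY vertex algebra is a vector superspace $V$ with an even vector $|0\rangle$, odd operators $S^1,\dots,S^N$, and a parity preserving linear map $a\mapsto Y(a,Z)$ from $V$ to $\mathrm{End}(V)$-valued fields such that: $Y(a,Z)|0\rangle\in V[[Z]]$ has value $a$ at $Z=0$, $S^i|0\rangle=0$; $[S^i,Y(a,Z)]=\overline D^{\,i}_ZY(a,Z)$; every pair $(Y(a,Z),Y(b,Z))$ is local. *)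

theory Defs
  imports Complex_Main "HOL-Library.Z2" "HOL-Library.Groups_Big_Fun"
begin

text \<open>
  Parities are elements of the two-element field \<open>bit\<close>: \<open>0\<close> is even, \<open>1\<close> is odd.  Formulas of the
  source that are stated for homogeneous arguments (supercommutators, \<open>(j|J)\<close>-products) are
  extended to arbitrary arguments by bilinearity, through the homogeneous components.
\<close>

definition psign :: "bit \<Rightarrow> complex" where
  "psign p = (if p = 0 then 1 else - 1)"


section \<open>Complex vector superspaces and their endomorphisms\<close>

class superspace = ab_group_add +
  fixes scaleC :: "complex \<Rightarrow> 'a \<Rightarrow> 'a" (infixr \<open>*\<^sub>C\<close> 75)
    and graded :: "bit \<Rightarrow> 'a set"
  assumes scaleC_right_distrib: "c *\<^sub>C (x + y) = c *\<^sub>C x + c *\<^sub>C y"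
    and scaleC_left_distrib: "(c + d) *\<^sub>C x = c *\<^sub>C x + d *\<^sub>C x"
    and scaleC_scaleC: "c *\<^sub>C d *\<^sub>C x = (c * d) *\<^sub>C x"
    and scaleC_one: "1 *\<^sub>C x = x"
    and graded_zero: "0 \<in> graded p"
    and graded_add: "x \<in> graded p \<Longrightarrow> y \<in> graded p \<Longrightarrow> x + y \<in> graded p"
    and graded_scaleC: "x \<in> graded p \<Longrightarrow> c *\<^sub>C x \<in> graded p"
    and graded_Int: "graded 0 \<inter> graded 1 = {0}"
    and graded_sum: "\<exists>y\<in>graded 0. \<exists>z\<in>graded 1. x = y + z"

global_interpretation superspace: vector_space "scaleC :: complex \<Rightarrow> 'v::superspace \<Rightarrow> 'v"
  by unfold_locales
    (simp_all add: scaleC_right_distrib scaleC_left_distrib scaleC_scaleC scaleC_one)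

definition part :: "bit \<Rightarrow> 'v::superspace \<Rightarrow> 'v" where
  "part p v = (THE x. x \<in> graded p \<and> v - x \<in> graded (p + 1))"

definition endo :: "('v::superspace \<Rightarrow> 'v) \<Rightarrow> bool" where
  "endo A \<longleftrightarrow> Vector_Spaces.linear scaleC scaleC A"

definition op_parity :: "bit \<Rightarrow> ('v::superspace \<Rightarrow> 'v) \<Rightarrow> bool" where
  "op_parity p A \<longleftrightarrow> (\<forall>q. \<forall>v\<in>graded q. A v \<in> graded (p + q))"

definition op_part :: "bit \<Rightarrow> ('v::superspace \<Rightarrow> 'v) \<Rightarrow> 'v \<Rightarrow> 'v" where
  "op_part p A v = (\<Sum>q\<in>{0, 1}. part (p + q) (A (part q v)))"

definition scomm :: "('v::superspace \<Rightarrow> 'v) \<Rightarrow> ('v \<Rightarrow> 'v) \<Rightarrow> 'v \<Rightarrow> 'v" where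
  "scomm A B v = (\<Sum>p\<in>{0, 1}. \<Sum>q\<in>{0, 1}.
     op_part p A (op_part q B v) - psign (p * q) *\<^sub>C op_part q B (op_part p A v))"


section \<open>Grassmann variables\<close>

text \<open>
  For a family of anticommuting variables \<open>\<xi>\<^sup>1, \<xi>\<^sup>2, \<dots>\<close> and a finite set \<open>L\<close>, \<open>\<xi>\<^sup>L\<close> is the product of
  the \<open>\<xi>\<^sup>i\<close>, \<open>i \<in> L\<close>, in increasing order; \<open>\<xi>\<^sup>I \<xi>\<^sup>J = gsign I J \<xi>\<^sup>I\<^sup>\<union>\<^sup>J\<close> for disjoint \<open>I\<close> and \<open>J\<close>.  A Grassmann
  polynomial is represented by its coefficients, written to the right of \<open>\<xi>\<^sup>L\<close>.
\<close>

definition gsign :: "nat set \<Rightarrow> nat set \<Rightarrow> complex" where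
  "gsign I J = (- 1) ^ card {(i, j). i \<in> I \<and> j \<in> J \<and> j < i}"

definition sigma :: "nat \<Rightarrow> nat set \<Rightarrow> complex" where
  "sigma N J = gsign J ({1..N} - J)"

type_synonym grass = "nat set \<Rightarrow> complex"

definition gone :: grass where
  "gone L = (if L = {} then 1 else 0)"

definition gvar :: "nat \<Rightarrow> grass" where
  "gvar i L = (if L = {i} then 1 else 0)"

definition gmul :: "grass \<Rightarrow> grass \<Rightarrow> grass" where
  "gmul f g L = (\<Sum>K\<in>Pow L. gsign K (L - K) * f K * g (L - K))"

text \<open>
  The same product for operator coefficients: moving \<open>\<xi>\<^sup>M\<close> to the left through an operator of parity
  \<open>p\<close> gives the sign \<open>(-1)\<^bsup>p |M|\<^esup>\<close>.
\<close>

definition gcross :: "nat set \<Rightarrow> ('v::superspace \<Rightarrow> 'v) \<Rightarrow> 'v \<Rightarrow> 'v" where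
  "gcross M A v = (\<Sum>p\<in>{0, 1}. psign (p * of_nat (card M)) *\<^sub>C op_part p A v)"

definition op_gmul ::
    "(nat set \<Rightarrow> 'v::superspace \<Rightarrow> 'v) \<Rightarrow> (nat set \<Rightarrow> 'v \<Rightarrow> 'v) \<Rightarrow> nat set \<Rightarrow> 'v \<Rightarrow> 'v" where
  "op_gmul A B L v = (\<Sum>K\<in>Pow L. gsign K (L - K) *\<^sub>C gcross (L - K) (A K) (B (L - K) v))"


section \<open>Fields\<close>

text \<open>\<open>a n I\<close> is the coefficient of \<open>Z\<^bsup>n|I\<^esup>\<close>; it is \<open>0\<close> unless \<open>I \<subseteq> {1..N}\<close>.\<close>

type_synonym 'v sfield = "int \<Rightarrow> nat set \<Rightarrow> 'v \<Rightarrow> 'v"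

definition is_field :: "nat \<Rightarrow> 'v::superspace sfield \<Rightarrow> bool" where
  "is_field N a \<longleftrightarrow>
     (\<forall>n I. endo (a n I)) \<and>
     (\<forall>n I. \<not> I \<subseteq> {1..N} \<longrightarrow> a n I = (\<lambda>v. 0)) \<and>
     (\<forall>v. \<exists>n0. \<forall>n<n0. \<forall>I. a n I v = 0)"

definition field_parity :: "bit \<Rightarrow> 'v::superspace sfield \<Rightarrow> bool" where
  "field_parity p a \<longleftrightarrow> (\<forall>n I. op_parity (p + of_nat (card I)) (a n I))"

definition field_part :: "bit \<Rightarrow> 'v::superspace sfield \<Rightarrow> 'v sfield" where
  "field_part p a n I = op_part (p + of_nat (card I)) (a n I)"

definition id_field :: "'v::superspace sfield" where
  "id_field n I v = (if n = 0 \<and> I = {} then v else 0)"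

definition fmode :: "nat \<Rightarrow> 'v::superspace sfield \<Rightarrow> int \<Rightarrow> nat set \<Rightarrow> 'v \<Rightarrow> 'v" where
  "fmode N a j J = a (- 1 - j) ({1..N} - J)"

text \<open>\<open>a(Z)|0\<rangle>\<close> lies in \<open>V[[Z]]\<close> and has value \<open>x\<close> at \<open>Z = 0\<close>.\<close>

definition creates :: "'v::superspace \<Rightarrow> 'v sfield \<Rightarrow> 'v \<Rightarrow> bool" where
  "creates vac a x \<longleftrightarrow> (\<forall>n<0. \<forall>I. a n I vac = 0) \<and> a 0 {} vac = x"

text \<open>\<open>[A, a(Z)]\<close>; here \<open>A Z\<^bsup>n|I\<^esup> = (-1)\<^bsup>p |I|\<^esup> Z\<^bsup>n|I\<^esup> A\<close> for \<open>A\<close> of parity \<open>p\<close>.\<close>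

definition scomm_field :: "('v::superspace \<Rightarrow> 'v) \<Rightarrow> 'v sfield \<Rightarrow> 'v sfield" where
  "scomm_field A a n I v = (\<Sum>p\<in>{0, 1}. \<Sum>q\<in>{0, 1}.
     psign (p * of_nat (card I)) *\<^sub>C op_part p A (field_part q a n I v)
     - psign (p * q) *\<^sub>C field_part q a n I (op_part p A v))"

text \<open>
  Coefficients of \<open>(\<partial>\<^bsub>\<theta>\<^sup>i\<^esub> - \<theta>\<^sup>i \<partial>\<^sub>z) a(Z)\<close>: for \<open>i \<notin> I\<close>, \<open>\<partial>\<^bsub>\<theta>\<^sup>i\<^esub> \<theta>\<^bsup>insert i I\<^esup> = gsign {i} I \<theta>\<^sup>I\<close> and
  \<open>\<theta>\<^sup>i \<partial>\<^sub>z Z\<^bsup>n|I\<^esup> = n gsign {i} I Z\<^bsup>n-1|insert i I\<^esup>\<close>.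
\<close>

definition Dbar :: "nat \<Rightarrow> 'v::superspace sfield \<Rightarrow> 'v sfield" where
  "Dbar i a n I v =
     (if i \<notin> I then gsign {i} I *\<^sub>C a n (insert i I) v
      else - ((of_int (n + 1) * gsign {i} (I - {i})) *\<^sub>C a (n + 1) (I - {i}) v))"


section \<open>Formal distributions in \<open>Z\<close> and \<open>W\<close>\<close>

text \<open>
  \<open>F m k L\<close> is the coefficient of \<open>z\<^sup>m w\<^sup>k \<xi>\<^sup>L\<close>, where \<open>L \<subseteq> {1..2N}\<close>, \<open>\<xi>\<^sup>i = \<theta>\<^sup>i\<close> and \<open>\<xi>\<^bsup>N+i\<^esup> = \<zeta>\<^sup>i\<close> for
  \<open>1 \<le> i \<le> N\<close>.
\<close>

type_synonym cdist2 = "int \<Rightarrow> int \<Rightarrow> grass"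
type_synonym 'v opdist2 = "int \<Rightarrow> int \<Rightarrow> nat set \<Rightarrow> 'v \<Rightarrow> 'v"

text \<open>Substitution of \<open>\<zeta>\<^sup>i\<close> for \<open>\<theta>\<^sup>i\<close>.\<close>

definition to_zeta :: "nat \<Rightarrow> (nat set \<Rightarrow> 'v::superspace \<Rightarrow> 'v) \<Rightarrow> nat set \<Rightarrow> 'v \<Rightarrow> 'v" where
  "to_zeta N B L = (if L \<subseteq> {N + 1..2 * N} then B ((\<lambda>i. i - N) ` L) else (\<lambda>v. 0))"

text \<open>\<open>a(Z) b(W)\<close> and \<open>b(W) a(Z)\<close>\<close>

definition prod_ZW :: "nat \<Rightarrow> 'v::superspace sfield \<Rightarrow> 'v sfield \<Rightarrow> 'v opdist2" where
  "prod_ZW N a b m k = op_gmul (a m) (to_zeta N (b k))"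

definition prod_WZ :: "nat \<Rightarrow> 'v::superspace sfield \<Rightarrow> 'v sfield \<Rightarrow> 'v opdist2" where
  "prod_WZ N b a m k = op_gmul (to_zeta N (b k)) (a m)"

text \<open>
  Product of a scalar distribution and an operator distribution.  It is evaluated on vectors: in
  all uses below the sum over the exponents then has only finitely many nonzero terms.
\<close>

definition dist_mul :: "cdist2 \<Rightarrow> 'v::superspace opdist2 \<Rightarrow> 'v opdist2" where
  "dist_mul c F m k L v = Sum_any (\<lambda>(m', k').
     \<Sum>K\<in>Pow L. (gsign K (L - K) * c m' k' K) *\<^sub>C F (m - m') (k - k') (L - K) v)"

text \<open>\<open>i\<^bsub>z,w\<^esub> (z - w)\<^sup>n\<close> and \<open>i\<^bsub>w,z\<^esub> (z - w)\<^sup>n\<close>\<close>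

definition exp_zw :: "int \<Rightarrow> int \<Rightarrow> int \<Rightarrow> complex" where
  "exp_zw n m k =
     (if 0 \<le> k \<and> m + k = n then (of_int n gchoose nat k) * (- 1) powi k else 0)"

definition exp_wz :: "int \<Rightarrow> int \<Rightarrow> int \<Rightarrow> complex" where
  "exp_wz n m k =
     (if 0 \<le> m \<and> m + k = n then (of_int n gchoose nat m) * (- 1) powi k else 0)"

definition theta_zeta :: "nat \<Rightarrow> grass" where
  "theta_zeta N L = (\<Sum>i\<in>{1..N}. gmul (gvar i) (gvar (N + i)) L)"

definition theta_minus_zeta :: "nat \<Rightarrow> nat \<Rightarrow> grass" where
  "theta_minus_zeta N i L = gvar i L - gvar (N + i) L"

definition odd_factor :: "nat \<Rightarrow> nat set \<Rightarrow> grass" where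
  "odd_factor N J = foldr (\<lambda>i. gmul (theta_minus_zeta N i)) (sorted_list_of_set J) gone"

text \<open>
  The expansion of \<open>(Z - W)\<^bsup>j|J\<^esup>\<close> in which the powers of \<open>z - w\<close> are expanded by \<open>e\<close>, namely
  \<open>\<Sum>\<^sub>s (j choose s) (-1)\<^sup>s (z - w)\<^bsup>j-s\<^esup> (\<Sum>\<^sub>i \<theta>\<^sup>i \<zeta>\<^sup>i)\<^sup>s \<Prod>\<^bsub>i\<in>J\<^esub> (\<theta>\<^sup>i - \<zeta>\<^sup>i)\<close>; the powers with \<open>s > N\<close> vanish.
\<close>

definition ZW_power :: "(int \<Rightarrow> int \<Rightarrow> int \<Rightarrow> complex) \<Rightarrow> nat \<Rightarrow> int \<Rightarrow> nat set \<Rightarrow> cdist2" where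
  "ZW_power e N j J m k L =
     (\<Sum>s\<le>N. (of_int j gchoose s) * (- 1) ^ s * e (j - int s) m k *
        gmul ((gmul (theta_zeta N) ^^ s) gone) (odd_factor N J) L)"

definition comm_ZW :: "nat \<Rightarrow> 'v::superspace sfield \<Rightarrow> 'v sfield \<Rightarrow> 'v opdist2" where
  "comm_ZW N a b m k L v = (\<Sum>p\<in>{0, 1}. \<Sum>q\<in>{0, 1}.
     prod_ZW N (field_part p a) (field_part q b) m k L v
     - psign (p * q) *\<^sub>C prod_WZ N (field_part q b) (field_part p a) m k L v)"

definition local_pair :: "nat \<Rightarrow> 'v::superspace sfield \<Rightarrow> 'v sfield \<Rightarrow> bool" where
  "local_pair N a b \<longleftrightarrow> (\<exists>n::nat. \<forall>m k L v.
     dist_mul (\<lambda>m k L. exp_zw (int n) m k * gone L) (comm_ZW N a b) m k L v = 0)"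

text \<open>Coefficient of \<open>z\<^bsup>-1\<^esup> \<theta>\<^sup>1 \<cdots> \<theta>\<^sup>N\<close>, a formal distribution in \<open>W\<close>.\<close>

definition res_Z :: "nat \<Rightarrow> 'v::superspace opdist2 \<Rightarrow> 'v sfield" where
  "res_Z N F k K v =
     (if K \<subseteq> {1..N} then F (- 1) k ({1..N} \<union> (\<lambda>i. N + i) ` K) v else 0)"

definition jJ_prod ::
    "nat \<Rightarrow> int \<Rightarrow> nat set \<Rightarrow> 'v::superspace sfield \<Rightarrow> 'v sfield \<Rightarrow> 'v sfield" where
  "jJ_prod N j J a b = res_Z N (\<lambda>m k L v. \<Sum>p\<in>{0, 1}. \<Sum>q\<in>{0, 1}.
     dist_mul (ZW_power exp_zw N j J) (prod_ZW N (field_part p a) (field_part q b)) m k L v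
     - psign (p * q) *\<^sub>C
       dist_mul (ZW_power exp_wz N j J) (prod_WZ N (field_part q b) (field_part p a)) m k L v)"


section \<open>SUSY vertex algebras\<close>

locale susy_vertex_algebra =
  fixes N :: nat
    and vac :: "'v::superspace"
    and S :: "nat \<Rightarrow> 'v \<Rightarrow> 'v"
    and Y :: "'v \<Rightarrow> 'v sfield"
  assumes N_pos: "1 \<le> N"
    and vac_even: "vac \<in> graded 0"
    and S_endo: "i \<in> {1..N} \<Longrightarrow> endo (S i)"
    and S_odd: "i \<in> {1..N} \<Longrightarrow> op_parity 1 (S i)"
    and Y_field: "is_field N (Y x)"
    and Y_add: "Y (x + y) n I v = Y x n I v + Y y n I v"
    and Y_scaleC: "Y (c *\<^sub>C x) n I v = c *\<^sub>C Y x n I v"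
    and Y_parity: "x \<in> graded p \<Longrightarrow> field_parity p (Y x)"
    and Y_vac: "creates vac (Y x) x"
    and S_vac: "i \<in> {1..N} \<Longrightarrow> S i vac = 0"
    and S_covariance: "i \<in> {1..N} \<Longrightarrow> scomm_field (S i) (Y x) = Dbar i (Y x)"
    and locality: "local_pair N (Y x) (Y y)"


section \<open>Words in the modes of a family of fields\<close>

text \<open>
  The word \<open>(\<alpha>\<^sub>s, j\<^sub>s, J\<^sub>s), \<dots>, (\<alpha>\<^sub>1, j\<^sub>1, J\<^sub>1)\<close> is a list with head \<open>(\<alpha>\<^sub>s, j\<^sub>s, J\<^sub>s)\<close>; the empty word is
  allowed.
\<close>

type_synonym 'i word = "('i \<times> int \<times> nat set) list"

definition words :: "nat \<Rightarrow> 'i set \<Rightarrow> 'i word set" where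
  "words N A = lists (A \<times> UNIV \<times> Pow {1..N})"

definition word_vector :: "nat \<Rightarrow> 'v::superspace \<Rightarrow> ('i \<Rightarrow> 'v sfield) \<Rightarrow> 'i word \<Rightarrow> 'v" where
  "word_vector N vac F ws = foldr (\<lambda>(\<alpha>, j, J). fmode N (F \<alpha>) j J) ws vac"

definition word_field :: "nat \<Rightarrow> ('i \<Rightarrow> 'v::superspace sfield) \<Rightarrow> 'i word \<Rightarrow> 'v sfield" where
  "word_field N F ws = foldr (\<lambda>(\<alpha>, j, J). jJ_prod N j J (F \<alpha>)) ws id_field"

definition word_sign :: "nat \<Rightarrow> 'i word \<Rightarrow> complex" where
  "word_sign N ws = prod_list (map (\<lambda>(\<alpha>, j, J). sigma N J) ws)"

end

theory Submission
  imports Defs "HOL-Library.Function_Algebras"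
begin

text \<open>
  For homogeneous fields locality means mutual locality, in the ordinary sense, of all pairs of
  components, and the components of \<open>a(W)\<^sub>(\<^sub>j\<^sub>|\<^sub>J\<^sub>)b(W)\<close> are linear combinations of ordinary
  \<open>n\<close>-th products of components of \<open>a\<close> and \<open>b\<close>; hence Dong's lemma reduces to its ordinary form.
  Covariance of the products holds because \<open>(Z - W)\<^bsup>j|J\<^esup>\<close> is annihilated by the sum of the two
  covariant derivatives.  So all fields attached to words are covariant and mutually local.  By
  Goddard's uniqueness argument such a field is determined by its value on the vacuum at \<open>Z = 0\<close>, so
  the linear map from the span of these fields to \<open>V\<close> is bijective, and its inverse is \<open>Y\<close>.
\<close>

text \<open>Signs shape the whole proof. A product of operator-valued Grassmann elements has
  explicit signs only for homogeneous factors, so the statements concern a field together with a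
  parity p, its coefficient at I having parity p + |I|; arbitrary states are split into two parts
  only at the end. The residue extracts a monomial with N odd variables: hence a (j|J)-product has
  parity p(a) + p(b) + |J| + N, and covariant derivatives leave it with a sign (-1)^N. The factor
  \<sigma>(J) has another source: at W = 0 the kernel is z^j \<theta>^J, and \<theta>^J has to be
  completed to \<theta>^1...\<theta>^N.

  The j-th power of z - w - \<Sum> \<theta>^i \<zeta>^i is a binomial sum cut off at s = N, so its
  invariance is a telescoping sum, whose last term has to be killed separately, by Grassmann degree.

  Uniqueness uses locality with the generators only, whereas the axioms ask for locality of any two
  states. The state fields are therefore required to be local with every field that is local with
  the generators; this is a condition on one field at a time, and linear in it.\<close>

section \<open>Parities\<close>

text \<open>As simplification rules these turn sums of parities into case distinctions.\<close>

declare add_bit_eq_xor [simp del] mult_bit_eq_and [simp del]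

lemmas scaleC_add = superspace.scale_right_distrib
  and scaleC_diff = superspace.scale_right_diff_distrib
  and scaleC_sum = superspace.scale_sum_right

abbreviation cardp :: "'a set \<Rightarrow> bit" where
  "cardp K \<equiv> of_nat (card K)"

lemma psign_add: "psign (p + q) = psign p * psign q"
  by (cases p; cases q) (simp_all add: psign_def)

lemma psign_0 [simp]: "psign 0 = 1"
  and psign_1 [simp]: "psign 1 = - 1"
  by (simp_all add: psign_def)

lemma psign_square [simp]: "psign p * psign p = 1"
  by (cases p) simp_all

lemma psign_square' [simp]: "psign p * (psign p * c) = c"
  by (cases p) simp_all

lemma psign_neq_0 [simp]: "psign p \<noteq> 0"
  by (cases p) simp_all

lemma psign_of_nat: "psign (of_nat n) = (- 1) ^ n"
  by (induction n) (simp_all add: psign_add)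

lemma bit_double [simp]: "p + p = (0::bit)" "p + (p + q) = (q::bit)"
  by (cases p; cases q; simp)+

lemma sum_bit: "(\<Sum>p\<in>{0, 1}. f p) = f q + f (q + 1 :: bit)"
  for f :: "bit \<Rightarrow> 'a::comm_monoid_add"
  by (cases q) (simp_all add: add.commute)

section \<open>Homogeneous components of vectors\<close>

lemma graded_minus: "x \<in> graded p \<Longrightarrow> - x \<in> graded p"
  using graded_scaleC[of x p "-1"] by simp

lemma graded_diff: "x \<in> graded p \<Longrightarrow> y \<in> graded p \<Longrightarrow> x - y \<in> graded p"
  using graded_add[of x p "- y"] graded_minus[of y p] by simp

lemma graded_sum_set: "(\<And>i. i \<in> I \<Longrightarrow> f i \<in> graded p) \<Longrightarrow> sum f I \<in> graded p"
  by (induction I rule: infinite_finite_induct) (auto simp: graded_zero graded_add)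

lemma graded_disjoint: "x \<in> graded p \<Longrightarrow> x \<in> graded (p + 1) \<Longrightarrow> x = 0"
  using graded_Int by (cases p) auto

lemma part_unique:
  fixes v :: "'v::superspace"
  shows "\<exists>!x. x \<in> graded p \<and> v - x \<in> graded (p + 1)"
proof -
  obtain y z where yz: "y \<in> graded 0" "z \<in> graded 1" "v = y + z"
    using graded_sum by blast
  have "\<exists>x. x \<in> graded p \<and> v - x \<in> graded (p + 1)"
    using yz by (cases p) (auto intro: exI[of _ y] exI[of _ z])
  moreover have "x = x'" if "x \<in> graded p" "v - x \<in> graded (p + 1)" "x' \<in> graded p"
    "v - x' \<in> graded (p + 1)" for x x'
  proof -
    have "x - x' \<in> graded p" using that graded_diff by blast
    moreover have "x - x' = (v - x') - (v - x)" by simp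
    then have "x - x' \<in> graded (p + 1)" using that graded_diff by metis
    ultimately show ?thesis using graded_disjoint by fastforce
  qed
  ultimately show ?thesis by blast
qed

lemma part_graded [simp]: "part p v \<in> graded p"
  and part_compl: "v - part p v \<in> graded (p + 1)"
  using theI'[OF part_unique[of p v]] by (auto simp: part_def)

lemma part_eqI: "x \<in> graded p \<Longrightarrow> v - x \<in> graded (p + 1) \<Longrightarrow> part p v = x"
  using part_unique[of p v] part_graded part_compl by blast

lemma part_same: "v \<in> graded p \<Longrightarrow> part p v = v"
  by (rule part_eqI) (simp_all add: graded_zero)

lemma part_other: "v \<in> graded q \<Longrightarrow> q \<noteq> p \<Longrightarrow> part p v = 0"
  by (rule part_eqI) (cases p; cases q; simp_all add: graded_zero)+

lemma part_add: "part p (v + w) = part p v + part p w"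
proof (rule part_eqI)
  have "v + w - (part p v + part p w) = (v - part p v) + (w - part p w)" by simp
  then show "v + w - (part p v + part p w) \<in> graded (p + 1)"
    using part_compl graded_add by metis
qed (simp add: graded_add)

lemma part_scaleC: "part p (c *\<^sub>C v) = c *\<^sub>C part p v"
  by (rule part_eqI)
    (simp_all add: graded_scaleC part_compl flip: scaleC_diff)

lemma part_sum: "part p v + part (p + 1) v = v"
proof -
  have "part (p + 1) v = v - part p v"
    by (rule part_eqI) (simp_all add: part_compl add.assoc)
  then show ?thesis by simp
qed

lemma part_zero [simp]: "part p 0 = 0"
  by (simp add: part_same graded_zero)

section \<open>Endomorphisms, their parities and homogeneous parts\<close>

lemma endoI:
  "(\<And>v w. A (v + w) = A v + A w) \<Longrightarrow> (\<And>c v. A (c *\<^sub>C v) = c *\<^sub>C A v) \<Longrightarrow> endo A"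
  unfolding endo_def by unfold_locales auto

lemma endo_add: "endo A \<Longrightarrow> A (v + w) = A v + A w"
  unfolding endo_def by (rule Vector_Spaces.linear.axioms(3)[THEN module_hom.add])

lemma endo_scaleC: "endo A \<Longrightarrow> A (c *\<^sub>C v) = c *\<^sub>C A v"
  unfolding endo_def by (rule Vector_Spaces.linear.axioms(3)[THEN module_hom.scale])

lemma endo_zero: "endo A \<Longrightarrow> A 0 = 0"
  using endo_scaleC[of A 0 0] by simp

lemma endo_minus: "endo A \<Longrightarrow> A (- v) = - A v"
  using endo_scaleC[of A "-1" v] by simp

lemma endo_diff: "endo A \<Longrightarrow> A (v - w) = A v - A w"
  using endo_add[of A v "- w"] by (simp add: endo_minus)

lemma endo_sum: "endo A \<Longrightarrow> A (sum f I) = (\<Sum>i\<in>I. A (f i))"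
  by (induction I rule: infinite_finite_induct) (simp_all add: endo_zero endo_add)

lemma endo_zero_op [simp]: "endo (\<lambda>v. 0)"
  by (rule endoI) simp_all

lemma endo_op_part: "endo A \<Longrightarrow> endo (op_part p A)"
  unfolding op_part_def
  by (rule endoI) (simp_all add: part_add part_scaleC endo_add endo_scaleC
    scaleC_add add_ac)

lemma op_parity_zero [simp]: "op_parity p (\<lambda>v. 0)"
  by (simp add: op_parity_def graded_zero)

lemma op_parityD: "op_parity p A \<Longrightarrow> v \<in> graded q \<Longrightarrow> A v \<in> graded (p + q)"
  by (simp add: op_parity_def)

lemma op_part_same:
  assumes "endo A" "op_parity p A" shows "op_part p A = A"
proof
  fix v
  have *: "part (p + q) (A (part q v)) = A (part q v)" for q
    using op_parityD[OF assms(2) part_graded] by (rule part_same)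
  show "op_part p A v = A v"
    unfolding op_part_def * sum_bit[where q = 0]
    using endo_add[OF assms(1), of "part 0 v" "part (0 + 1) v"] unfolding part_sum by simp
qed

lemma op_part_other:
  assumes "op_parity p A" "q \<noteq> p" shows "op_part q A = (\<lambda>v. 0)"
proof
  fix v
  have *: "part (q + r) (A (part r v)) = 0" for r
    using op_parityD[OF assms(1) part_graded] assms(2) by (intro part_other) auto
  show "op_part q A v = 0"
    unfolding op_part_def by (simp add: *)
qed

lemma op_part_add: "op_part p (\<lambda>v. A v + B v) v = op_part p A v + op_part p B v"
  by (simp add: op_part_def part_add add_ac)

lemma op_part_zero [simp]: "op_part p (\<lambda>v. 0) = (\<lambda>v. 0)"
  by (simp add: op_part_def fun_eq_iff)

lemma gcross_homog:
  assumes "endo A" "op_parity p A"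
  shows "gcross M A v = psign (p * cardp M) *\<^sub>C A v"
  unfolding gcross_def sum_bit[where q = p]
  by (simp add: op_part_same[OF assms] op_part_other[OF assms(2)])

lemma field_endo: "is_field N a \<Longrightarrow> endo (a n I)"
  and field_support: "is_field N a \<Longrightarrow> \<not> I \<subseteq> {1..N} \<Longrightarrow> a n I = (\<lambda>v. 0)"
  and field_trunc: "is_field N a \<Longrightarrow> \<exists>n0. \<forall>n<n0. \<forall>I. a n I v = 0"
  by (simp_all add: is_field_def)

lemma field_part_same: "is_field N a \<Longrightarrow> field_parity p a \<Longrightarrow> field_part p a = a"
  by (simp add: field_part_def field_parity_def op_part_same field_endo fun_eq_iff)

lemma field_part_other:
  assumes "field_parity p a" "q \<noteq> p"
  shows "field_part q a = (\<lambda>n I v. 0)"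
proof -
  have "op_part (q + cardp I) (a n I) = (\<lambda>v. 0)" for n I
    using assms by (intro op_part_other[of "p + cardp I"]) (auto simp: field_parity_def)
  then show ?thesis by (simp add: field_part_def fun_eq_iff)
qed

section \<open>Expansions of powers of \<open>z - w\<close>\<close>

text \<open>No finiteness hypothesis: a nonzero scalar does not change the support, so both sides
  take the default value 0 of \<open>Sum_any\<close> together.\<close>

lemma Sum_any_scaleC: "c *\<^sub>C Sum_any g = Sum_any (\<lambda>x. c *\<^sub>C g x)"
  by (cases "c = 0") (simp_all add: Sum_any.expand_set scaleC_sum)

lemma Sum_any_endo:
  assumes "endo h" "finite {x. g x \<noteq> 0}"
  shows "h (Sum_any g) = Sum_any (\<lambda>x. h (g x))"
proof -
  have "Sum_any (\<lambda>x. h (g x)) = (\<Sum>x\<in>{x. g x \<noteq> 0}. h (g x))"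
    using assms(2) by (rule Sum_any.expand_superset) (auto simp: endo_zero[OF assms(1)])
  then show ?thesis by (simp add: Sum_any.expand_set endo_sum[OF assms(1)])
qed

lemma Sum_any_sum:
  assumes "finite S" "\<And>s. s \<in> S \<Longrightarrow> finite {x. f s x \<noteq> 0}"
  shows "Sum_any (\<lambda>x. \<Sum>s\<in>S. f s x) = (\<Sum>s\<in>S. Sum_any (f s))"
    and "finite {x. (\<Sum>s\<in>S. f s x) \<noteq> 0}"
proof -
  have "Sum_any (\<lambda>x. \<Sum>s\<in>S. f s x) = (\<Sum>s\<in>S. Sum_any (f s)) \<and> finite {x. (\<Sum>s\<in>S. f s x) \<noteq> 0}"
    using assms
  proof (induction S rule: finite_induct)
    case (insert s S)
    have fin: "finite {x. f s x \<noteq> 0}" "finite {x. (\<Sum>s\<in>S. f s x) \<noteq> 0}"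
      using insert by auto
    have "finite {x. f s x + (\<Sum>s\<in>S. f s x) \<noteq> 0}"
      by (rule finite_subset[OF _ finite_UnI[OF fin]]) auto
    then show ?case
      using insert Sum_any.distrib[OF fin] by simp
  qed simp
  then show "Sum_any (\<lambda>x. \<Sum>s\<in>S. f s x) = (\<Sum>s\<in>S. Sum_any (f s))"
    and "finite {x. (\<Sum>s\<in>S. f s x) \<noteq> 0}" by auto
qed

section \<open>Multiplication of distributions by expanded powers of z - w\<close>

definition shift_diff :: "(int \<Rightarrow> int \<Rightarrow> 'v::ab_group_add) \<Rightarrow> int \<Rightarrow> int \<Rightarrow> 'v" where
  "shift_diff f m k = f (m - 1) k - f m (k - 1)"

text \<open>The derivatives in z and, below, in w; \<open>shift_diff\<close> above is multiplication
  by z - w.\<close>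

definition diff1 :: "(int \<Rightarrow> int \<Rightarrow> 'v::superspace) \<Rightarrow> int \<Rightarrow> int \<Rightarrow> 'v" where
  "diff1 f m k = of_int (m + 1) *\<^sub>C f (m + 1) k"

definition diff2 :: "(int \<Rightarrow> int \<Rightarrow> 'v::superspace) \<Rightarrow> int \<Rightarrow> int \<Rightarrow> 'v" where
  "diff2 f m k = of_int (k + 1) *\<^sub>C f m (k + 1)"

type_synonym expansion = "int \<Rightarrow> int \<Rightarrow> int \<Rightarrow> complex"

text \<open>Where \<open>conv_fin\<close> fails, \<open>conv\<close> has the junk value \<open>0\<close> of \<open>Sum_any\<close>.\<close>

definition conv_fin :: "expansion \<Rightarrow> int \<Rightarrow> (int \<Rightarrow> int \<Rightarrow> 'v::superspace) \<Rightarrow> bool" where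
  "conv_fin e n f \<longleftrightarrow> (\<forall>m k. finite {(m', k'). e n m' k' \<noteq> 0 \<and> f (m - m') (k - k') \<noteq> 0})"

definition conv :: "expansion \<Rightarrow> int \<Rightarrow> (int \<Rightarrow> int \<Rightarrow> 'v::superspace) \<Rightarrow> int \<Rightarrow> int \<Rightarrow> 'v" where
  "conv e n f m k = Sum_any (\<lambda>(m', k'). e n m' k' *\<^sub>C f (m - m') (k - k'))"

lemma conv_finD: "conv_fin e n f \<Longrightarrow> finite {p. (case p of (m', k') \<Rightarrow> e n m' k' *\<^sub>C f (m - m') (k -
  k')) \<noteq> 0}"
  by (simp add: conv_fin_def case_prod_unfold)

lemma conv_fin_mono:
  assumes "conv_fin e n f" "\<And>m k. f m k = 0 \<Longrightarrow> g m k = 0"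
  shows "conv_fin e n g"
  using assms(1) unfolding conv_fin_def by (fast intro: finite_subset[rotated] dest: assms(2))

lemma conv_fin_add:
  assumes "conv_fin e n f" "conv_fin e n g" shows "conv_fin e n (\<lambda>m k. f m k + g m k)"
  unfolding conv_fin_def
proof (intro allI)
  fix m k
  show "finite {(m', k'). e n m' k' \<noteq> 0 \<and> f (m - m') (k - k') + g (m - m') (k - k') \<noteq> 0}"
    by (rule finite_subset[of _ "{(m', k'). e n m' k' \<noteq> 0 \<and> f (m - m') (k - k') \<noteq> 0} \<union>
      {(m', k'). e n m' k' \<noteq> 0 \<and> g (m - m') (k - k') \<noteq> 0}"])
      (use assms in \<open>auto simp: conv_fin_def\<close>)
qed

lemma conv_fin_scaleC: "conv_fin e n f \<Longrightarrow> conv_fin e n (\<lambda>m k. c *\<^sub>C f m k)"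
  by (rule conv_fin_mono) auto

lemma conv_fin_zero: "conv_fin e n (\<lambda>m k. 0)"
  by (simp add: conv_fin_def)

lemma conv_fin_endo: "conv_fin e n f \<Longrightarrow> endo h \<Longrightarrow> conv_fin e n (\<lambda>m k. h (f m k))"
  by (rule conv_fin_mono[of e n f]) (auto simp: endo_zero)

lemma conv_fin_diff: "conv_fin e n f \<Longrightarrow> conv_fin e n g \<Longrightarrow> conv_fin e n (\<lambda>m k. f m k - g m k)"
  using conv_fin_add[of e n f "\<lambda>m k. (- 1) *\<^sub>C g m k"] conv_fin_scaleC[of e n g "- 1"] by simp

lemma conv_fin_sum: "(\<And>s. s \<in> S \<Longrightarrow> conv_fin e n (f s)) \<Longrightarrow> conv_fin e n (\<lambda>m k. \<Sum>s\<in>S. f s m k)"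
  by (induction S rule: infinite_finite_induct) (auto simp: conv_fin_zero conv_fin_add)

lemma conv_fin_shift:
  assumes "conv_fin e n f" shows "conv_fin e n (\<lambda>m k. f (m + i) (k + j))"
  unfolding conv_fin_def
proof (intro allI)
  fix m k
  have "finite {(m', k'). e n m' k' \<noteq> 0 \<and> f (m + i - m') (k + j - k') \<noteq> 0}"
    using assms unfolding conv_fin_def by blast
  then show "finite {(m', k'). e n m' k' \<noteq> 0 \<and> f (m - m' + i) (k - k' + j) \<noteq> 0}"
    by (simp add: algebra_simps)
qed

lemma conv_fin_diff1: "conv_fin e n f \<Longrightarrow> conv_fin e n (diff1 f)"
  using conv_fin_shift[of e n f 1 0] unfolding diff1_def by (rule conv_fin_mono) auto

lemma conv_fin_diff2: "conv_fin e n f \<Longrightarrow> conv_fin e n (diff2 f)"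
  using conv_fin_shift[of e n f 0 1] unfolding diff2_def by (rule conv_fin_mono) auto

lemma conv_add:
  assumes "conv_fin e n f" "conv_fin e n g"
  shows "conv e n (\<lambda>m k. f m k + g m k) m k = conv e n f m k + conv e n g m k"
  unfolding conv_def
  by (subst Sum_any.distrib[OF conv_finD[OF assms(1)] conv_finD[OF assms(2)], symmetric])
    (simp add: scaleC_add case_prod_unfold)

lemma conv_scaleC: "conv e n (\<lambda>m k. c *\<^sub>C f m k) m k = c *\<^sub>C conv e n f m k"
  unfolding conv_def Sum_any_scaleC by (simp add: case_prod_unfold mult.commute)

lemma conv_diff:
  assumes "conv_fin e n f" "conv_fin e n g"
  shows "conv e n (\<lambda>m k. f m k - g m k) m k = conv e n f m k - conv e n g m k"
  using conv_add[OF assms(1) conv_fin_scaleC[OF assms(2), of "-1"]] conv_scaleC[of e n "-1" g]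
  by simp

lemma conv_zero [simp]: "conv e n (\<lambda>m k. 0) m k = 0"
  by (simp add: conv_def case_prod_unfold)

lemma conv_endo:
  assumes "conv_fin e n f" "endo h"
  shows "conv e n (\<lambda>m k. h (f m k)) m k = h (conv e n f m k)"
  unfolding conv_def
  by (subst Sum_any_endo[OF assms(2) conv_finD[OF assms(1)]])
    (simp add: case_prod_unfold endo_scaleC[OF assms(2)])

lemma conv_sum:
  assumes "finite S" "\<And>s. s \<in> S \<Longrightarrow> conv_fin e n (f s)"
  shows "conv e n (\<lambda>m k. \<Sum>s\<in>S. f s m k) m k = (\<Sum>s\<in>S. conv e n (f s) m k)"
  using assms
  by (induction S rule: finite_induct) (auto simp: conv_add conv_fin_sum)

text \<open>The assumptions are the two derivatives of (z-w)^n, the rule (z-w)(z-w)^n = (z-w)^(n+1),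
  and (z-w)^0 = 1. They hold in both domains of expansion, so the calculus below is derived once and
  serves both orders of a product.\<close>

locale expansion =
  fixes e :: expansion
  assumes e_diff1: "of_int (m + 1) * e n (m + 1) k = of_int n * e (n - 1) m k"
    and e_diff2: "of_int (k + 1) * e n m (k + 1) = - of_int n * e (n - 1) m k"
    and e_shift_diff: "e n (m - 1) k - e n m (k - 1) = e (n + 1) m k"
    and e_0: "e 0 m k = (if m = 0 \<and> k = 0 then 1 else 0)"
begin

lemma bij_shift:
  fixes i j :: int
  shows "bij (\<lambda>(m, k). (m + i, k + j))"
  by (rule o_bij[of "\<lambda>(m, k). (m - i, k - j)"]) auto

lemma Sum_any_shift:
  fixes i j :: int
  shows "Sum_any (\<lambda>(m, k). g (m + i) (k + j)) = Sum_any (\<lambda>(m, k). g m k)"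
  by (rule Sum_any.reindex_cong[OF bij_shift[of i j], symmetric]) auto

lemma finite_shift:
  fixes i j :: int
  assumes "finite {(m, k). P m k}"
  shows "finite {(m, k). P (m + i) (k + j)}"
proof -
  have "{(m, k). P (m + i) (k + j)} = (\<lambda>(m, k). (m - i, k - j)) ` {(m, k). P m k}"
    by (force simp: image_iff)
  then show ?thesis using assms by simp
qed

lemma conv_0: "conv e 0 f = f"
proof (intro ext)
  fix m k
  have "conv e 0 f m k = Sum_any (\<lambda>p. if p = (0 :: int, 0 :: int) then f m k else 0)"
    unfolding conv_def by (intro arg_cong[where f = Sum_any] ext) (simp add: e_0 case_prod_unfold
      prod_eq_iff)
  then show "conv e 0 f m k = f m k" by simp
qed

text \<open>Leibniz rule: the factor m + 1 = (m + 1 - m') + m' distributes the derivative over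
  \<open>f\<close> and (z-w)^n.\<close>

lemma conv_diff1:
  assumes "conv_fin e n f" "conv_fin e (n - 1) f"
  shows "diff1 (conv e n f) m k = conv e n (diff1 f) m k + of_int n *\<^sub>C conv e (n - 1) f m k"
proof -
  let ?A = "\<lambda>m' k'. (of_int m' * e n m' k') *\<^sub>C f (m + 1 - m') (k - k')"
  have "diff1 (conv e n f) m k =
      Sum_any (\<lambda>(m', k'). e n m' k' *\<^sub>C diff1 f (m - m') (k - k') + ?A m' k')"
    unfolding diff1_def conv_def Sum_any_scaleC
    by (rule Sum_any.cong) (auto simp: algebra_simps simp flip: superspace.scale_left_distrib)
  also have "\<dots> = conv e n (diff1 f) m k + Sum_any (\<lambda>(m', k'). ?A m' k')"
  proof -
    have fin: "finite {p. (case p of (m', k') \<Rightarrow> ?A m' k') \<noteq> 0}"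
      by (rule finite_subset[OF _ conv_finD[OF assms(1), of "m + 1" k]]) auto
    show ?thesis unfolding conv_def
      by (subst Sum_any.distrib[OF conv_finD[OF conv_fin_diff1[OF assms(1)]] fin, symmetric])
        (simp add: case_prod_unfold)
  qed
  also have "Sum_any (\<lambda>(m', k'). ?A m' k') = Sum_any (\<lambda>(m', k'). ?A (m' + 1) (k' + 0))"
    by (rule Sum_any_shift[symmetric])
  also have "\<dots> = of_int n *\<^sub>C conv e (n - 1) f m k"
    unfolding conv_def Sum_any_scaleC
    by (rule Sum_any.cong) (auto simp: e_diff1[simplified])
  finally show ?thesis .
qed

lemma conv_diff2:
  assumes "conv_fin e n f" "conv_fin e (n - 1) f"
  shows "diff2 (conv e n f) m k = conv e n (diff2 f) m k - of_int n *\<^sub>C conv e (n - 1) f m k"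
proof -
  let ?A = "\<lambda>m' k'. (of_int k' * e n m' k') *\<^sub>C f (m - m') (k + 1 - k')"
  have "diff2 (conv e n f) m k =
      Sum_any (\<lambda>(m', k'). e n m' k' *\<^sub>C diff2 f (m - m') (k - k') + ?A m' k')"
    unfolding diff2_def conv_def Sum_any_scaleC
    by (rule Sum_any.cong) (auto simp: algebra_simps simp flip: superspace.scale_left_distrib)
  also have "\<dots> = conv e n (diff2 f) m k + Sum_any (\<lambda>(m', k'). ?A m' k')"
  proof -
    have fin: "finite {p. (case p of (m', k') \<Rightarrow> ?A m' k') \<noteq> 0}"
      by (rule finite_subset[OF _ conv_finD[OF assms(1), of m "k + 1"]]) auto
    show ?thesis unfolding conv_def
      by (subst Sum_any.distrib[OF conv_finD[OF conv_fin_diff2[OF assms(1)]] fin, symmetric])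
        (simp add: case_prod_unfold)
  qed
  also have "Sum_any (\<lambda>(m', k'). ?A m' k') = Sum_any (\<lambda>(m', k'). ?A (m' + 0) (k' + 1))"
    by (rule Sum_any_shift[symmetric])
  also have "\<dots> = (- of_int n) *\<^sub>C conv e (n - 1) f m k"
    unfolding conv_def Sum_any_scaleC
    by (rule Sum_any.cong) (auto simp: e_diff2[simplified])
  finally show ?thesis by simp
qed

text \<open>The coefficients of (z-w)^(n+1) are differences of shifted coefficients of (z-w)^n, so
  summability passes upwards in n.\<close>

lemma conv_fin_Suc:
  assumes "conv_fin e n f" shows "conv_fin e (n + 1) f"
  unfolding conv_fin_def
proof (intro allI)
  fix m k
  let ?P = "\<lambda>i j m' k'. e n m' k' \<noteq> 0 \<and> f (m + i - m') (k + j - k') \<noteq> 0"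
  have fin: "finite {(m', k'). ?P (-1) 0 (m' + - 1) (k' + 0)}" "finite {(m', k'). ?P 0 (-1) (m' +
    0) (k' + - 1)}"
    using assms by (intro finite_shift; simp add: conv_fin_def)+
  show "finite {(m', k'). e (n + 1) m' k' \<noteq> 0 \<and> f (m - m') (k - k') \<noteq> 0}"
    by (rule finite_subset[OF _ finite_UnI[OF fin]]) (auto simp flip: e_shift_diff)
qed

lemma shift_diff_conv:
  assumes "conv_fin e n f"
  shows "shift_diff (conv e n f) = conv e (n + 1) f"
proof (intro ext)
  fix m k
  let ?A = "\<lambda>m' k'. e n (m' - 1) k' *\<^sub>C f (m - m') (k - k')"
  let ?B = "\<lambda>m' k'. e n m' (k' - 1) *\<^sub>C f (m - m') (k - k')"
  have "finite {(m', k'). e n m' k' \<noteq> 0 \<and> f (m - m') (k - 1 - k') \<noteq> 0}"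
    using assms by (simp add: conv_fin_def)
  from finite_shift[OF this, of 0 "- 1"]
  have fin: "finite {p. (case p of (m', k') \<Rightarrow> ?B m' k') \<noteq> 0}"
    by (simp add: case_prod_unfold)
  have "conv e n f (m - 1) k = Sum_any (\<lambda>(m', k'). ?A m' k')"
    unfolding conv_def
    by (subst Sum_any_shift[of "?A" 1 0, symmetric]) (simp add: algebra_simps)
  moreover have "conv e n f m (k - 1) = Sum_any (\<lambda>(m', k'). ?B m' k')"
    unfolding conv_def
    by (subst Sum_any_shift[of "?B" 0 1, symmetric]) (simp add: algebra_simps)
  moreover have "Sum_any (\<lambda>(m', k'). ?A m' k') =
     conv e (n + 1) f m k + Sum_any (\<lambda>(m', k'). ?B m' k')"
    unfolding conv_def
    by (subst Sum_any.distrib[OF conv_finD[OF conv_fin_Suc[OF assms]] fin, symmetric])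
       (simp add: case_prod_unfold flip: e_shift_diff superspace.scale_left_distrib)
  ultimately show "shift_diff (conv e n f) m k = conv e (n + 1) f m k"
    by (simp add: shift_diff_def)
qed

end

lemma gchoose_absorb: "of_nat (Suc k) * (a gchoose Suc k) = a * ((a - 1) gchoose k)" for a :: complex
  using gbinomial_absorption[of k a] by simp

lemma gchoose_absorb_comp: "(a - of_nat k) * (a gchoose k) = a * ((a - 1) gchoose k)" for a :: complex
  using gbinomial_absorb_comp[of a k] by simp

lemma powi_minus_one_Suc: "(- 1 :: complex) powi (k + 1) = - ((- 1) powi k)"
  by (simp add: power_int_add)

lemma powi_minus_one_pred: "(- 1 :: complex) powi (k - 1) = - ((- 1) powi k)"
  by (simp add: power_int_diff)

text \<open>(z-w)^n = (-1)^n (w-z)^n: exchanging the variables carries one expansion into the other,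
  and the second interpretation below follows from the first.\<close>

lemma exp_wz_eq: "exp_wz n m k = (- 1) powi n * exp_zw n k m"
  by (auto simp: exp_wz_def exp_zw_def power_int_add simp flip: power_mult_distrib)

interpretation zw: expansion exp_zw
proof
  fix n m k :: int
  show "of_int (m + 1) * exp_zw n (m + 1) k = of_int n * exp_zw (n - 1) m k"
  proof (cases "0 \<le> k \<and> m + 1 + k = n")
    case True
    then have "of_int (m + 1) = (of_int n - of_nat (nat k) :: complex)"
      by (simp add: algebra_simps flip: of_int_add)
    then show ?thesis using True gchoose_absorb_comp[of "of_int n" "nat k"]
      by (auto simp: exp_zw_def)
  qed (auto simp: exp_zw_def)
  show "of_int (k + 1) * exp_zw n m (k + 1) = - of_int n * exp_zw (n - 1) m k"
  proof (cases "0 \<le> k \<and> m + 1 + k = n")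
    case True
    then have "nat (k + 1) = Suc (nat k)" "of_int (k + 1) = (of_nat (Suc (nat k)) :: complex)" by auto
    then show ?thesis using True gchoose_absorb[of "nat k" "of_int n"]
      by (auto simp: exp_zw_def power_int_add add_ac)
  next
    case False
    \<comment> \<open>At k = -1 the coefficient on the left may be nonzero; it is the factor k + 1
      that vanishes.\<close>
    then show ?thesis by (cases "k = - 1") (auto simp: exp_zw_def)
  qed
  show "exp_zw n (m - 1) k - exp_zw n m (k - 1) = exp_zw (n + 1) m k"
  proof (cases "0 \<le> k \<and> m - 1 + k = n")
    case True
    show ?thesis
    proof (cases "k = 0")
      case False
      with True have "k - 1 \<ge> 0" by linarith
      then obtain t where "k - 1 = int t" by (rule nonneg_int_cases)
      then have t: "k = 1 + int t" by simp
      have "nat (int t) = t" "nat (1 + int t) = Suc t" by auto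
      then show ?thesis using True t gbinomial_Suc_Suc[of "of_int n :: complex" t]
        by (auto simp: exp_zw_def power_int_add algebra_simps)
    qed (use True in \<open>auto simp: exp_zw_def\<close>)
  qed (auto simp: exp_zw_def)
  show "exp_zw 0 m k = (if m = 0 \<and> k = 0 then 1 else 0)"
  proof (cases "k \<le> 0")
    case False
    then have "nat k = Suc (nat (k - 1))" by simp
    then show ?thesis by (simp add: exp_zw_def gbinomial_0(2))
  qed (auto simp: exp_zw_def)
qed

interpretation wz: expansion exp_wz
proof
  fix n m k :: int
  show "of_int (m + 1) * exp_wz n (m + 1) k = of_int n * exp_wz (n - 1) m k"
    using zw.e_diff2[of m n k] by (simp add: exp_wz_eq powi_minus_one_pred mult.left_commute[of _
      "(- 1) powi n"])
  show "of_int (k + 1) * exp_wz n m (k + 1) = - of_int n * exp_wz (n - 1) m k"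
    using zw.e_diff1[of k n m] by (simp add: exp_wz_eq powi_minus_one_pred mult.left_commute[of _
      "(- 1) powi n"])
  show "exp_wz n (m - 1) k - exp_wz n m (k - 1) = exp_wz (n + 1) m k"
    using zw.e_shift_diff[of n k m]
    by (simp add: exp_wz_eq powi_minus_one_Suc right_diff_distrib flip: minus_mult_right) (simp
      add: algebra_simps)
  show "exp_wz 0 m k = (if m = 0 \<and> k = 0 then 1 else 0)"
    by (auto simp: exp_wz_eq zw.e_0)
qed

text \<open>For |z| > |w| the exponents of w in (z-w)^n are nonnegative and the total degree is n,
  so a lower bound for the w-exponents of \<open>f\<close> leaves finitely many terms.\<close>

lemma conv_fin_zw:
  assumes "\<And>m k. k < k0 \<Longrightarrow> f m k = 0"
  shows "conv_fin exp_zw n f"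
  unfolding conv_fin_def
proof (intro allI)
  fix m k
  show "finite {(m', k'). exp_zw n m' k' \<noteq> 0 \<and> f (m - m') (k - k') \<noteq> 0}"
  proof (rule finite_subset)
    show "{(m', k'). exp_zw n m' k' \<noteq> 0 \<and> f (m - m') (k - k') \<noteq> 0} \<subseteq> (\<lambda>k'. (n - k', k')) ` {0..k - k0}"
      using assms by (fastforce simp: exp_zw_def image_iff not_less split: if_splits)
  qed simp
qed

lemma conv_fin_wz:
  assumes "\<And>m k. m < m0 \<Longrightarrow> f m k = 0"
  shows "conv_fin exp_wz n f"
  unfolding conv_fin_def
proof (intro allI)
  fix m k
  show "finite {(m', k'). exp_wz n m' k' \<noteq> 0 \<and> f (m - m') (k - k') \<noteq> 0}"
  proof (rule finite_subset)
    show "{(m', k'). exp_wz n m' k' \<noteq> 0 \<and> f (m - m') (k - k') \<noteq> 0} \<subseteq> (\<lambda>m'. (m', n - m')) ` {0..m - m0}"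
      using assms by (fastforce simp: exp_wz_def image_iff not_less split: if_splits)
  qed simp
qed

context expansion
begin

lemma conv_fin_int: "conv_fin e (int n) f"
proof (induction n)
  case 0
  show ?case unfolding conv_fin_def
    by (intro allI, rule finite_subset[of _ "{(0, 0)}"]) (auto simp: e_0 split: if_split_asm)
next
  case (Suc n)
  then show ?case using conv_fin_Suc[of "int n" f] by (simp add: add.commute)
qed

text \<open>For nonnegative exponents both expansions are the same polynomial. In Dong's lemma this
  makes the two orders A B and B A comparable.\<close>

lemma conv_int: "conv e (int n) f = (shift_diff ^^ n) f"
proof (induction n)
  case (Suc n)
  then show ?case
    using shift_diff_conv[OF conv_fin_int, of n f] by (simp add: add.commute)
qed (simp add: conv_0)

end

section \<open>Locality and Dong's lemma\<close>

definition additive_op :: "('a::ab_group_add \<Rightarrow> 'a) \<Rightarrow> bool" where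
  "additive_op D \<longleftrightarrow> (\<forall>f g. D (f - g) = D f - D g)"

lemma additive_op_funpow: "additive_op D \<Longrightarrow> additive_op (D ^^ n)"
  by (induction n) (auto simp: additive_op_def)

lemma additive_op_zero: "additive_op D \<Longrightarrow> D 0 = 0"
  unfolding additive_op_def by (metis diff_self)

lemma funpow_commute:
  fixes D D' :: "'a \<Rightarrow> 'a"
  assumes "\<And>f. D (D' f) = D' (D f)"
  shows "(D ^^ n) (D' f) = D' ((D ^^ n) f)" and "(D ^^ n) ((D' ^^ k) f) = (D' ^^ k) ((D ^^ n) f)"
proof -
  show *: "(D ^^ n) (D' f) = D' ((D ^^ n) f)" for f
    by (induction n) (simp_all add: assms)
  show "(D ^^ n) ((D' ^^ k) f) = (D' ^^ k) ((D ^^ n) f)"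
    by (induction k) (simp_all add: *)
qed

text \<open>With \<open>D2 = D3 - D1\<close> this is the binomial expansion of \<open>D2\<^sup>N\<close>.\<close>

lemma funpow_diff_eq_0:
  fixes D1 D2 D3 :: "'a::ab_group_add \<Rightarrow> 'a"
  assumes D: "\<And>f. D2 f = D3 f - D1 f"
    and comm: "\<And>f. D1 (D3 f) = D3 (D1 f)"
    and add: "additive_op D1" "additive_op D3"
    and kill: "\<And>s t. s + t = N \<Longrightarrow> (D1 ^^ s) ((D3 ^^ t) f) = 0"
  shows "(D2 ^^ N) f = 0"
  using kill
proof (induction N arbitrary: f)
  case (Suc N)
  have "(D1 ^^ s) ((D3 ^^ t) (D3 f - D1 f)) = 0" if "s + t = N" for s t
  proof -
    have "(D1 ^^ s) ((D3 ^^ t) (D3 f - D1 f)) =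
        (D1 ^^ s) ((D3 ^^ Suc t) f) - (D1 ^^ Suc s) ((D3 ^^ t) f)"
      using additive_op_funpow[OF add(1), of s] additive_op_funpow[OF add(2), of t]
      by (simp add: additive_op_def funpow_commute(1)[of D3 D1, OF comm[symmetric]] funpow_swap1)
    then show ?thesis using Suc.prems[of s "Suc t"] Suc.prems[of "Suc s" t] that by simp
  qed
  from Suc.IH[OF this] show ?case by (simp add: D funpow_Suc_right del: funpow.simps)
qed (use kill[of 0 0] in auto)

section \<open>Distributions in three variables z, w, x\<close>

type_synonym 'v dist3 = "int \<Rightarrow> int \<Rightarrow> int \<Rightarrow> 'v"

text \<open>Multiplication by z - w; the two definitions below are multiplication by w - x and by z
  - x.\<close>

definition sd12 :: "'v::superspace dist3 \<Rightarrow> 'v dist3" where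
  "sd12 f m k l = f (m - 1) k l - f m (k - 1) l"

definition sd23 :: "'v::superspace dist3 \<Rightarrow> 'v dist3" where
  "sd23 f m k l = f m (k - 1) l - f m k (l - 1)"

definition sd13 :: "'v::superspace dist3 \<Rightarrow> 'v dist3" where
  "sd13 f m k l = f (m - 1) k l - f m k (l - 1)"

lemmas sd_defs = sd12_def sd23_def sd13_def

lemma sd_additive: "additive_op sd12" "additive_op sd23" "additive_op sd13"
  by (auto simp: additive_op_def sd_defs fun_eq_iff)

lemma sd_commute:
  "sd12 (sd13 f) = sd13 (sd12 f)" "sd12 (sd23 f) = sd23 (sd12 f)" "sd13 (sd23 f) = sd23 (sd13 f)"
  by (auto simp: sd_defs fun_eq_iff)

lemma sd12_funpow: "(sd12 ^^ n) f m k l = (shift_diff ^^ n) (\<lambda>m k. f m k l) m k"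
  by (induction n arbitrary: f m k) (simp_all add: sd12_def shift_diff_def)

lemma sd23_funpow: "(sd23 ^^ n) f m k l = (shift_diff ^^ n) (\<lambda>k l. f m k l) k l"
  by (induction n arbitrary: f k l) (simp_all add: sd23_def shift_diff_def)

lemma sd13_funpow: "(sd13 ^^ n) f m k l = (shift_diff ^^ n) (\<lambda>m l. f m k l) m l"
  by (induction n arbitrary: f m l) (simp_all add: sd13_def shift_diff_def)

lemma shift_diff_funpow_endo:
  "endo h \<Longrightarrow> (shift_diff ^^ n) (\<lambda>m k. h (f m k)) m k = h ((shift_diff ^^ n) f m k)"
  by (induction n arbitrary: m k) (simp_all add: shift_diff_def endo_diff)

lemma shift_diff_funpow_add:
  "(shift_diff ^^ n) (\<lambda>m k. f m k + g m k) =
    (\<lambda>m k. (shift_diff ^^ n) f m k + (shift_diff ^^ n) g m k)"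
  by (induction n) (auto simp: shift_diff_def fun_eq_iff)

lemma shift_diff_funpow_scaleC:
  "(shift_diff ^^ n) (\<lambda>m k. c *\<^sub>C f m k) = (\<lambda>m k. c *\<^sub>C (shift_diff ^^ n) f m k)"
  by (induction n) (auto simp: shift_diff_def fun_eq_iff scaleC_diff)

lemma shift_diff_funpow_swap:
  "(shift_diff ^^ n) (\<lambda>m k. f k m) m k = (- 1) ^ n *\<^sub>C (shift_diff ^^ n) f k m"
  by (induction n arbitrary: m k) (simp_all add: shift_diff_def scaleC_diff)

lemma shift_diff_funpow_zero: "(shift_diff ^^ n) (\<lambda>m k. 0) = (\<lambda>m k. 0)"
  by (induction n) (auto simp: shift_diff_def fun_eq_iff)

lemma shift_diff_funpow_mono:
  assumes "(shift_diff ^^ r) f = (\<lambda>m k. 0)" "r \<le> n"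
  shows "(shift_diff ^^ n) f = (\<lambda>m k. 0)"
proof -
  have "(shift_diff ^^ n) f = (shift_diff ^^ (n - r)) ((shift_diff ^^ r) f)"
    using assms(2) by (simp add: flip: funpow_add[THEN fun_cong, simplified])
  then show ?thesis by (simp add: assms(1) shift_diff_funpow_zero)
qed

text \<open>Below, \<open>\<epsilon>\<close> stands for the sign \<open>(-1)\<^bsup>p(A) p(B)\<^esup>\<close> in the supercommutator of \<open>A\<close> and \<open>B\<close>.\<close>

type_synonym 'v series = "int \<Rightarrow> 'v \<Rightarrow> 'v"

abbreviation bracket :: "complex \<Rightarrow> 'v::superspace series \<Rightarrow> 'v series \<Rightarrow> 'v \<Rightarrow> int \<Rightarrow> int \<Rightarrow> 'v" where
  "bracket \<epsilon> A B v \<equiv> \<lambda>m k. A m (B k v) - \<epsilon> *\<^sub>C B k (A m v)"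

definition mutually_local :: "complex \<Rightarrow> 'v::superspace series \<Rightarrow> 'v series \<Rightarrow> bool" where
  "mutually_local \<epsilon> A B \<longleftrightarrow>
    (\<exists>r. \<forall>v. (shift_diff ^^ r) (bracket \<epsilon> A B v) = (\<lambda>m k. 0))"

definition is_series :: "'v::superspace series \<Rightarrow> bool" where
  "is_series A \<longleftrightarrow> (\<forall>n. endo (A n)) \<and> (\<forall>v. \<exists>n0. \<forall>n<n0. A n v = 0)"

lemma is_series_endo: "is_series A \<Longrightarrow> endo (A n)"
  by (simp add: is_series_def)

lemma is_series_trunc: "is_series A \<Longrightarrow> \<exists>n0. \<forall>n<n0. A n v = 0"
  by (simp add: is_series_def)

lemma is_series_zero: "is_series (\<lambda>n v. 0)"
  by (simp add: is_series_def)

lemma is_series_scaleC: "is_series A \<Longrightarrow> is_series (\<lambda>n v. c *\<^sub>C A n v)"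
  unfolding is_series_def
  by (auto intro!: endoI simp: endo_add endo_scaleC scaleC_add mult.commute) metis

lemma is_series_add:
  assumes "is_series A" "is_series B" shows "is_series (\<lambda>n v. A n v + B n v)"
  unfolding is_series_def
proof (intro conjI allI)
  show "endo (\<lambda>v. A n v + B n v)" for n
    using assms by (auto intro!: endoI simp: is_series_def endo_add endo_scaleC scaleC_add)
  fix v
  obtain n0 n1 where "\<forall>n<n0. A n v = 0" "\<forall>n<n1. B n v = 0"
    using assms is_series_trunc by meson
  then show "\<exists>n0. \<forall>n<n0. A n v + B n v = 0" by (intro exI[of _ "min n0 n1"]) auto
qed

lemma is_series_sum: "(\<And>s. s \<in> S \<Longrightarrow> is_series (A s)) \<Longrightarrow> is_series (\<lambda>n v. \<Sum>s\<in>S. A s n v)"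
  by (induction S rule: infinite_finite_induct) (auto simp: is_series_zero is_series_add)

lemma mutually_local_sym:
  assumes "mutually_local \<epsilon> A B" "\<epsilon> * \<epsilon> = 1" shows "mutually_local \<epsilon> B A"
proof -
  obtain r where r: "\<And>v. (shift_diff ^^ r) (bracket \<epsilon> A B v) = (\<lambda>m k. 0)"
    using assms(1) unfolding mutually_local_def by blast
  have "(bracket \<epsilon> B A v) =
      (\<lambda>m k. (\<lambda>m k. - \<epsilon> *\<^sub>C (A m (B k v) - \<epsilon> *\<^sub>C B k (A m v))) k m)" for v
    using assms(2) by (simp add: scaleC_diff)
  then have "(shift_diff ^^ r) (bracket \<epsilon> B A v) = (\<lambda>m k. 0)" for v
    by (simp only: shift_diff_funpow_swap shift_diff_funpow_scaleC fun_eq_iff r) simp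
  then show ?thesis unfolding mutually_local_def by blast
qed

lemma mutually_local_zero: "is_series B \<Longrightarrow> mutually_local \<epsilon> (\<lambda>n v. 0) B"
  unfolding mutually_local_def by (rule exI[of _ 0]) (simp add: endo_zero[OF is_series_endo])

lemma mutually_local_scaleC:
  assumes "mutually_local \<epsilon> A B" "is_series B" shows "mutually_local \<epsilon> (\<lambda>n v. c *\<^sub>C A n v) B"
proof -
  have "(\<lambda>m k. c *\<^sub>C A m (B k v) - \<epsilon> *\<^sub>C B k (c *\<^sub>C A m v)) =
      (\<lambda>m k. c *\<^sub>C (A m (B k v) - \<epsilon> *\<^sub>C B k (A m v)))" for v
    by (simp add: scaleC_diff endo_scaleC[OF is_series_endo[OF assms(2)]] mult.commute)
  moreover obtain r where "\<And>v. (shift_diff ^^ r) (bracket \<epsilon> A B v) = (\<lambda>m k. 0)"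
    using assms(1) unfolding mutually_local_def by blast
  ultimately show ?thesis
    unfolding mutually_local_def by (intro exI[of _ r]) (simp add: shift_diff_funpow_scaleC)
qed

lemma mutually_local_add:
  assumes "mutually_local \<epsilon> A B" "mutually_local \<epsilon> A' B" "is_series B"
  shows "mutually_local \<epsilon> (\<lambda>n v. A n v + A' n v) B"
proof -
  obtain r r' where r: "\<And>v. (shift_diff ^^ r) (bracket \<epsilon> A B v) = (\<lambda>m k. 0)"
    "\<And>v. (shift_diff ^^ r') (\<lambda>m k. A' m (B k v) - \<epsilon> *\<^sub>C B k (A' m v)) = (\<lambda>m k. 0)"
    using assms(1,2) unfolding mutually_local_def by blast
  have "(\<lambda>m k. A m (B k v) + A' m (B k v) - \<epsilon> *\<^sub>C B k (A m v + A' m v)) =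
      (\<lambda>m k. (A m (B k v) - \<epsilon> *\<^sub>C B k (A m v)) + (A' m (B k v) - \<epsilon> *\<^sub>C B k (A' m v)))" for v
    by (simp add: fun_eq_iff scaleC_add endo_add[OF is_series_endo[OF assms(3)]])
  then show ?thesis
    using shift_diff_funpow_mono[OF r(1), of "max r r'"] shift_diff_funpow_mono[OF r(2), of "max r r'"]
    unfolding mutually_local_def
    by (intro exI[of _ "max r r'"]) (simp add: shift_diff_funpow_add)
qed

lemma mutually_local_sum:
  "(\<And>s. s \<in> S \<Longrightarrow> mutually_local \<epsilon> (A s) B) \<Longrightarrow> is_series B \<Longrightarrow>
    mutually_local \<epsilon> (\<lambda>n v. \<Sum>s\<in>S. A s n v) B"
  by (induction S rule: infinite_finite_induct) (auto simp: mutually_local_zero mutually_local_add)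

text \<open>The ordinary n-th product of series in one even variable: the argument -1 takes the
  residue in z, and k is the exponent of w.\<close>

definition nth_product :: "complex \<Rightarrow> int \<Rightarrow> 'v::superspace series \<Rightarrow> 'v series \<Rightarrow> 'v series" where
  "nth_product \<epsilon> n A B k v = conv exp_zw n (\<lambda>m k. A m (B k v)) (- 1) k
     - \<epsilon> *\<^sub>C conv exp_wz n (\<lambda>m k. B k (A m v)) (- 1) k"

lemma conv_fin_zw_series:
  assumes "is_series A" "is_series B" shows "conv_fin exp_zw n (\<lambda>m k. A m (B k v))"
proof -
  obtain k0 where "\<forall>k<k0. B k v = 0" using is_series_trunc[OF assms(2)] by blast
  then show ?thesis
    by (intro conv_fin_zw[of k0]) (simp add: endo_zero[OF is_series_endo[OF assms(1)]])
qed

lemma conv_fin_wz_series: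
  assumes "is_series A" "is_series B" shows "conv_fin exp_wz n (\<lambda>m k. B k (A m v))"
proof -
  obtain k0 where "\<forall>k<k0. A k v = 0" using is_series_trunc[OF assms(1)] by blast
  then show ?thesis
    by (intro conv_fin_wz[of k0]) (simp add: endo_zero[OF is_series_endo[OF assms(2)]])
qed

definition conv3 :: "expansion \<Rightarrow> int \<Rightarrow> 'v::superspace dist3 \<Rightarrow> 'v dist3" where
  "conv3 e n f m k l = conv e n (\<lambda>m k. f m k l) m k"

definition conv3_fin :: "expansion \<Rightarrow> 'v::superspace dist3 \<Rightarrow> bool" where
  "conv3_fin e f \<longleftrightarrow> (\<forall>n l. conv_fin e n (\<lambda>m k. f m k l))"

lemma conv_shift: "conv e n (\<lambda>m k. f (m + i) (k + j)) m k = conv e n f (m + i) (k + j)"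
  by (simp add: conv_def algebra_simps)

lemma conv3_diff: "conv3_fin e f \<Longrightarrow> conv3_fin e g \<Longrightarrow> conv3 e n (f - g) = conv3 e n f - conv3 e n g"
  by (auto simp: conv3_def conv3_fin_def fun_eq_iff conv_diff)

lemma conv3_zero: "conv3 e n 0 = 0"
  by (simp add: conv3_def fun_eq_iff)

lemma conv3_fin_diff: "conv3_fin e f \<Longrightarrow> conv3_fin e g \<Longrightarrow> conv3_fin e (f - g)"
  by (simp add: conv3_fin_def conv_fin_diff)

lemma conv3_fin_sd:
  assumes "conv3_fin e f"
  shows "conv3_fin e (sd12 f)" "conv3_fin e (sd13 f)" "conv3_fin e (sd23 f)"
  using assms conv_fin_shift[where i = "- 1" and j = 0] conv_fin_shift[where i = 0 and j = "- 1"]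
  by (fastforce simp: conv3_fin_def sd_defs intro!: conv_fin_diff)+

lemma conv3_sd:
  assumes "conv3_fin e f"
  shows "conv3 e n (sd12 f) = sd12 (conv3 e n f)" "conv3 e n (sd13 f) = sd13 (conv3 e n f)"
    "conv3 e n (sd23 f) = sd23 (conv3 e n f)"
proof -
  have fin: "conv_fin e n (\<lambda>m k. f m k l)" for l
    using assms by (simp add: conv3_fin_def)
  note sh = conv_fin_shift[OF fin, where i = "- 1" and j = 0, simplified]
    conv_fin_shift[OF fin, where i = 0 and j = "- 1", simplified]
    conv_shift[where i = "- 1" and j = 0, simplified] conv_shift[where i = 0 and j = "- 1", simplified]
  show "conv3 e n (sd12 f) = sd12 (conv3 e n f)" "conv3 e n (sd13 f) = sd13 (conv3 e n f)"
    "conv3 e n (sd23 f) = sd23 (conv3 e n f)"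
    using sh(3)[of e n "\<lambda>m k. f m k _"] sh(4)[of e n "\<lambda>m k. f m k _"]
    by (simp_all add: conv3_def sd_defs fun_eq_iff conv_diff sh(1,2) fin)
qed

lemma conv3_fin_funpow:
  assumes "conv3_fin e f"
  shows "conv3_fin e ((sd12 ^^ s) f)" "conv3_fin e ((sd13 ^^ s) f)" "conv3_fin e ((sd23 ^^ s) f)"
  by (induction s) (simp_all add: assms conv3_fin_sd)

lemma conv3_funpow:
  assumes "conv3_fin e f"
  shows "conv3 e n ((sd13 ^^ s) f) = (sd13 ^^ s) (conv3 e n f)"
    "conv3 e n ((sd23 ^^ s) f) = (sd23 ^^ s) (conv3 e n f)"
  by (induction s) (simp_all add: assms conv3_sd conv3_fin_funpow)

context expansion
begin

lemma sd12_funpow_conv3: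
  assumes "conv3_fin e f"
  shows "(sd12 ^^ s) (conv3 e n f) = conv3 e (n + int s) f"
proof (induction s)
  case (Suc s)
  have "sd12 (conv3 e (n + int s) f) = conv3 e (n + int s + 1) f"
    using shift_diff_conv[of "n + int s" "\<lambda>m k. f m k _"] assms
    by (auto simp: sd12_def conv3_def conv3_fin_def fun_eq_iff shift_diff_def)
  then show ?case using Suc by (simp add: algebra_simps)
qed simp

lemma conv3_int: "conv3 e (int n) f = (sd12 ^^ n) f"
  by (simp add: conv3_def conv_int sd12_funpow fun_eq_iff)

text \<open>Once n + s is nonnegative the right side no longer mentions the expansion
  \<open>e\<close>.\<close>

lemma sd12_funpow_conv3':
  assumes "conv3_fin e f" "0 \<le> n + int s"
  shows "(sd12 ^^ s) (conv3 e n f) = (sd12 ^^ nat (n + int s)) f"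
  using sd12_funpow_conv3[OF assms(1), of s n] conv3_int[of "nat (n + int s)" f] assms(2) by simp

end

lemma nth_product_endo: "is_series A \<Longrightarrow> is_series B \<Longrightarrow> endo (nth_product \<epsilon> n A B k)"
  unfolding nth_product_def
  by (rule endoI) (simp_all add: endo_add[OF is_series_endo] endo_scaleC[OF is_series_endo]
    conv_add conv_scaleC conv_fin_zw_series conv_fin_wz_series scaleC_add
    scaleC_diff mult.commute)

text \<open>The two terms truncate for different reasons. For |z| > |w| only nonnegative powers of w
  multiply B(w)v. For |w| > |z| the residue involves only modes of A with negative index; finitely
  many of them are nonzero on v, each with its own truncation bound for B.\<close>

lemma is_series_nth_product:
  assumes "is_series A" "is_series B" shows "is_series (nth_product \<epsilon> n A B)"
  unfolding is_series_def
proof (intro conjI allI)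
  show "endo (nth_product \<epsilon> n A B k)" for k using assms by (rule nth_product_endo)
  fix v
  obtain k0 where k0: "\<And>k. k < k0 \<Longrightarrow> B k v = 0" using is_series_trunc[OF assms(2)] by blast
  obtain m0 where m0: "\<And>m. m < m0 \<Longrightarrow> A m v = 0" using is_series_trunc[OF assms(1)] by blast
  have "\<exists>l. \<forall>k<l. B k (A m v) = 0" for m using is_series_trunc[OF assms(2)] by blast
  then obtain l where l: "\<And>m k. k < l m \<Longrightarrow> B k (A m v) = 0" by metis
  \<comment> \<open>With m = -1 - m' and k' = n - m', the index k - k' is below \<open>l m\<close>
    exactly when k < \<open>l m\<close> + n + m + 1.\<close>
  define l0 where "l0 = Min (insert k0 ((\<lambda>m. l m + n + m + 1) ` {m0..- 1}))"
  have l0: "l0 \<le> k0" "m \<in> {m0..- 1} \<Longrightarrow> l0 \<le> l m + n + m + 1" for m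
    unfolding l0_def by (intro Min_le; simp)+
  have "nth_product \<epsilon> n A B k v = 0" if k: "k < l0" for k
  proof -
    have "(case p of (m', k') \<Rightarrow> exp_zw n m' k' *\<^sub>C A (- 1 - m') (B (k - k') v)) = 0" for p
      using k l0(1) k0[of "k - snd p"] endo_zero[OF is_series_endo[OF assms(1)]]
      by (cases p) (auto simp: exp_zw_def)
    then have 1: "conv exp_zw n (\<lambda>m k. A m (B k v)) (- 1) k = 0" by (simp add: conv_def)
    have "exp_wz n m' k' *\<^sub>C B (k - k') (A (- 1 - m') v) = 0" for m' k'
    proof (cases "- 1 - m' < m0 \<or> m' < 0 \<or> m' + k' \<noteq> n")
      case True
      then show ?thesis using m0 endo_zero[OF is_series_endo[OF assms(2)]] by (auto simp: exp_wz_def)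
    next
      case False
      then have "k - k' < l (- 1 - m')" using l0(2)[of "- 1 - m'"] k by auto
      then show ?thesis using l by simp
    qed
    then have "conv exp_wz n (\<lambda>m k. B k (A m v)) (- 1) k = 0"
      unfolding conv_def case_prod_unfold by (simp only: Sum_any.neutral)
    with 1 show ?thesis by (simp add: nth_product_def)
  qed
  then show "\<exists>l. \<forall>k<l. nth_product \<epsilon> n A B k v = 0" by blast
qed

lemma mutually_localD:
  assumes "mutually_local \<epsilon> A B"
  shows "\<exists>r. \<forall>n\<ge>r. \<forall>v. (shift_diff ^^ n) (bracket \<epsilon> A B v) = (\<lambda>m k. 0)"
proof -
  obtain r where "\<forall>v. (shift_diff ^^ r) (bracket \<epsilon> A B v) = (\<lambda>m k. 0)"
    using assms unfolding mutually_local_def by blast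
  with shift_diff_funpow_mono[of r] show ?thesis by blast
qed

text \<open>Dong's lemma.  For \<open>r\<close> large, \<open>(w - x)\<^sup>4\<^sup>r\<close> is expanded as \<open>(w - x)\<^sup>r ((z - x) - (z - w))\<^sup>3\<^sup>r\<close>: a
  term containing \<open>(z - w)\<^sup>2\<^sup>r\<close> turns both expansions of \<open>(z - w)\<^sup>n\<close> into the same polynomial, killing
  \<open>A B - \<epsilon>\<^sub>1 B A\<close>, and otherwise \<open>(w - x)\<^sup>r (z - x)\<^sup>r\<close> moves \<open>C\<close> past \<open>A\<close> and \<open>B\<close>.\<close>

theorem mutually_local_nth_product:
  fixes A B C :: "'v::superspace series"
  assumes "is_series A" "is_series B" "is_series C"
    and "mutually_local \<epsilon>1 A B" "mutually_local \<epsilon>2 A C" "mutually_local \<epsilon>3 B C"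
  shows "mutually_local (\<epsilon>2 * \<epsilon>3) (nth_product \<epsilon>1 n A B) C"
proof -
  note endoA = is_series_endo[OF assms(1)] and endoB = is_series_endo[OF assms(2)]
    and endoC = is_series_endo[OF assms(3)]
  let ?\<delta> = "\<epsilon>2 * \<epsilon>3"
  obtain r1 where r1: "\<And>v n. r1 \<le> n \<Longrightarrow> (shift_diff ^^ n) (bracket \<epsilon>1 A B v) = (\<lambda>m k. 0)"
    using mutually_localD[OF assms(4)] by blast
  obtain r2 where r2: "\<And>v n. r2 \<le> n \<Longrightarrow> (shift_diff ^^ n) (bracket \<epsilon>2 A C v) = (\<lambda>m k. 0)"
    using mutually_localD[OF assms(5)] by blast
  obtain r3 where r3: "\<And>v n. r3 \<le> n \<Longrightarrow> (shift_diff ^^ n) (bracket \<epsilon>3 B C v) = (\<lambda>m k. 0)"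
    using mutually_localD[OF assms(6)] by blast
  \<comment> \<open>The bound |n| ensures n + s \<ge> r whenever s \<ge> 2r: the s factors z - w
    absorb a negative n and still leave r of them for the commutator of A and B.\<close>
  define r where "r = max (max r1 r2) (max r3 (nat \<bar>n\<bar>))"
  have r: "r1 \<le> r" "r2 \<le> r" "r3 \<le> r" "nat \<bar>n\<bar> \<le> r" by (auto simp: r_def)
  have "(shift_diff ^^ (4 * r)) (\<lambda>k l. nth_product \<epsilon>1 n A B k (C l v) - ?\<delta> *\<^sub>C C l (nth_product \<epsilon>1
    n A B k v))
      = (\<lambda>k l. 0)" for v
  proof -
    \<comment> \<open>The six orders of A(z), B(w), C(x), each carrying the signs collected on the
      way from A B C, so that neighbouring orders differ by a scaled supercommutator.\<close>
    define abc where "abc = (\<lambda>m k l. A m (B k (C l v)))"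
    define bac where "bac = (\<lambda>m k l. \<epsilon>1 *\<^sub>C B k (A m (C l v)))"
    define cab where "cab = (\<lambda>m k l. ?\<delta> *\<^sub>C C l (A m (B k v)))"
    define cba where "cba = (\<lambda>m k l. ?\<delta> *\<^sub>C \<epsilon>1 *\<^sub>C C l (B k (A m v)))"
    define acb where "acb = (\<lambda>m k l. \<epsilon>3 *\<^sub>C A m (C l (B k v)))"
    define bca where "bca = (\<lambda>m k l. \<epsilon>2 *\<^sub>C \<epsilon>1 *\<^sub>C B k (C l (A m v)))"
    note fdefs = abc_def bac_def cab_def cba_def acb_def bca_def
    have fin: "conv3_fin exp_zw abc" "conv3_fin exp_zw cab" "conv3_fin exp_wz bac" "conv3_fin
      exp_wz cba"
      unfolding conv3_fin_def fdefs
      by (auto intro!: conv_fin_scaleC conv_fin_endo[OF _ endoC] conv_fin_zw_series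
        conv_fin_wz_series assms)
    have ab: "(sd12 ^^ s) (abc - bac) = 0" "(sd12 ^^ s) (cab - cba) = 0" if "r \<le> s" for s
    proof -
      have *: "(shift_diff ^^ s) (\<lambda>m k. A m (B k u) - \<epsilon>1 *\<^sub>C B k (A m u)) = (\<lambda>m k. 0)" for u
        using r1 that r(1) by simp
      show "(sd12 ^^ s) (abc - bac) = 0"
        by (simp add: fun_eq_iff sd12_funpow fdefs * del: minus_apply) (simp add: *)
      have "(shift_diff ^^ s) (\<lambda>m k. ?\<delta> *\<^sub>C C l (A m (B k v) - \<epsilon>1 *\<^sub>C B k (A m v))) m k = 0" for m k l
        unfolding shift_diff_funpow_scaleC shift_diff_funpow_endo[OF endoC] *
        by (simp add: endo_zero[OF endoC])
      then show "(sd12 ^^ s) (cab - cba) = 0"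
        by (simp add: fun_eq_iff sd12_funpow fdefs endo_diff[OF endoC] endo_scaleC[OF endoC]
          scaleC_diff)
    qed
    have kill: "(sd23 ^^ r) (abc - acb) = 0" "(sd13 ^^ r) (acb - cab) = 0"
      "(sd13 ^^ r) (bac - bca) = 0" "(sd23 ^^ r) (bca - cba) = 0"
    proof -
      have "(shift_diff ^^ r) (\<lambda>k l. A m (B k (C l v) - \<epsilon>3 *\<^sub>C C l (B k v))) k l = 0" for m k l
        unfolding shift_diff_funpow_endo[OF endoA] r3[OF r(3)] by (simp add: endo_zero[OF endoA])
      then show "(sd23 ^^ r) (abc - acb) = 0"
        by (simp add: fun_eq_iff sd23_funpow fdefs endo_diff[OF endoA] endo_scaleC[OF endoA])
      have "(shift_diff ^^ r) (\<lambda>m l. \<epsilon>3 *\<^sub>C (A m (C l (B k v)) - \<epsilon>2 *\<^sub>C C l (A m (B k v)))) m l =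
        0" for m k l
        unfolding shift_diff_funpow_scaleC r2[OF r(2)] by simp
      then show "(sd13 ^^ r) (acb - cab) = 0"
        by (simp add: fun_eq_iff sd13_funpow fdefs scaleC_diff mult.commute)
      have "(shift_diff ^^ r) (\<lambda>m l. \<epsilon>1 *\<^sub>C B k (A m (C l v) - \<epsilon>2 *\<^sub>C C l (A m v))) m l = 0" for m k l
        unfolding shift_diff_funpow_scaleC shift_diff_funpow_endo[OF endoB] r2[OF r(2)]
        by (simp add: endo_zero[OF endoB])
      then show "(sd13 ^^ r) (bac - bca) = 0"
        by (simp add: fun_eq_iff sd13_funpow fdefs endo_diff[OF endoB] endo_scaleC[OF endoB]
          scaleC_diff mult.commute)
      have "(shift_diff ^^ r) (\<lambda>k l. (\<epsilon>2 * \<epsilon>1) *\<^sub>C (B k (C l (A m v)) - \<epsilon>3 *\<^sub>C C l (B k (A m v))))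
        k l = 0" for m k l
        unfolding shift_diff_funpow_scaleC r3[OF r(3)] by simp
      then show "(sd23 ^^ r) (bca - cba) = 0"
        by (simp add: fun_eq_iff sd23_funpow fdefs scaleC_diff mult_ac)
    qed
    note add = additive_op_funpow[OF sd_additive(1)] additive_op_funpow[OF sd_additive(2)]
      additive_op_funpow[OF sd_additive(3)]
    note diff = add[unfolded additive_op_def, rule_format] and zero = add[THEN additive_op_zero]
    have comm: "(sd13 ^^ i) ((sd23 ^^ j) f) = (sd23 ^^ j) ((sd13 ^^ i) f)"
      "(sd12 ^^ i) ((sd23 ^^ j) f) = (sd23 ^^ j) ((sd12 ^^ i) f)"
      "(sd12 ^^ i) ((sd13 ^^ j) f) = (sd13 ^^ j) ((sd12 ^^ i) f)" for i j and f :: "'v dist3"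
      by (rule funpow_commute(2), rule sd_commute)+
    have "(sd13 ^^ r) ((sd23 ^^ r) (abc - cab)) =
        (sd13 ^^ r) ((sd23 ^^ r) (abc - acb)) + (sd23 ^^ r) ((sd13 ^^ r) (acb - cab))"
      by (simp add: diff comm)
    then have ac: "(sd13 ^^ r) ((sd23 ^^ r) (abc - cab)) = 0" by (simp add: kill zero)
    have "(sd13 ^^ r) ((sd23 ^^ r) (bac - cba)) =
        (sd23 ^^ r) ((sd13 ^^ r) (bac - bca)) + (sd13 ^^ r) ((sd23 ^^ r) (bca - cba))"
      by (simp add: diff comm)
    then have bc: "(sd13 ^^ r) ((sd23 ^^ r) (bac - cba)) = 0" by (simp add: kill zero)
    define G where "G = (conv3 exp_zw n abc - conv3 exp_wz n bac) - (conv3 exp_zw n cab - conv3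
      exp_wz n cba)"
    have "(sd23 ^^ (3 * r)) ((sd23 ^^ r) G) = 0"
    proof (rule funpow_diff_eq_0[of sd23 sd13 sd12])
      fix s t assume st: "s + t = 3 * r"
      show "(sd12 ^^ s) ((sd13 ^^ t) ((sd23 ^^ r) G)) = 0"
      proof (cases "2 * r \<le> s")
        case True
        then have ns: "0 \<le> n + int s" "r \<le> nat (n + int s)" using r(4) by linarith+
        have "(sd12 ^^ s) G = 0"
          using ab[OF ns(2)]
          by (simp add: G_def diff zw.sd12_funpow_conv3'[OF _ ns(1)] wz.sd12_funpow_conv3'[OF _
            ns(1)] fin)
        then show ?thesis by (simp add: comm zero)
      next
        case False
        with st have t: "t = (t - r) + r" by linarith
        \<comment> \<open>The four terms of G are regrouped by expansion. Moving C past A and B then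
          takes place inside a single \<open>conv3\<close>, which commutes with multiplication by w
          - x and z - x.\<close>
        define P Q where "P = abc - cab" and "Q = bac - cba"
        have PQ: "conv3_fin exp_zw P" "conv3_fin exp_wz Q" and G: "G = conv3 exp_zw n P - conv3
          exp_wz n Q"
          by (simp_all add: P_def Q_def G_def conv3_diff conv3_fin_diff fin)
        have "(sd13 ^^ r) ((sd23 ^^ r) G) = conv3 exp_zw n ((sd13 ^^ r) ((sd23 ^^ r) P))
            - conv3 exp_wz n ((sd13 ^^ r) ((sd23 ^^ r) Q))"
          by (simp add: G diff conv3_funpow conv3_fin_funpow PQ)
        also have "\<dots> = 0" by (simp add: ac bc conv3_zero P_def Q_def)
        finally show ?thesis by (subst t) (simp add: funpow_add zero)
      qed
    qed (auto simp: sd_additive sd_commute sd_defs fun_eq_iff)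
    moreover have "sd23 ^^ (4 * r) = (sd23 ^^ (3 * r)) \<circ> (sd23 ^^ r :: 'v dist3 \<Rightarrow> 'v dist3)"
      by (simp flip: funpow_add)
    ultimately have "(sd23 ^^ (4 * r)) G = 0"
      by simp
    moreover have "nth_product \<epsilon>1 n A B k (C l v) - ?\<delta> *\<^sub>C C l (nth_product \<epsilon>1 n A B k v) = G (-
      1) k l" for k l
      unfolding G_def conv3_def fdefs nth_product_def
      by (simp add: conv_scaleC conv_endo[OF _ endoC] conv_fin_zw_series conv_fin_wz_series assms
        endo_diff[OF endoC] endo_scaleC[OF endoC] scaleC_diff mult_ac)
    ultimately show ?thesis
      by (simp add: fun_eq_iff sd23_funpow)
  qed
  then show ?thesis unfolding mutually_local_def by blast
qed

section \<open>Grassmann variables\<close>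

lemma gsign_empty [simp]: "gsign {} J = 1" "gsign I {} = 1"
  by (simp_all add: gsign_def)

lemma gsign_square [simp]: "gsign I J * gsign I J = 1" "gsign I J * (gsign I J * c) = c"
proof -
  show *: "gsign I J * gsign I J = 1" by (simp add: gsign_def flip: power_mult_distrib)
  show "gsign I J * (gsign I J * c) = c" by (simp add: * flip: mult.assoc)
qed

lemma gsign_neq_0 [simp]: "gsign I J \<noteq> 0"
  by (simp add: gsign_def)

lemma finite_gsign_set: "finite I \<Longrightarrow> finite {(i, j). i \<in> I \<and> j \<in> J \<and> j < (i :: nat)}"
  by (rule finite_subset[of _ "Sigma I (\<lambda>i. {..<i})"]) auto

lemma gsign_Un_left:
  assumes "finite I" "finite I'" "I \<inter> I' = {}"
  shows "gsign (I \<union> I') J = gsign I J * gsign I' J"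
proof -
  have "{(i, j). i \<in> I \<union> I' \<and> j \<in> J \<and> j < i} =
     {(i, j). i \<in> I \<and> j \<in> J \<and> j < i} \<union> {(i, j). i \<in> I' \<and> j \<in> J \<and> j < i}" by auto
  moreover have "{(i, j). i \<in> I \<and> j \<in> J \<and> j < i} \<inter> {(i, j). i \<in> I' \<and> j \<in> J \<and> j < i} = {}"
    using assms(3) by auto
  ultimately show ?thesis
    by (simp add: gsign_def card_Un_disjoint finite_gsign_set assms power_add)
qed

lemma gsign_Un_right:
  assumes "finite I" "J \<inter> J' = {}"
  shows "gsign I (J \<union> J') = gsign I J * gsign I J'"
proof -
  have "{(i, j). i \<in> I \<and> j \<in> J \<union> J' \<and> j < i} =
     {(i, j). i \<in> I \<and> j \<in> J \<and> j < i} \<union> {(i, j). i \<in> I \<and> j \<in> J' \<and> j < i}" by auto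
  moreover have "{(i, j). i \<in> I \<and> j \<in> J \<and> j < i} \<inter> {(i, j). i \<in> I \<and> j \<in> J' \<and> j < i} = {}"
    using assms(2) by auto
  ultimately show ?thesis
    by (simp add: gsign_def card_Un_disjoint finite_gsign_set assms power_add)
qed

lemma gsign_less: "(\<And>i j. i \<in> I \<Longrightarrow> j \<in> J \<Longrightarrow> i < j) \<Longrightarrow> gsign I J = 1"
  by (auto simp: gsign_def dest!: less_asym) (metis (no_types, lifting) Collect_empty_eq
    card.empty case_prod_conv less_asym power_0 prod.exhaust)

text \<open>Each pair in I \<times> J is an inversion for exactly one of the two orders, so the two
  inversion counts add up to |I| |J|.\<close>

lemma gsign_swap:
  assumes "finite I" "finite J" "I \<inter> J = {}"
  shows "gsign J I = psign (cardp I * cardp J) * gsign I J"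
proof -
  let ?A = "{(i, j). i \<in> I \<and> j \<in> J \<and> j < i}" and ?B = "{(i, j). i \<in> I \<and> j \<in> J \<and> i < j}"
  have IJ: "I \<times> J = ?A \<union> ?B"
  proof (intro set_eqI iffI)
    fix p assume "p \<in> I \<times> J"
    then obtain i j where "p = (i, j)" "i \<in> I" "j \<in> J" "i \<noteq> j" using assms(3) by blast
    then show "p \<in> ?A \<union> ?B" by (simp add: neq_iff) linarith
  qed auto
  have "finite (I \<times> J)" using assms(1,2) by simp
  then have "finite ?A" "finite ?B" unfolding IJ by simp_all
  then have "card (?A \<union> ?B) = card ?A + card ?B" by (rule card_Un_disjoint) auto
  then have "card I * card J = card ?A + card ?B" using IJ by (metis card_cartesian_product)
  moreover have "card {(j, i). j \<in> J \<and> i \<in> I \<and> i < j} = card ?B"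
    by (rule bij_betw_same_card[of prod.swap]) (auto simp: bij_betw_def image_iff)
  ultimately have "gsign J I = (- 1) ^ card ?B" "(- 1 :: complex) ^ (card I * card J) = gsign I J
    * (- 1) ^ card ?B"
    by (simp_all add: gsign_def power_add)
  then have "(- 1 :: complex) ^ (card I * card J) * gsign I J = gsign J I"
    by simp
  then show ?thesis by (simp flip: psign_of_nat)
qed

lemma gsign_singleton_insert:
  assumes "j \<notin> L" shows "gsign {i} (insert j L) = (if j < i then - gsign {i} L else gsign {i} L)"
proof -
  have "gsign {i} ({j} \<union> L) = gsign {i} {j} * gsign {i} L"
    using assms by (intro gsign_Un_right) auto
  moreover have "{(a, b). a = i \<and> b = j \<and> b < a} = (if j < i then {(i, j)} else {})" by auto
  then have "gsign {i} {j} = (if j < i then - 1 else 1)" by (simp add: gsign_def)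
  ultimately show ?thesis by simp
qed

lemma gsign_insert_left:
  "i \<notin> K \<Longrightarrow> finite K \<Longrightarrow> gsign (insert i K) M = gsign {i} M * gsign K M"
  using gsign_Un_left[of "{i}" K M] by simp

lemma gsign_insert_right:
  assumes "i \<notin> K" "i \<notin> M" "finite K"
  shows "gsign K (insert i M) = psign (cardp K) * gsign {i} K * gsign K M"
  using gsign_Un_right[of K "{i}" M] gsign_swap[of "{i}" K] assms by simp

section \<open>Grassmann multiplications and derivatives as operators\<close>

definition gact :: "grass \<Rightarrow> (nat set \<Rightarrow> 'v::superspace) \<Rightarrow> nat set \<Rightarrow> 'v" where
  "gact g X L = (\<Sum>K\<in>Pow L. (gsign K (L - K) * g K) *\<^sub>C X (L - K))"

text \<open>Left multiplication by one odd variable and, below, the left derivative in it. Their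
  exchange rules later replace manipulations of sums over subsets.\<close>

definition lmul :: "nat \<Rightarrow> (nat set \<Rightarrow> 'v::superspace) \<Rightarrow> nat set \<Rightarrow> 'v" where
  "lmul i X L = (if i \<in> L then gsign {i} (L - {i}) *\<^sub>C X (L - {i}) else 0)"

definition ldiff :: "nat \<Rightarrow> (nat set \<Rightarrow> 'v::superspace) \<Rightarrow> nat set \<Rightarrow> 'v" where
  "ldiff i X L = (if i \<notin> L then gsign {i} L *\<^sub>C X (insert i L) else 0)"

lemma gact_infinite: "infinite L \<Longrightarrow> gact g X L = 0"
  by (simp add: gact_def finite_Pow_iff)

text \<open>Associativity: both sides sum over the ordered splittings of L into three parts, (K, K1)
  on the left corresponding to (K1, K - K1) on the right.\<close>

lemma gact_gmul: "gact (gmul f g) X = gact f (gact g X)"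
proof
  fix L
  show "gact (gmul f g) X L = gact f (gact g X) L"
  proof (cases "finite L")
    case True
    let ?T = "\<lambda>K K1. (gsign K (L - K) * (gsign K1 (K - K1) * f K1 * g (K - K1))) *\<^sub>C X (L - K)"
    let ?R = "\<lambda>K1 K2. (gsign K1 (L - K1) * f K1 * (gsign K2 (L - K1 - K2) * g K2)) *\<^sub>C X (L - K1 - K2)"
    have "gact (gmul f g) X L = (\<Sum>K\<in>Pow L. \<Sum>K1\<in>Pow K. ?T K K1)"
      by (simp add: gact_def gmul_def sum_distrib_left superspace.scale_sum_left)
    also have "\<dots> = (\<Sum>(K, K1)\<in>Sigma (Pow L) Pow. ?T K K1)"
      using True by (intro sum.Sigma) (auto intro: finite_subset)
    also have "\<dots> = (\<Sum>(K1, K2)\<in>Sigma (Pow L) (\<lambda>K1. Pow (L - K1)). ?R K1 K2)"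
    proof (rule sum.reindex_bij_witness[of _ "\<lambda>(K1, K2). (K1 \<union> K2, K1)" "\<lambda>(K, K1). (K1, K - K1)"])
      fix a assume "a \<in> Sigma (Pow L) Pow"
      then obtain K K1 where a: "a = (K, K1)" "K1 \<subseteq> K" "K \<subseteq> L" by auto
      define K2 M where "K2 = K - K1" and "M = L - K"
      have fin: "finite K1" "finite K2" "finite M"
        using a True unfolding K2_def M_def by (auto intro: finite_subset)
      have eq: "K = K1 \<union> K2" "L - K1 = K2 \<union> M" "K2 \<union> M - K2 = M" and disj: "K1 \<inter> K2 = {}" "K2 \<inter> M = {}"
        using a by (auto simp: K2_def M_def)
      have "gsign K M * gsign K1 K2 = gsign K1 (K2 \<union> M) * gsign K2 M"
        by (simp add: eq(1) gsign_Un_left gsign_Un_right fin disj mult_ac)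
      then have "gsign K1 (K2 \<union> M) * f K1 * (gsign K2 M * g K2) = gsign K M * gsign K1 K2 * (f K1
        * g K2)"
        by simp
      then show "(case case a of (K, K1) \<Rightarrow> (K1, K - K1) of (K1, K2) \<Rightarrow> ?R K1 K2) = (case a of (K,
        K1) \<Rightarrow> ?T K K1)"
        unfolding a prod.case K2_def[symmetric] M_def[symmetric] eq(2) eq(3)
        by (simp add: mult.assoc)
    qed auto
    also have "\<dots> = (\<Sum>K1\<in>Pow L. \<Sum>K2\<in>Pow (L - K1). ?R K1 K2)"
      using True by (intro sum.Sigma[symmetric]) auto
    also have "\<dots> = gact f (gact g X) L"
      by (simp add: gact_def scaleC_sum)
    finally show ?thesis .
  qed (simp add: gact_infinite)
qed

text \<open>A sum over \<open>Pow L\<close> has the default value 0 for infinite L, so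
  \<open>gact\<close> erases such coefficients; \<open>gact_gone\<close> and
  \<open>gact_gvar\<close> hold only if they vanish beforehand.\<close>

definition finsupp :: "(nat set \<Rightarrow> 'v::superspace) \<Rightarrow> bool" where
  "finsupp X \<longleftrightarrow> (\<forall>L. infinite L \<longrightarrow> X L = 0)"

lemma finsupp_gact: "finsupp (gact g X)"
  by (simp add: finsupp_def gact_infinite)

lemma gact_gone: "finsupp X \<Longrightarrow> gact gone X = X"
proof
  fix L assume X: "finsupp X"
  show "gact gone X L = X L"
  proof (cases "finite L")
    case True
    have "gact gone X L = (\<Sum>K\<in>Pow L. if K = {} then X L else 0)"
      unfolding gact_def by (rule sum.cong) (auto simp: gone_def)
    then show ?thesis using True by simp
  qed (use X in \<open>auto simp: gact_infinite finsupp_def\<close>)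
qed

lemma gact_gvar: "finsupp X \<Longrightarrow> gact (gvar i) X = lmul i X"
proof
  fix L assume X: "finsupp X"
  show "gact (gvar i) X L = lmul i X L"
  proof (cases "finite L")
    case True
    have "gact (gvar i) X L = (\<Sum>K\<in>Pow L. if K = {i} then lmul i X L else 0)"
      unfolding gact_def by (rule sum.cong) (auto simp: gvar_def lmul_def)
    then show ?thesis using True by (simp add: lmul_def)
  qed (use X in \<open>auto simp: gact_infinite finsupp_def lmul_def\<close>)
qed

lemma finsupp_lmul: "finsupp X \<Longrightarrow> finsupp (lmul i X)"
  by (auto simp: finsupp_def lmul_def)

lemma gact_diff: "gact (\<lambda>L. f L - g L) X = (\<lambda>L. gact f X L - gact g X L)"
  by (simp add: gact_def fun_eq_iff right_diff_distrib superspace.scale_left_diff_distrib sum_subtractf)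

lemma gact_sum: "gact (\<lambda>L. \<Sum>i\<in>I. f i L) X = (\<lambda>L. \<Sum>i\<in>I. gact (f i) X L)"
  by (auto simp: gact_def fun_eq_iff sum_distrib_left superspace.scale_sum_left intro: sum.swap)

lemma lmul_lmul:
  assumes "i \<noteq> j" shows "lmul i (lmul j X) L = - lmul j (lmul i X) L"
proof (cases "i \<in> L \<and> j \<in> L")
  case True
  define M where "M = L - {i} - {j}"
  have "L - {i} = insert j M" "L - {j} = insert i M" "i \<notin> M" "j \<notin> M" using True assms by (auto
    simp: M_def)
  then show ?thesis using True assms by (auto simp: lmul_def gsign_singleton_insert mult.commute)
qed (auto simp: lmul_def)

lemma lmul_lmul_same: "lmul i (lmul i X) L = 0"
  by (simp add: lmul_def)

lemma ldiff_lmul: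
  assumes "i \<noteq> j" shows "ldiff i (lmul j X) L = - lmul j (ldiff i X) L"
proof (cases "i \<notin> L \<and> j \<in> L")
  case True
  define M where "M = L - {j}"
  have "L = insert j M" "insert i (insert j M) - {j} = insert i M" "insert j M - {j} = M" "i \<notin> M"
    "j \<notin> M"
    using True assms by (auto simp: M_def)
  then show ?thesis using assms by (auto simp: lmul_def ldiff_def gsign_singleton_insert mult.commute)
qed (use assms in \<open>auto simp: lmul_def ldiff_def\<close>)

lemma ldiff_lmul_same: "ldiff i (lmul i X) L = X L - lmul i (ldiff i X) L"
  by (auto simp: lmul_def ldiff_def insert_absorb)

lemma sum_Pow_insert:
  assumes "finite L" "i \<notin> L"
  shows "(\<Sum>K\<in>Pow (insert i L). f K) = (\<Sum>K\<in>Pow L. f K + f (insert i K))"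
proof -
  have "inj_on (insert i) (Pow L)" using assms(2) by (auto simp: inj_on_def)
  then show ?thesis
    using assms by (subst Pow_insert, subst sum.union_disjoint) (auto simp: sum.reindex sum.distrib)
qed

text \<open>This is \<open>op_gmul\<close> applied to v when the left factor has total parity p: its
  coefficient at K then has parity p + |K| and crosses the variables of L - K with a single explicit
  sign.\<close>

definition hmul :: "bit \<Rightarrow> (nat set \<Rightarrow> 'v::superspace \<Rightarrow> 'v) \<Rightarrow> (nat set \<Rightarrow> 'v \<Rightarrow> 'v) \<Rightarrow> 'v \<Rightarrow> nat set \<Rightarrow>
  'v" where
  "hmul p A B v L = (\<Sum>K\<in>Pow L. (gsign K (L - K) * psign ((p + cardp K) * cardp (L - K))) *\<^sub>C
     A K (B (L - K) v))"

lemma op_gmul_homog: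
  assumes "\<And>K. endo (A K)" "\<And>K. op_parity (p + cardp K) (A K)"
  shows "op_gmul A B L v = hmul p A B v L"
  by (simp add: op_gmul_def hmul_def gcross_homog[OF assms])

abbreviation lmul_op :: "nat \<Rightarrow> (nat set \<Rightarrow> 'v::superspace \<Rightarrow> 'v) \<Rightarrow> nat set \<Rightarrow> 'v \<Rightarrow> 'v" where
  "lmul_op i A L v \<equiv> lmul i (\<lambda>L. A L v) L"

abbreviation ldiff_op :: "nat \<Rightarrow> (nat set \<Rightarrow> 'v::superspace \<Rightarrow> 'v) \<Rightarrow> nat set \<Rightarrow> 'v \<Rightarrow> 'v" where
  "ldiff_op i A L v \<equiv> ldiff i (\<lambda>L. A L v) L"

lemma hmul_infinite: "infinite L \<Longrightarrow> hmul p A B v L = 0"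
  by (simp add: hmul_def finite_Pow_iff)

text \<open>The left factor absorbs the variable without a sign but changes its parity.\<close>

lemma lmul_hmul_left:
  "lmul i (hmul p A B v) = hmul (p + 1) (lmul_op i A) B v"
proof
  fix L
  consider "infinite L" | "finite L" "i \<notin> L" | L' where "finite L'" "L = insert i L'" "i \<notin> L'"
    by (metis finite_insert mk_disjoint_insert)
  then show "lmul i (hmul p A B v) L = hmul (p + 1) (lmul_op i A) B v L"
  proof cases
    case 3
    have "gsign {i} L' * (gsign K (L' - K) * psign ((p + cardp K) * cardp (L' - K))) =
      gsign (insert i K) (L' - K) * psign ((p + 1 + cardp (insert i K)) * cardp (L' - K)) * gsign {i} K"
      if K: "K \<subseteq> L'" for K
    proof -
      have "gsign {i} (K \<union> (L' - K)) = gsign {i} K * gsign {i} (L' - K)"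
        by (rule gsign_Un_right) auto
      moreover have "K \<union> (L' - K) = L'" and fin: "finite K" "i \<notin> K" using K 3 by (auto intro:
        finite_subset)
      ultimately have "gsign {i} L' = gsign {i} K * gsign {i} (L' - K)" by simp
      then show ?thesis by (simp add: gsign_insert_left[OF fin(2,1)] fin add_ac mult_ac)
    qed
    moreover have "insert i L' - insert i K = L' - K" "K \<subseteq> L' \<Longrightarrow> i \<notin> K" "K \<subseteq> L' \<Longrightarrow> insert i K - {i}
      = K" for K using 3 by auto
    ultimately show ?thesis unfolding 3
      by (auto simp: hmul_def sum_Pow_insert 3 lmul_def scaleC_sum intro!: sum.cong)
  qed (auto simp: hmul_infinite lmul_def hmul_def subset_iff intro!: sum.neutral)
qed

text \<open>The sign is that of the variable crossing the left factor.\<close>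

lemma lmul_hmul_right:
  assumes "\<And>K. endo (A K)"
  shows "lmul i (hmul p A B v) L = psign p *\<^sub>C hmul p A (lmul_op i B) v L"
proof -
  consider "infinite L" | "finite L" "i \<notin> L" | L' where "finite L'" "L = insert i L'" "i \<notin> L'"
    by (metis finite_insert mk_disjoint_insert)
  then show ?thesis
  proof cases
    case 3
    have "gsign {i} L' * (gsign K (L' - K) * psign ((p + cardp K) * cardp (L' - K))) =
      psign p * (gsign K (insert i (L' - K)) * psign ((p + cardp K) * cardp (insert i (L' - K))))
        * gsign {i} (L' - K)"
      if K: "K \<subseteq> L'" for K
    proof -
      have "gsign {i} (K \<union> (L' - K)) = gsign {i} K * gsign {i} (L' - K)"
        by (rule gsign_Un_right) auto
      moreover have "K \<union> (L' - K) = L'" and fin: "finite K" "i \<notin> K" "i \<notin> L' - K" using K 3 by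
        (auto intro: finite_subset)
      ultimately have "gsign {i} L' = gsign {i} K * gsign {i} (L' - K)" by simp
      then show ?thesis using 3 by (simp add: gsign_insert_right[OF fin(2,3,1)] fin distrib_left
        psign_add mult_ac)
    qed
    moreover have "K \<subseteq> L' \<Longrightarrow> insert i L' - K = insert i (L' - K)" "insert i L' - insert i K = L' -
      K" "K \<subseteq> L' \<Longrightarrow> i \<notin> K" for K using 3 by auto
    ultimately show ?thesis unfolding 3
      by (auto simp: hmul_def sum_Pow_insert 3 lmul_def scaleC_sum endo_scaleC[OF assms]
        endo_zero[OF assms] intro!: sum.cong)
  qed (auto simp: hmul_infinite lmul_def hmul_def endo_zero[OF assms] intro!: sum.neutral)
qed

lemma ldiff_hmul:
  assumes "\<And>K. endo (A K)"
  shows "ldiff i (hmul p A B v) L = hmul (p + 1) (ldiff_op i A) B v L + psign p *\<^sub>C hmul p A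
    (ldiff_op i B) v L"
proof -
  consider "infinite L" | "finite L" "i \<notin> L" | L' where "finite L'" "L = insert i L'" "i \<notin> L'"
    by (metis finite_insert mk_disjoint_insert)
  then show ?thesis
  proof cases
    case 1
    then show ?thesis by (simp add: ldiff_def hmul_infinite)
  next
    case 2
    have "gsign {i} L * (gsign K (insert i (L - K)) * psign ((p + cardp K) * cardp (insert i (L -
      K)))) =
        psign p * (gsign K (L - K) * psign ((p + cardp K) * cardp (L - K)) * gsign {i} (L - K))" (is ?A)
      "gsign {i} L * (gsign (insert i K) (L - K) * psign ((p + cardp (insert i K)) * cardp (L - K))) =
        gsign K (L - K) * psign ((p + 1 + cardp K) * cardp (L - K)) * gsign {i} K" (is ?B)
      if K: "K \<subseteq> L" for K
    proof -
      have "gsign {i} (K \<union> (L - K)) = gsign {i} K * gsign {i} (L - K)"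
        by (rule gsign_Un_right) auto
      moreover have "K \<union> (L - K) = L" and fin: "finite K" "i \<notin> K" "i \<notin> L - K" using K 2 by (auto
        intro: finite_subset)
      ultimately have "gsign {i} L = gsign {i} K * gsign {i} (L - K)" by simp
      then show ?A ?B
        using 2 by (simp_all add: gsign_insert_right[OF fin(2,3,1)] gsign_insert_left[OF fin(2,1)]
          fin distrib_left psign_add mult_ac add_ac)
    qed
    moreover have "K \<subseteq> L \<Longrightarrow> insert i L - K = insert i (L - K)" "insert i L - insert i K = L - K" "K
      \<subseteq> L \<Longrightarrow> i \<notin> K" for K using 2 by auto
    ultimately show ?thesis using 2
      by (auto simp: hmul_def sum_Pow_insert ldiff_def scaleC_sum endo_scaleC[OF assms]
        scaleC_add sum.distrib add.commute intro!: arg_cong2[where f = "(+)"] sum.cong)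
  next
    case 3
    \<comment> \<open>For i in L the left side is 0. On the right, K avoids i in the first sum and
      contains i in the second, and the terms for K and \<open>insert i K\<close> cancel.\<close>
    have "gsign K (insert i (L' - K)) * psign ((p + 1 + cardp K) * cardp (insert i (L' - K))) *
      gsign {i} K =
      - (psign p * (gsign (insert i K) (L' - K) * psign ((p + cardp (insert i K)) * cardp (L' -
        K)) * gsign {i} (L' - K)))"
      if K: "K \<subseteq> L'" for K
    proof -
      have fin: "finite K" "i \<notin> K" "i \<notin> L' - K" using K 3 by (auto intro: finite_subset)
      then show ?thesis using 3 by (simp add: gsign_insert_right[OF fin(2,3,1)]
        gsign_insert_left[OF fin(2,1)] distrib_left psign_add mult_ac add_ac)
    qed
    moreover have "K \<subseteq> L' \<Longrightarrow> insert i L' - K = insert i (L' - K)" "insert i L' - insert i K = L' -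
      K" "K \<subseteq> L' \<Longrightarrow> i \<notin> K" for K using 3 by auto
    ultimately show ?thesis unfolding 3
      by (auto simp: hmul_def sum_Pow_insert 3 ldiff_def scaleC_sum endo_scaleC[OF assms]
        endo_zero[OF assms]
        simp flip: sum.distrib intro!: sum.neutral)
  qed
qed

text \<open>Coefficients of the supercommutator of an odd S with an element of total parity p; the
  first sign is that of S crossing the variables of L.\<close>

definition ad :: "('v::superspace \<Rightarrow> 'v) \<Rightarrow> bit \<Rightarrow> (nat set \<Rightarrow> 'v \<Rightarrow> 'v) \<Rightarrow> nat set \<Rightarrow> 'v \<Rightarrow> 'v" where
  "ad S p A L v = psign (cardp L) *\<^sub>C S (A L v) - psign p *\<^sub>C A L (S v)"

text \<open>Graded derivation rule: the terms with S between the two factors cancel.\<close>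

lemma ad_hmul:
  assumes S: "endo S" and A: "\<And>K. endo (A K)"
  shows "ad S (p + q) (\<lambda>L v. hmul p A B v L) L v =
    hmul (p + 1) (ad S p A) B v L + psign p *\<^sub>C hmul p A (ad S q B) v L"
proof (cases "finite L")
  case True
  let ?f = "\<lambda>K. gsign K (L - K) * psign ((p + cardp K) * cardp (L - K))"
  have "?f K *\<^sub>C (psign (cardp L) *\<^sub>C S (A K (B (L - K) v)) - psign (p + q) *\<^sub>C A K (B (L - K) (S v))) =
     (gsign K (L - K) * psign ((p + 1 + cardp K) * cardp (L - K))) *\<^sub>C ad S p A K (B (L - K) v)
     + psign p *\<^sub>C ?f K *\<^sub>C A K (ad S q B (L - K) v)" if "K \<subseteq> L" for K
  proof -
    have "card L = card K + card (L - K)"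
      using that True by (metis card_Diff_subset card_mono finite_subset le_add_diff_inverse)
    then show ?thesis
      by (simp add: ad_def psign_add endo_diff[OF A] endo_scaleC[OF A] scaleC_diff
        distrib_left distrib_right mult_ac)
  qed
  then have "(\<Sum>K\<in>Pow L. ?f K *\<^sub>C (psign (cardp L) *\<^sub>C S (A K (B (L - K) v)) - psign (p + q) *\<^sub>C A
    K (B (L - K) (S v)))) =
     hmul (p + 1) (ad S p A) B v L + psign p *\<^sub>C hmul p A (ad S q B) v L"
    by (simp add: hmul_def scaleC_sum flip: sum.distrib)
  then show ?thesis
    by (simp add: ad_def hmul_def endo_sum[OF S] endo_scaleC[OF S] scaleC_sum
      scaleC_diff sum_subtractf mult_ac)
qed (simp add: ad_def hmul_infinite endo_zero[OF S])

section \<open>The odd part of \<open>(Z - W)\<^bsup>j|J\<^esup>\<close>\<close>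

lemma sum_fun_apply: "(\<Sum>i\<in>I. f i) x = (\<Sum>i\<in>I. f i x)"
  by (induction I rule: infinite_finite_induct) auto

lemma lmul_linear:
  "lmul i (X + Y) = lmul i X + lmul i Y" "lmul i (X - Y) = lmul i X - lmul i Y"
  "lmul i (- X) = - lmul i X" "lmul i 0 = 0"
  "lmul i (\<lambda>L. c *\<^sub>C X L) = (\<lambda>L. c *\<^sub>C lmul i X L)"
  by (auto simp: lmul_def fun_eq_iff scaleC_add scaleC_diff mult.commute)

lemma ldiff_linear:
  "ldiff i (X + Y) = ldiff i X + ldiff i Y" "ldiff i (X - Y) = ldiff i X - ldiff i Y"
  "ldiff i (- X) = - ldiff i X" "ldiff i 0 = 0"
  "ldiff i (\<lambda>L. c *\<^sub>C X L) = (\<lambda>L. c *\<^sub>C ldiff i X L)"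
  by (auto simp: ldiff_def fun_eq_iff scaleC_add scaleC_diff mult.commute)

lemma lmul_sum: "lmul i (sum f A) = (\<Sum>a\<in>A. lmul i (f a))"
  by (induction A rule: infinite_finite_induct)
    (simp_all only: sum.infinite sum.empty sum.insert lmul_linear if_False not_False_eq_True)

lemma ldiff_sum: "ldiff i (sum f A) = (\<Sum>a\<in>A. ldiff i (f a))"
  by (induction A rule: infinite_finite_induct)
    (simp_all only: sum.infinite sum.empty sum.insert ldiff_linear if_False not_False_eq_True)

lemma lmul_anticommute: "lmul i (lmul j X) = - lmul j (lmul i X)"
  using lmul_lmul[of i j X] lmul_lmul_same[of i X] by (cases "i = j") (auto simp: fun_eq_iff)

lemma ldiff_lmul': "i \<noteq> j \<Longrightarrow> ldiff i (lmul j X) = - lmul j (ldiff i X)"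
  by (simp add: fun_eq_iff ldiff_lmul)

lemma ldiff_lmul_same': "ldiff i (lmul i X) = X - lmul i (ldiff i X)"
  by (simp add: fun_eq_iff ldiff_lmul_same)

text \<open>Multiplication by \<theta>^i - \<zeta>^i. Below, \<open>thetazeta\<close> is
  multiplication by \<Sum> \<theta>^i \<zeta>^i, and \<open>odd_op\<close> by the whole odd factor
  of the s-th term of (Z-W)^(j|J).\<close>

definition eta :: "nat \<Rightarrow> nat \<Rightarrow> (nat set \<Rightarrow> 'v::superspace) \<Rightarrow> nat set \<Rightarrow> 'v" where
  "eta N i X = lmul i X - lmul (N + i) X"

definition thetazeta :: "nat \<Rightarrow> (nat set \<Rightarrow> 'v::superspace) \<Rightarrow> nat set \<Rightarrow> 'v" where
  "thetazeta N X = (\<Sum>i\<in>{1..N}. lmul i (lmul (N + i) X))"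

definition odd_op :: "nat \<Rightarrow> nat \<Rightarrow> nat set \<Rightarrow> (nat set \<Rightarrow> 'v::superspace) \<Rightarrow> nat set \<Rightarrow> 'v" where
  "odd_op N s J X = (thetazeta N ^^ s) (foldr (eta N) (sorted_list_of_set J) X)"

definition odd_grass :: "nat \<Rightarrow> nat \<Rightarrow> nat set \<Rightarrow> grass" where
  "odd_grass N s J = gmul ((gmul (theta_zeta N) ^^ s) gone) (odd_factor N J)"

lemma gact_theta_minus_zeta: "finsupp X \<Longrightarrow> gact (theta_minus_zeta N i) X = eta N i X"
proof -
  assume "finsupp X"
  moreover have "theta_minus_zeta N i = (\<lambda>L. gvar i L - gvar (N + i) L)"
    by (simp add: fun_eq_iff theta_minus_zeta_def)
  ultimately show ?thesis by (simp only: gact_diff gact_gvar) (simp add: eta_def fun_eq_iff)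
qed

lemma gact_theta_zeta: "finsupp X \<Longrightarrow> gact (theta_zeta N) X = thetazeta N X"
proof -
  assume "finsupp X"
  moreover have "theta_zeta N = (\<lambda>L. \<Sum>i\<in>{1..N}. gmul (gvar i) (gvar (N + i)) L)"
    by (simp add: fun_eq_iff theta_zeta_def)
  ultimately show ?thesis
    by (simp only: gact_sum gact_gmul gact_gvar finsupp_lmul thetazeta_def) (simp add: fun_eq_iff
      sum_fun_apply)
qed

text \<open>Replaces the Grassmann coefficients in (Z-W)^(j|J) by a composition of operators,
  through which derivatives can be moved one factor at a time.\<close>

lemma gact_odd_grass:
  assumes "finsupp X" shows "gact (odd_grass N s J) X = odd_op N s J X"
proof -
  have 1: "gact (foldr (\<lambda>i. gmul (theta_minus_zeta N i)) xs gone) X = foldr (eta N) xs X" for xs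
    using assms
  proof (induction xs)
    case (Cons i xs)
    then have "finsupp (foldr (eta N) xs X)" by (metis finsupp_gact)
    then show ?case using Cons by (simp add: gact_gmul gact_theta_minus_zeta)
  qed (simp add: gact_gone)
  have 2: "gact ((gmul (theta_zeta N) ^^ s) gone) Y = (thetazeta N ^^ s) Y" if "finsupp Y" for Y
    :: "nat set \<Rightarrow> 'a"
    using that
  proof (induction s)
    case (Suc s)
    then have "finsupp ((thetazeta N ^^ s) Y)" by (metis finsupp_gact)
    then show ?case using Suc by (simp add: gact_gmul gact_theta_zeta)
  qed (simp add: gact_gone)
  have "finsupp (foldr (eta N) (sorted_list_of_set J) X)" by (metis 1 finsupp_gact)
  then show ?thesis
    by (simp add: odd_grass_def gact_gmul odd_factor_def 1 2 odd_op_def)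
qed

lemma lmul_eta: "lmul a (eta N i X) = - eta N i (lmul a X)"
  by (simp add: eta_def lmul_linear lmul_anticommute[of a])

lemma lmul_thetazeta: "lmul a (thetazeta N X) = thetazeta N (lmul a X)"
  by (simp add: thetazeta_def lmul_sum lmul_linear lmul_anticommute[of a])

lemma eta_linear: "eta N i (X + Y) = eta N i X + eta N i Y" "eta N i (X - Y) = eta N i X - eta N i Y"
  "eta N i (\<lambda>L. c *\<^sub>C X L) = (\<lambda>L. c *\<^sub>C eta N i X L)" "eta N i (- X) = - eta N i X"
  by (simp_all add: eta_def lmul_linear fun_eq_iff scaleC_diff)

lemma thetazeta_linear: "thetazeta N (X + Y) = thetazeta N X + thetazeta N Y"
  "thetazeta N (X - Y) = thetazeta N X - thetazeta N Y" "thetazeta N (- X) = - thetazeta N X"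
  "thetazeta N (\<lambda>L. c *\<^sub>C X L) = (\<lambda>L. c *\<^sub>C thetazeta N X L)"
proof -
  show "thetazeta N (X + Y) = thetazeta N X + thetazeta N Y"
    "thetazeta N (X - Y) = thetazeta N X - thetazeta N Y" "thetazeta N (- X) = - thetazeta N X"
    by (simp_all add: thetazeta_def lmul_linear sum.distrib sum_subtractf sum_negf)
  have "(\<Sum>i\<in>I. (\<lambda>L. c *\<^sub>C f i L)) = (\<lambda>L. c *\<^sub>C (\<Sum>i\<in>I. f i) L)" for I and f :: "nat \<Rightarrow> nat set \<Rightarrow> 'a"
    by (induction I rule: infinite_finite_induct) (auto simp: fun_eq_iff scaleC_add)
  then show "thetazeta N (\<lambda>L. c *\<^sub>C X L) = (\<lambda>L. c *\<^sub>C thetazeta N X L)"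
    by (simp add: thetazeta_def lmul_linear)
qed

lemma foldr_eta_linear: "foldr (eta N) xs (X + Y) = foldr (eta N) xs X + foldr (eta N) xs Y"
  "foldr (eta N) xs (X - Y) = foldr (eta N) xs X - foldr (eta N) xs Y"
  "foldr (eta N) xs (\<lambda>L. c *\<^sub>C X L) = (\<lambda>L. c *\<^sub>C foldr (eta N) xs X L)"
  by (induction xs) (simp_all add: eta_linear)

lemma thetazeta_funpow_linear: "(thetazeta N ^^ s) (X + Y) = (thetazeta N ^^ s) X + (thetazeta N
  ^^ s) Y"
  "(thetazeta N ^^ s) (X - Y) = (thetazeta N ^^ s) X - (thetazeta N ^^ s) Y"
  "(thetazeta N ^^ s) (\<lambda>L. c *\<^sub>C X L) = (\<lambda>L. c *\<^sub>C (thetazeta N ^^ s) X L)"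
  by (induction s) (simp_all add: thetazeta_linear)

lemma odd_op_linear: "odd_op N s J (X + Y) = odd_op N s J X + odd_op N s J Y"
  "odd_op N s J (X - Y) = odd_op N s J X - odd_op N s J Y"
  "odd_op N s J (\<lambda>L. c *\<^sub>C X L) = (\<lambda>L. c *\<^sub>C odd_op N s J X L)"
  by (simp_all add: odd_op_def foldr_eta_linear thetazeta_funpow_linear)

lemma scaleC_one_eq: "(\<lambda>L. 1 *\<^sub>C X L) = X"
  by (simp add: fun_eq_iff)

lemma anticommute_foldr_eta:
  assumes "\<And>i X. i \<in> set xs \<Longrightarrow> D (eta N i X) = - eta N i (D X)"
  shows "D (foldr (eta N) xs X) = (\<lambda>L. psign (of_nat (length xs)) *\<^sub>C foldr (eta N) xs (D X) L)"
  using assms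
proof (induction xs)
  case (Cons a xs)
  have IH: "D (foldr (eta N) xs X) = (\<lambda>L. psign (of_nat (length xs)) *\<^sub>C foldr (eta N) xs (D X) L)"
    using Cons.prems by (intro Cons.IH) simp
  have "D (foldr (eta N) (a # xs) X) = - eta N a (D (foldr (eta N) xs X))"
    unfolding foldr.simps o_apply by (rule Cons.prems) simp
  also have "\<dots> = - (\<lambda>L. psign (of_nat (length xs)) *\<^sub>C eta N a (foldr (eta N) xs (D X)) L)"
    unfolding IH eta_linear(3) ..
  finally show ?case by (simp add: psign_add fun_eq_iff)
qed (simp add: scaleC_one_eq)

lemma commute_thetazeta_funpow:
  assumes "\<And>X. D (thetazeta N X) = thetazeta N (D X)"
  shows "D ((thetazeta N ^^ s) X) = (thetazeta N ^^ s) (D X)"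
  by (induction s) (simp_all add: assms)

lemma lmul_odd_op:
  "lmul a (odd_op N s J X) = (\<lambda>L. psign (cardp J) *\<^sub>C odd_op N s J (lmul a X) L)"
  by (simp add: odd_op_def commute_thetazeta_funpow[where D = "lmul a", OF lmul_thetazeta]
      anticommute_foldr_eta[where D = "lmul a", OF lmul_eta] thetazeta_funpow_linear)

definition ldiff2 :: "nat \<Rightarrow> nat \<Rightarrow> (nat set \<Rightarrow> 'v::superspace) \<Rightarrow> nat set \<Rightarrow> 'v" where
  "ldiff2 N i X = ldiff i X + ldiff (N + i) X"

text \<open>The contributions of \<theta>^j and \<zeta>^j to the derivative of \<theta>^j -
  \<zeta>^j cancel, which leaves only the sign of crossing an odd factor.\<close>

lemma ldiff2_eta:
  assumes "i \<in> {1..N}" "j \<in> {1..N}"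
  shows "ldiff2 N i (eta N j X) = - eta N j (ldiff2 N i X)"
proof (cases "i = j")
  case True
  have "i \<noteq> N + j" "N + i \<noteq> j" using assms by auto
  then show ?thesis using True assms
    by (simp add: ldiff2_def eta_def ldiff_linear lmul_linear ldiff_lmul' ldiff_lmul_same')
next
  case False
  have "i \<noteq> N + j" "N + i \<noteq> j" using assms by auto
  then show ?thesis using False
    by (simp add: ldiff2_def eta_def ldiff_linear lmul_linear ldiff_lmul')
qed

text \<open>The extra term is the derivative \<zeta>^i - \<theta>^i of \<theta>^i \<zeta>^i.\<close>

lemma ldiff2_thetazeta:
  assumes "i \<in> {1..N}"
  shows "ldiff2 N i (thetazeta N X) = thetazeta N (ldiff2 N i X) - eta N i X"
proof -
  have *: "ldiff2 N i (lmul j (lmul (N + j) X)) =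
      lmul j (lmul (N + j) (ldiff2 N i X)) - (if j = i then eta N i X else 0)" if "j \<in> {1..N}" for j
  proof (cases "i = j")
    case True
    have "i \<noteq> N + j" "N + i \<noteq> j" using assms that by auto
    then show ?thesis using True assms
      by (simp add: ldiff2_def eta_def ldiff_linear lmul_linear ldiff_lmul' ldiff_lmul_same')
  next
    case False
    have "i \<noteq> N + j" "N + i \<noteq> j" using assms that by auto
    then show ?thesis using False
      by (simp add: ldiff2_def eta_def ldiff_linear lmul_linear ldiff_lmul')
  qed
  have "ldiff2 N i (thetazeta N X) = (\<Sum>j\<in>{1..N}. ldiff2 N i (lmul j (lmul (N + j) X)))"
    by (simp add: thetazeta_def ldiff2_def ldiff_sum sum.distrib)
  also have "\<dots> = (\<Sum>j\<in>{1..N}. lmul j (lmul (N + j) (ldiff2 N i X)) - (if j = i then eta N i X else 0))"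
    by (rule sum.cong[OF refl *])
  also have "\<dots> = thetazeta N (ldiff2 N i X) - eta N i X"
    using assms by (simp add: sum_subtractf thetazeta_def)
  finally show ?thesis .
qed

lemma eta_thetazeta: "eta N i (thetazeta N X) = thetazeta N (eta N i X)"
  by (simp add: eta_def lmul_thetazeta thetazeta_linear)

text \<open>Power rule: \<open>eta\<close> commutes with \<open>thetazeta\<close>, so the s
  correction terms coincide. At s = 0 the truncated exponent s - 1 is multiplied by 0.\<close>

lemma ldiff2_thetazeta_funpow:
  assumes "i \<in> {1..N}"
  shows "ldiff2 N i ((thetazeta N ^^ s) X) =
    (thetazeta N ^^ s) (ldiff2 N i X) - (\<lambda>L. of_nat s *\<^sub>C eta N i ((thetazeta N ^^ (s - 1)) X) L)"
proof (induction s)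
  case (Suc s)
  have *: "thetazeta N (\<lambda>L. of_nat s *\<^sub>C eta N i ((thetazeta N ^^ (s - 1)) X) L) =
      (\<lambda>L. of_nat s *\<^sub>C eta N i ((thetazeta N ^^ s) X) L)"
    unfolding thetazeta_linear by (cases s) (simp_all flip: eta_thetazeta)
  have "ldiff2 N i ((thetazeta N ^^ Suc s) X) = (thetazeta N ^^ Suc s) (ldiff2 N i X)
      - (\<lambda>L. of_nat s *\<^sub>C eta N i ((thetazeta N ^^ s) X) L) - eta N i ((thetazeta N ^^ s) X)"
    unfolding funpow.simps o_apply ldiff2_thetazeta[OF assms] Suc thetazeta_linear(2) * ..
  then show ?case by (simp add: fun_eq_iff superspace.scale_left_distrib)
qed (simp add: fun_eq_iff)

lemma ldiff2_odd_op:
  assumes "i \<in> {1..N}" "J \<subseteq> {1..N}"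
  shows "ldiff2 N i (odd_op N s J X) L = psign (cardp J) *\<^sub>C odd_op N s J (ldiff2 N i X) L
    - of_nat s *\<^sub>C eta N i (odd_op N (s - 1) J X) L"
proof -
  have "set (sorted_list_of_set J) \<subseteq> {1..N}" using assms(2) finite_subset[of J "{1..N}"] by simp
  then have "ldiff2 N i (foldr (eta N) (sorted_list_of_set J) X) =
     (\<lambda>L. psign (cardp J) *\<^sub>C foldr (eta N) (sorted_list_of_set J) (ldiff2 N i X) L)"
    by (subst anticommute_foldr_eta) (auto simp: subset_iff ldiff2_eta[OF assms(1)])
  then show ?thesis
    by (simp add: odd_op_def ldiff2_thetazeta_funpow[OF assms(1)] thetazeta_funpow_linear)
qed

text \<open>A lower bound d for the Grassmann degree in the 2N variables \<theta> and \<zeta>;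
  degree above 2N forces 0.\<close>

definition supp_ge :: "nat \<Rightarrow> nat \<Rightarrow> (nat set \<Rightarrow> 'v::superspace) \<Rightarrow> bool" where
  "supp_ge N d X \<longleftrightarrow> (\<forall>L. X L \<noteq> 0 \<longrightarrow> L \<subseteq> {1..2 * N} \<and> d \<le> card L)"

lemma supp_ge_finsupp: "supp_ge N d X \<Longrightarrow> finsupp X"
  unfolding supp_ge_def finsupp_def by (meson finite_atLeastAtMost finite_subset)

lemma supp_ge_lmul:
  assumes "supp_ge N d X" "a \<in> {1..2 * N}" shows "supp_ge N (Suc d) (lmul a X)"
  unfolding supp_ge_def
proof (intro allI impI)
  fix L assume "lmul a X L \<noteq> 0"
  then have L: "a \<in> L" "X (L - {a}) \<noteq> 0" by (auto simp: lmul_def split: if_splits)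
  then have *: "L - {a} \<subseteq> {1..2 * N}" "d \<le> card (L - {a})" using assms(1) by (auto simp: supp_ge_def)
  have "finite (L - {a})" by (rule finite_subset[OF *(1)]) simp
  then have "finite L" by (rule finite_Diff2[THEN iffD1, rotated]) (rule finite.emptyI[THEN
    finite.insertI])
  then have "Suc (card (L - {a})) = card L" by (rule card_Suc_Diff1) (rule L(1))
  then show "L \<subseteq> {1..2 * N} \<and> Suc d \<le> card L" using * L(1) assms(2) by auto
qed

lemma supp_ge_add:
  assumes "supp_ge N d X" "supp_ge N d Y" shows "supp_ge N d (X + Y)"
  unfolding supp_ge_def
proof (intro allI impI)
  fix L assume "(X + Y) L \<noteq> 0"
  then have "X L \<noteq> 0 \<or> Y L \<noteq> 0" by auto
  then show "L \<subseteq> {1..2 * N} \<and> d \<le> card L" using assms unfolding supp_ge_def by blast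
qed

lemma supp_ge_diff:
  assumes "supp_ge N d X" "supp_ge N d Y" shows "supp_ge N d (X - Y)"
  unfolding supp_ge_def
proof (intro allI impI)
  fix L assume "(X - Y) L \<noteq> 0"
  then have "X L \<noteq> 0 \<or> Y L \<noteq> 0" by auto
  then show "L \<subseteq> {1..2 * N} \<and> d \<le> card L" using assms unfolding supp_ge_def by blast
qed

lemma supp_ge_zero: "supp_ge N d 0"
  by (simp add: supp_ge_def)

lemma supp_ge_mono: "supp_ge N d X \<Longrightarrow> d' \<le> d \<Longrightarrow> supp_ge N d' X"
  unfolding supp_ge_def by (meson le_trans)

lemma supp_ge_thetazeta:
  assumes "supp_ge N d X" shows "supp_ge N (d + 2) (thetazeta N X)"
proof -
  have "supp_ge N (d + 2) (\<Sum>i\<in>I. lmul i (lmul (N + i) X))" if "I \<subseteq> {1..N}" for I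
    using finite_subset[OF that] that
  proof (induction I rule: infinite_finite_induct)
    case (insert i I)
    then have "supp_ge N (d + 2) (lmul i (lmul (N + i) X))"
      using supp_ge_lmul[OF supp_ge_lmul[OF assms, of "N + i"], of i] by simp
    moreover have "supp_ge N (d + 2) (\<Sum>i\<in>I. lmul i (lmul (N + i) X))" using insert by simp
    ultimately show ?case unfolding sum.insert[OF insert(1,2)] by (rule supp_ge_add)
  qed (auto simp: supp_ge_zero)
  then show ?thesis by (simp add: thetazeta_def)
qed

lemma supp_ge_eta: "supp_ge N d X \<Longrightarrow> i \<in> {1..N} \<Longrightarrow> supp_ge N d (eta N i X)"
  using supp_ge_mono[OF supp_ge_lmul[of N d X i]] supp_ge_mono[OF supp_ge_lmul[of N d X "N + i"]]
  by (auto simp: eta_def intro!: supp_ge_diff)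

lemma supp_ge_odd_op:
  assumes "supp_ge N 0 X" "J \<subseteq> {1..N}" shows "supp_ge N (2 * s) (odd_op N s J X)"
proof -
  have "supp_ge N 0 (foldr (eta N) xs X)" if "set xs \<subseteq> {1..N}" for xs
    using that by (induction xs) (auto simp: assms intro!: supp_ge_eta)
  moreover have "set (sorted_list_of_set J) \<subseteq> {1..N}" using assms(2) finite_subset[of J "{1..N}"]
    by simp
  ultimately have "supp_ge N 0 (foldr (eta N) (sorted_list_of_set J) X)" by blast
  then show ?thesis unfolding odd_op_def
    by (induction s) (auto dest: supp_ge_thetazeta)
qed

text \<open>The N-th power of \<Sum> \<theta>^i \<zeta>^i already has degree 2N, so one more odd
  factor kills it. This disposes of the boundary term left by cutting the expansion off at s =
  N.\<close>

lemma eta_odd_op_top: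
  assumes "supp_ge N 0 X" "J \<subseteq> {1..N}" "i \<in> {1..N}"
  shows "eta N i (odd_op N N J X) = 0"
proof -
  have "lmul a (odd_op N N J X) L = 0" if "a \<in> {1..2 * N}" for a L
  proof (rule ccontr)
    assume "lmul a (odd_op N N J X) L \<noteq> 0"
    with supp_ge_lmul[OF supp_ge_odd_op[OF assms(1,2)] that, of N]
    have "L \<subseteq> {1..2 * N}" "Suc (2 * N) \<le> card L" by (auto simp: supp_ge_def)
    with card_mono[of "{1..2 * N}" L] show False by simp
  qed
  then show ?thesis using assms(3) by (simp add: eta_def fun_eq_iff)
qed

section \<open>Translation invariance of \<open>(Z - W)\<^bsup>j|J\<^esup>\<close>\<close>

type_synonym 'v gdist2 = "int \<Rightarrow> int \<Rightarrow> nat set \<Rightarrow> 'v"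

definition coeffs_fin :: "expansion \<Rightarrow> 'v::superspace gdist2 \<Rightarrow> bool" where
  "coeffs_fin e \<Phi> \<longleftrightarrow> (\<forall>n L. conv_fin e n (\<lambda>m k. \<Phi> m k L))"

lemma coeffs_fin_gact: "coeffs_fin e \<Phi> \<Longrightarrow> coeffs_fin e (\<lambda>m k. gact g (\<Phi> m k))"
  unfolding coeffs_fin_def gact_def by (intro allI conv_fin_sum conv_fin_scaleC) auto

lemma conv_fin_if:
  "conv_fin e n f \<Longrightarrow> conv_fin e n g \<Longrightarrow> conv_fin e n (\<lambda>m k. if b then f m k else g m k)"
  by (cases b) simp_all

lemma coeffs_fin_lmul: "coeffs_fin e \<Phi> \<Longrightarrow> coeffs_fin e (\<lambda>m k. lmul i (\<Phi> m k))"
  by (auto simp: coeffs_fin_def lmul_def intro!: conv_fin_if conv_fin_scaleC conv_fin_zero)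

lemma coeffs_fin_ldiff: "coeffs_fin e \<Phi> \<Longrightarrow> coeffs_fin e (\<lambda>m k. ldiff i (\<Phi> m k))"
  by (auto simp: coeffs_fin_def ldiff_def intro!: conv_fin_if conv_fin_scaleC conv_fin_zero)

lemma coeffs_fin_odd_op:
  assumes "coeffs_fin e \<Phi>" "\<And>m k. finsupp (\<Phi> m k)"
  shows "coeffs_fin e (\<lambda>m k. odd_op N s J (\<Phi> m k))"
  using coeffs_fin_gact[OF assms(1), of "odd_grass N s J"] by (simp add: gact_odd_grass[OF assms(2)])

lemma lmul_conv: "lmul i (\<lambda>L. conv e n (\<lambda>m k. \<Phi> m k L) m k) L = conv e n (\<lambda>m k. lmul i (\<Phi> m k) L) m k"
  by (auto simp: lmul_def conv_scaleC)

lemma ldiff_conv: "ldiff i (\<lambda>L. conv e n (\<lambda>m k. \<Phi> m k L) m k) L = conv e n (\<lambda>m k. ldiff i (\<Phi> m k)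
  L) m k"
  by (auto simp: ldiff_def conv_scaleC)

definition zw_coeff :: "int \<Rightarrow> nat \<Rightarrow> complex" where
  "zw_coeff j s = (of_int j gchoose s) * (- 1) ^ s"

definition zw_mul :: "expansion \<Rightarrow> nat \<Rightarrow> int \<Rightarrow> nat set \<Rightarrow> 'v::superspace gdist2 \<Rightarrow> 'v gdist2" where
  "zw_mul e N j J \<Phi> m k L =
    (\<Sum>s\<le>N. zw_coeff j s *\<^sub>C conv e (j - int s) (\<lambda>m k. odd_op N s J (\<Phi> m k) L) m k)"

lemma dist_mul_ZW_power:
  assumes "coeffs_fin e (\<lambda>m k L. X m k L v)" "\<And>m k. finsupp (\<lambda>L. X m k L v)"
  shows "dist_mul (ZW_power e N j J) X m k L v = zw_mul e N j J (\<lambda>m k L. X m k L v) m k L"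
proof -
  let ?f = "\<lambda>s p. case p of (m', k') \<Rightarrow>
      e (j - int s) m' k' *\<^sub>C gact (odd_grass N s J) (\<lambda>L. X (m - m') (k - k') L v) L"
  have "conv_fin e (j - int s) (\<lambda>m k. gact (odd_grass N s J) (\<lambda>L. X m k L v) L)" for s
    using coeffs_fin_gact[OF assms(1), of "odd_grass N s J"] by (simp add: coeffs_fin_def)
  then have fin: "finite {p. ?f s p \<noteq> 0}" for s by (rule conv_finD)
  then have fin': "finite {p. zw_coeff j s *\<^sub>C ?f s p \<noteq> 0}" for s
    by (rule finite_subset[rotated]) auto
  have "dist_mul (ZW_power e N j J) X m k L v = Sum_any (\<lambda>p. \<Sum>s\<le>N. zw_coeff j s *\<^sub>C ?f s p)"
    unfolding dist_mul_def
  proof (intro arg_cong[where f = Sum_any] ext)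
    fix p :: "int \<times> int"
    obtain m' k' where p: "p = (m', k')" by force
    have "(\<Sum>K\<in>Pow L. (gsign K (L - K) * ZW_power e N j J m' k' K) *\<^sub>C X (m - m') (k - k') (L - K) v) =
       (\<Sum>K\<in>Pow L. \<Sum>s\<le>N. (gsign K (L - K) * (zw_coeff j s * e (j - int s) m' k' * odd_grass N s J
         K)) *\<^sub>C X (m - m') (k - k') (L - K) v)"
      by (simp add: ZW_power_def odd_grass_def zw_coeff_def sum_distrib_left superspace.scale_sum_left)
    also have "\<dots> = (\<Sum>s\<le>N. \<Sum>K\<in>Pow L. (gsign K (L - K) * (zw_coeff j s * e (j - int s) m' k' *
      odd_grass N s J K)) *\<^sub>C X (m - m') (k - k') (L - K) v)"
      by (rule sum.swap)
    also have "\<dots> = (\<Sum>s\<le>N. zw_coeff j s *\<^sub>C ?f s p)"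
      by (simp add: p gact_def scaleC_sum mult_ac)
    finally show "(case p of (m', k') \<Rightarrow> \<Sum>K\<in>Pow L. (gsign K (L - K) * ZW_power e N j J m' k' K) *\<^sub>C
      X (m - m') (k - k') (L - K) v) =
      (\<Sum>s\<le>N. zw_coeff j s *\<^sub>C ?f s p)" by (simp add: p)
  qed
  also have "\<dots> = (\<Sum>s\<le>N. zw_coeff j s *\<^sub>C Sum_any (?f s))"
    unfolding Sum_any_scaleC by (rule Sum_any_sum(1)[OF _ fin']) simp
  finally show ?thesis
    by (simp add: zw_mul_def conv_def gact_odd_grass assms(2))
qed

text \<open>The sum of the two covariant derivatives: \<partial>/\<partial>\<theta>^i - \<theta>^i
  \<partial>/\<partial>z in Z and \<partial>/\<partial>\<zeta>^i - \<zeta>^i \<partial>/\<partial>w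
  in W.\<close>

definition total_diff :: "nat \<Rightarrow> nat \<Rightarrow> 'v::superspace gdist2 \<Rightarrow> 'v gdist2" where
  "total_diff N i \<Phi> m k = ldiff2 N i (\<Phi> m k) - (\<lambda>L. of_int (m + 1) *\<^sub>C lmul i (\<Phi> (m + 1) k) L)
     - (\<lambda>L. of_int (k + 1) *\<^sub>C lmul (N + i) (\<Phi> m (k + 1)) L)"

lemma zw_coeff_Suc: "zw_coeff j (Suc s) * of_nat (Suc s) = - (zw_coeff j s * of_int (j - int s))"
proof -
  have "of_nat (Suc s) * (of_int j gchoose Suc s) = (of_int j - of_nat s) * (of_int j gchoose s ::
    complex)"
    using gchoose_absorb gchoose_absorb_comp by metis
  then have "(of_int j gchoose Suc s) * of_nat (Suc s) = (of_int j gchoose s) * (of_int j - of_nat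
    s :: complex)"
    by (simp only: mult.commute)
  then show ?thesis unfolding zw_coeff_def by (simp add: mult_ac)
qed

text \<open>In the application w_s comes from differentiating the s-th power of \<Sum> \<theta>^i
  \<zeta>^i and u_s from differentiating (z-w)^(j-s); the recursion of the binomial coefficients
  cancels u_s against w_(s+1).\<close>

lemma zw_coeff_telescope:
  assumes "\<And>s. w (Suc s) = u s"
  shows "(\<Sum>s\<le>n. zw_coeff j s *\<^sub>C (of_nat s *\<^sub>C w s + of_int (j - int s) *\<^sub>C u s)) =
    (zw_coeff j n * of_int (j - int n)) *\<^sub>C u n"
proof (induction n)
  case (Suc n)
  have "zw_coeff j (Suc n) *\<^sub>C of_nat (Suc n) *\<^sub>C w (Suc n) = - ((zw_coeff j n * of_int (j - int
    n)) *\<^sub>C u n)"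
    unfolding superspace.scale_scale zw_coeff_Suc assms by simp
  moreover have "(\<Sum>s\<le>Suc n. zw_coeff j s *\<^sub>C (of_nat s *\<^sub>C w s + of_int (j - int s) *\<^sub>C u s)) =
      (zw_coeff j n * of_int (j - int n)) *\<^sub>C u n +
      zw_coeff j (Suc n) *\<^sub>C (of_nat (Suc n) *\<^sub>C w (Suc n) + of_int (j - int (Suc n)) *\<^sub>C u (Suc n))"
    by (simp only: sum.atMost_Suc Suc.IH)
  ultimately show ?case by (simp add: scaleC_add)
qed simp

context expansion
begin

text \<open>
  The coordinates \<open>z - w - \<Sum>\<^sub>i \<theta>\<^sup>i \<zeta>\<^sup>i\<close> and \<open>\<theta>\<^sup>i - \<zeta>\<^sup>i\<close> are annihilated by the sum of the two
  covariant derivatives, which therefore supercommutes with multiplication by \<open>(Z - W)\<^bsup>j|J\<^esup>\<close>.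
\<close>

lemma total_diff_zw_mul:
  assumes fin: "coeffs_fin e \<Phi>" and supp: "\<And>m k. supp_ge N 0 (\<Phi> m k)"
    and i: "i \<in> {1..N}" and J: "J \<subseteq> {1..N}"
  shows "total_diff N i (zw_mul e N j J \<Phi>) m k L = psign (cardp J) *\<^sub>C zw_mul e N j J (total_diff
    N i \<Phi>) m k L"
proof -
  define c where "c = psign (cardp J)"
  note finsupp = supp_ge_finsupp[OF supp]
  define Q where "Q s = (\<lambda>m k. odd_op N s J (\<Phi> m k))" for s
  have finQ: "coeffs_fin e (Q s)" for s
    unfolding Q_def by (rule coeffs_fin_odd_op[OF fin finsupp])
  \<comment> \<open>At s = 0 the index s - 1 is a truncated 0, but \<open>w 0\<close> only occurs
    with the factor \<open>of_nat 0\<close>.\<close>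
  define w where "w s = conv e (j - int s) (\<lambda>m k. eta N i (Q (s - 1) m k) L) m k" for s
  define u where "u s = conv e (j - int s - 1) (\<lambda>m k. eta N i (Q s m k) L) m k" for s
  define f1 where "f1 s = (\<lambda>m k. odd_op N s J (ldiff2 N i (\<Phi> m k)) L)" for s
  define f2 where "f2 s = (\<lambda>m k. odd_op N s J (lmul i (\<Phi> m k)) L)" for s
  define f3 where "f3 s = (\<lambda>m k. odd_op N s J (lmul (N + i) (\<Phi> m k)) L)" for s
  have supp': "finsupp (lmul a (\<Phi> m k))" "finsupp (ldiff a (\<Phi> m k))" for a m k
    using finsupp[of m k] by (auto simp: finsupp_def lmul_def ldiff_def)
  have fin2: "conv_fin e n (f2 s)" and fin3: "conv_fin e n (f3 s)" for n s
    using coeffs_fin_odd_op[OF coeffs_fin_lmul[OF fin] supp'(1)]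
    by (auto simp: f2_def f3_def coeffs_fin_def)
  have fin1: "conv_fin e n (f1 s)" for n s
    using coeffs_fin_odd_op[OF coeffs_fin_ldiff[OF fin] supp'(2)]
    by (auto simp: f1_def ldiff2_def odd_op_linear coeffs_fin_def intro!: conv_fin_add)
  have fin_eta: "conv_fin e n (\<lambda>m k. eta N i (Q s m k) L)" for n s
    using coeffs_fin_lmul[OF finQ[of s]] by (auto simp: eta_def coeffs_fin_def intro!: conv_fin_diff)
  have step: "ldiff2 N i (\<lambda>L. conv e (j - int s) (\<lambda>m k. Q s m k L) m k) L
      - of_int (m + 1) *\<^sub>C lmul i (\<lambda>L. conv e (j - int s) (\<lambda>m k. Q s m k L) (m + 1) k) L
      - of_int (k + 1) *\<^sub>C lmul (N + i) (\<lambda>L. conv e (j - int s) (\<lambda>m k. Q s m k L) m (k + 1)) L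
    = c *\<^sub>C conv e (j - int s) (\<lambda>m k. odd_op N s J (total_diff N i \<Phi> m k) L) m k
      - (of_nat s *\<^sub>C w s + of_int (j - int s) *\<^sub>C u s)" (is "?t1 - ?t2 - ?t3 = ?rhs") for s
  proof -
    let ?n = "j - int s"
    have Q2: "lmul i (Q s m k) L = c *\<^sub>C f2 s m k" "lmul (N + i) (Q s m k) L = c *\<^sub>C f3 s m k" for m k
      by (simp_all add: Q_def f2_def f3_def c_def lmul_odd_op)
    have "?t1 = conv e ?n (\<lambda>m k. ldiff2 N i (Q s m k) L) m k"
      using coeffs_fin_ldiff[OF finQ[of s]]
      by (simp add: ldiff2_def ldiff_conv conv_add coeffs_fin_def)
    also have "\<dots> = conv e ?n (\<lambda>m k. c *\<^sub>C f1 s m k - of_nat s *\<^sub>C eta N i (Q (s - 1) m k) L) m k"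
      by (simp add: Q_def ldiff2_odd_op[OF i J] c_def f1_def)
    also have "\<dots> = c *\<^sub>C conv e ?n (f1 s) m k - of_nat s *\<^sub>C w s"
      by (subst conv_diff) (simp_all add: conv_fin_scaleC fin1 fin_eta conv_scaleC w_def)
    finally have t1: "?t1 = c *\<^sub>C conv e ?n (f1 s) m k - of_nat s *\<^sub>C w s" .
    have "?t2 = diff1 (conv e ?n (\<lambda>m k. c *\<^sub>C f2 s m k)) m k"
      unfolding lmul_conv Q2 by (simp add: diff1_def)
    also have "\<dots> = conv e ?n (diff1 (\<lambda>m k. c *\<^sub>C f2 s m k)) m k + of_int ?n *\<^sub>C conv e (?n - 1)
      (\<lambda>m k. c *\<^sub>C f2 s m k) m k"
      by (intro conv_diff1 conv_fin_scaleC fin2)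
    also have "diff1 (\<lambda>m k. c *\<^sub>C f2 s m k) = (\<lambda>m k. c *\<^sub>C diff1 (f2 s) m k)"
      by (simp add: diff1_def fun_eq_iff mult.commute)
    finally have t2: "?t2 = c *\<^sub>C conv e ?n (diff1 (f2 s)) m k + of_int ?n *\<^sub>C conv e (?n - 1) (\<lambda>m
      k. c *\<^sub>C f2 s m k) m k"
      by (simp only: conv_scaleC)
    have "?t3 = diff2 (conv e ?n (\<lambda>m k. c *\<^sub>C f3 s m k)) m k"
      unfolding lmul_conv Q2 by (simp add: diff2_def)
    also have "\<dots> = conv e ?n (diff2 (\<lambda>m k. c *\<^sub>C f3 s m k)) m k - of_int ?n *\<^sub>C conv e (?n - 1)
      (\<lambda>m k. c *\<^sub>C f3 s m k) m k"
      by (intro conv_diff2 conv_fin_scaleC fin3)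
    also have "diff2 (\<lambda>m k. c *\<^sub>C f3 s m k) = (\<lambda>m k. c *\<^sub>C diff2 (f3 s) m k)"
      by (simp add: diff2_def fun_eq_iff mult.commute)
    finally have t3: "?t3 = c *\<^sub>C conv e ?n (diff2 (f3 s)) m k - of_int ?n *\<^sub>C conv e (?n - 1) (\<lambda>m
      k. c *\<^sub>C f3 s m k) m k"
      by (simp only: conv_scaleC)
    have "u s = conv e (?n - 1) (\<lambda>m k. c *\<^sub>C f2 s m k - c *\<^sub>C f3 s m k) m k"
      by (simp add: u_def eta_def Q2)
    also have "\<dots> = conv e (?n - 1) (\<lambda>m k. c *\<^sub>C f2 s m k) m k - conv e (?n - 1) (\<lambda>m k. c *\<^sub>C f3 s
      m k) m k"
      by (intro conv_diff conv_fin_scaleC fin2 fin3)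
    finally have u: "u s = \<dots>" .
    have "odd_op N s J (total_diff N i \<Phi> m k) L = f1 s m k - diff1 (f2 s) m k - diff2 (f3 s) m k"
      for m k
      by (simp add: total_diff_def odd_op_linear f1_def f2_def f3_def diff1_def diff2_def)
    then have "conv e ?n (\<lambda>m k. odd_op N s J (total_diff N i \<Phi> m k) L) m k =
        conv e ?n (\<lambda>m k. f1 s m k - diff1 (f2 s) m k - diff2 (f3 s) m k) m k" by simp
    also have "\<dots> = conv e ?n (f1 s) m k - conv e ?n (diff1 (f2 s)) m k - conv e ?n (diff2 (f3 s)) m k"
      by (simp add: conv_diff conv_fin_diff conv_fin_diff1 conv_fin_diff2 fin1 fin2 fin3)
    finally have td: "conv e ?n (\<lambda>m k. odd_op N s J (total_diff N i \<Phi> m k) L) m k = \<dots>" .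
    show ?thesis
      unfolding t1 t2 t3 u td by (simp add: scaleC_diff)
  qed
  have u_N: "u N = 0"
    by (simp add: u_def Q_def eta_odd_op_top[OF supp J i])
  have zw: "zw_mul e N j J \<Phi> m k = (\<Sum>s\<le>N. (\<lambda>L. zw_coeff j s *\<^sub>C conv e (j - int s) (\<lambda>m k. Q s m k
    L) m k))" for m k
    by (simp add: fun_eq_iff zw_mul_def Q_def sum_fun_apply)
  have "total_diff N i (zw_mul e N j J \<Phi>) m k L =
     (\<Sum>s\<le>N. zw_coeff j s *\<^sub>C (ldiff2 N i (\<lambda>L. conv e (j - int s) (\<lambda>m k. Q s m k L) m k) L
      - of_int (m + 1) *\<^sub>C lmul i (\<lambda>L. conv e (j - int s) (\<lambda>m k. Q s m k L) (m + 1) k) L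
      - of_int (k + 1) *\<^sub>C lmul (N + i) (\<lambda>L. conv e (j - int s) (\<lambda>m k. Q s m k L) m (k + 1)) L))"
    by (simp add: sum_fun_apply total_diff_def zw ldiff2_def ldiff_sum lmul_sum ldiff_linear lmul_linear
        scaleC_sum sum_subtractf sum.distrib scaleC_diff
        scaleC_add mult_ac)
  also have "\<dots> = c *\<^sub>C zw_mul e N j J (total_diff N i \<Phi>) m k L -
      (\<Sum>s\<le>N. zw_coeff j s *\<^sub>C (of_nat s *\<^sub>C w s + of_int (j - int s) *\<^sub>C u s))"
    unfolding step by (simp add: scaleC_diff sum_subtractf zw_mul_def
        scaleC_sum mult.commute)
  also have "(\<Sum>s\<le>N. zw_coeff j s *\<^sub>C (of_nat s *\<^sub>C w s + of_int (j - int s) *\<^sub>C u s)) = 0"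
  proof -
    have "w (Suc s) = u s" for s by (simp add: w_def u_def algebra_simps)
    from zw_coeff_telescope[where w = w, OF this] show ?thesis by (simp add: u_N)
  qed
  finally show ?thesis by (simp add: c_def)
qed

end

text \<open>S with the sign of an odd operator crossing the variables of L, so that it anticommutes
  with each \<open>lmul\<close>. The value 0 at infinite L agrees with the default of
  \<open>gact\<close>.\<close>

definition signed_op :: "('v::superspace \<Rightarrow> 'v) \<Rightarrow> (nat set \<Rightarrow> 'v) \<Rightarrow> nat set \<Rightarrow> 'v" where
  "signed_op S X L = (if finite L then psign (cardp L) *\<^sub>C S (X L) else 0)"

lemma lmul_signed_op:
  assumes "endo S" shows "lmul a (signed_op S X) = - signed_op S (lmul a X)"
proof
  fix L
  show "lmul a (signed_op S X) L = (- signed_op S (lmul a X)) L"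
  proof (cases "finite L \<and> a \<in> L")
    case True
    then have "card L = Suc (card (L - {a}))" by (metis card_Suc_Diff1)
    then show ?thesis using True
      by (simp add: lmul_def signed_op_def psign_add endo_scaleC[OF assms] mult.commute)
  qed (auto simp: lmul_def signed_op_def endo_zero[OF assms])
qed

lemma signed_op_linear:
  assumes "endo S"
  shows "signed_op S (X + Y) = signed_op S X + signed_op S Y" "signed_op S (X - Y) = signed_op S X
    - signed_op S Y"
    "signed_op S (- X) = - signed_op S X" "signed_op S 0 = 0"
  by (auto simp: signed_op_def fun_eq_iff endo_add[OF assms] endo_diff[OF assms] endo_minus[OF assms]
    endo_zero[OF assms] scaleC_add scaleC_diff)

lemma signed_op_odd_op:
  assumes "endo S"
  shows "signed_op S (odd_op N s J X) = (\<lambda>L. psign (cardp J) *\<^sub>C odd_op N s J (signed_op S X) L)"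
proof -
  have lm: "signed_op S (lmul a X) = - lmul a (signed_op S X)" for a X
    by (simp add: lmul_signed_op[OF assms])
  have eta: "signed_op S (eta N i X) = - eta N i (signed_op S X)" for i X
    by (simp add: eta_def signed_op_linear[OF assms] lm)
  have sum: "signed_op S (sum f A) = (\<Sum>a\<in>A. signed_op S (f a))" for A and f :: "nat \<Rightarrow> nat set \<Rightarrow> 'a"
    by (induction A rule: infinite_finite_induct)
      (simp_all only: sum.infinite sum.empty sum.insert signed_op_linear[OF assms] if_False
        not_False_eq_True)
  have tz: "signed_op S (thetazeta N X) = thetazeta N (signed_op S X)" for X
    by (simp add: thetazeta_def sum lm lmul_linear)
  show ?thesis
    by (simp add: odd_op_def commute_thetazeta_funpow[where D = "signed_op S", OF tz]
        anticommute_foldr_eta[where D = "signed_op S", OF eta] thetazeta_funpow_linear)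
qed

definition covariant2 :: "('v::superspace \<Rightarrow> 'v) \<Rightarrow> nat \<Rightarrow> nat \<Rightarrow> bit \<Rightarrow> 'v opdist2 \<Rightarrow> bool" where
  "covariant2 S N i r X \<longleftrightarrow>
    (\<forall>m k L v. ad S r (X m k) L v = total_diff N i (\<lambda>m k L. X m k L v) m k L)"

text \<open>The total derivative and the operator S both cross (Z-W)^(j|J) with the sign (-1)^|J|,
  so an equation between them survives the multiplication and the parity grows by |J|.\<close>

lemma (in expansion) covariant2_zw_mul:
  assumes S: "endo S" and cov: "covariant2 S N i r X"
    and fin: "\<And>v. coeffs_fin e (\<lambda>m k L. X m k L v)" and supp: "\<And>m k v. supp_ge N 0 (\<lambda>L. X m k L v)"
    and i: "i \<in> {1..N}" and J: "J \<subseteq> {1..N}"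
  shows "covariant2 S N i (r + cardp J) (\<lambda>m k L v. zw_mul e N j J (\<lambda>m k L. X m k L v) m k L)"
  unfolding covariant2_def
proof (intro allI)
  fix m k L v
  let ?X = "\<lambda>v m k L. X m k L v" and ?c = "psign (cardp J)"
  note finsupp = supp_ge_finsupp[OF supp]
  have inf: "X m k L v = 0" if "infinite L" for m k L v
    using finsupp[of m k v] that by (simp add: finsupp_def)
  have zw_inf: "zw_mul e N j J (?X v) m k L = 0" if "infinite L" for m k L v
    using that by (simp add: zw_mul_def gact_infinite flip: gact_odd_grass[OF finsupp])
  have finO: "conv_fin e n (\<lambda>m k. odd_op N s J (?X v m k) L)" for n s v L
    using coeffs_fin_odd_op[OF fin finsupp] by (simp add: coeffs_fin_def)
  have td: "total_diff N i (?X v) m k = signed_op S (?X v m k) - (\<lambda>L. psign r *\<^sub>C X m k L (S v))"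
    for m k
  proof
    fix L
    have "total_diff N i (?X v) m k L = ad S r (X m k) L v" using cov by (simp add: covariant2_def)
    then show "total_diff N i (?X v) m k L = (signed_op S (?X v m k) - (\<lambda>L. psign r *\<^sub>C X m k L (S
      v))) L"
      by (simp add: ad_def signed_op_def inf endo_zero[OF S])
  qed
  have "zw_mul e N j J (total_diff N i (?X v)) m k L =
      ?c *\<^sub>C signed_op S (zw_mul e N j J (?X v) m k) L - psign r *\<^sub>C zw_mul e N j J (?X (S v)) m k L"
  proof (cases "finite L")
    case True
    have "odd_op N s J (signed_op S (?X v m k)) L = ?c *\<^sub>C psign (cardp L) *\<^sub>C S (odd_op N s J (?X
      v m k) L)" for s m k
      using True fun_cong[OF signed_op_odd_op[OF S, of N s J "?X v m k"], of L] by (simp add: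
        signed_op_def)
    then have "odd_op N s J (total_diff N i (?X v) m k) L =
       ?c *\<^sub>C psign (cardp L) *\<^sub>C S (odd_op N s J (?X v m k) L) - psign r *\<^sub>C odd_op N s J (?X (S
         v) m k) L" for s m k
      by (simp add: td odd_op_linear)
    then have "conv e n (\<lambda>m k. odd_op N s J (total_diff N i (?X v) m k) L) m k =
      ?c *\<^sub>C psign (cardp L) *\<^sub>C S (conv e n (\<lambda>m k. odd_op N s J (?X v m k) L) m k)
      - psign r *\<^sub>C conv e n (\<lambda>m k. odd_op N s J (?X (S v) m k) L) m k" for n s
      by (simp only:) (simp add: conv_diff conv_fin_scaleC conv_fin_endo[OF finO S] conv_scaleC
        conv_endo[OF finO S] finO)
    then show ?thesis using True
      by (simp add: zw_mul_def signed_op_def endo_sum[OF S] endo_scaleC[OF S] scaleC_sum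
        scaleC_diff sum_subtractf mult_ac)
  next
    case False
    have "finsupp (total_diff N i (?X v) m k)" for m k
      by (auto simp: td finsupp_def signed_op_def inf)
    then have "zw_mul e N j J (total_diff N i (?X v)) m k L = 0"
      using False by (simp add: zw_mul_def gact_infinite flip: gact_odd_grass)
    then show ?thesis using False by (simp add: zw_inf signed_op_def)
  qed
  then have "total_diff N i (zw_mul e N j J (?X v)) m k L =
      signed_op S (zw_mul e N j J (?X v) m k) L - psign (r + cardp J) *\<^sub>C zw_mul e N j J (?X (S
        v)) m k L"
    unfolding total_diff_zw_mul[OF fin supp i J] by (simp add: scaleC_diff psign_add mult_ac)
  then show "ad S (r + cardp J) ((\<lambda>m k L v. zw_mul e N j J (?X v) m k L) m k) L v =
     total_diff N i (\<lambda>m k L. zw_mul e N j J (?X v) m k L) m k L"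
    by (simp add: ad_def signed_op_def zw_inf endo_zero[OF S])
qed

section \<open>Covariance of \<open>(j|J)\<close>-products\<close>

definition hfield :: "nat \<Rightarrow> bit \<Rightarrow> 'v::superspace sfield \<Rightarrow> bool" where
  "hfield N p a \<longleftrightarrow> is_field N a \<and> field_parity p a"

lemma hfield_endo: "hfield N p a \<Longrightarrow> endo (a n I)"
  and hfield_parity: "hfield N p a \<Longrightarrow> op_parity (p + cardp I) (a n I)"
  and hfield_support: "hfield N p a \<Longrightarrow> \<not> I \<subseteq> {1..N} \<Longrightarrow> a n I = (\<lambda>v. 0)"
  by (auto simp: hfield_def is_field_def field_parity_def)

lemma hfield_series: "hfield N p a \<Longrightarrow> is_series (\<lambda>n. a n I)"
  using field_trunc[of N a] unfolding is_series_def by (auto simp: hfield_endo) (simp add: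
    hfield_def, metis)

lemma inj_on_unshift: "(L :: nat set) \<subseteq> {N + 1..2 * N} \<Longrightarrow> inj_on (\<lambda>i. i - N) L"
proof (rule inj_onI)
  fix x y assume "L \<subseteq> {N + 1..2 * N}" "x \<in> L" "y \<in> L" "x - N = y - N"
  moreover then have "N + 1 \<le> x" "N + 1 \<le> y" by auto
  ultimately show "x = y" by linarith
qed

lemma to_zeta_endo: "(\<And>K. endo (B K)) \<Longrightarrow> endo (to_zeta N B L)"
  by (simp add: to_zeta_def)

lemma to_zeta_parity:
  assumes "\<And>K. op_parity (q + cardp K) (B K)"
  shows "op_parity (q + cardp L) (to_zeta N B L)"
  using assms[of "(\<lambda>i. i - N) ` L"] by (auto simp: to_zeta_def card_image inj_on_unshift)

lemma prod_ZW_hmul: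
  "hfield N p a \<Longrightarrow> prod_ZW N a b m k L v = hmul p (a m) (to_zeta N (b k)) v L"
  by (simp add: prod_ZW_def op_gmul_homog hfield_endo hfield_parity)

lemma prod_WZ_hmul:
  "hfield N q b \<Longrightarrow> prod_WZ N b a m k L v = hmul q (to_zeta N (b k)) (a m) v L"
  by (simp add: prod_WZ_def op_gmul_homog hfield_endo hfield_parity to_zeta_endo to_zeta_parity)

lemma hmul_diff_left: "hmul p (\<lambda>L v. A L v - c *\<^sub>C A' L v) B v L = hmul p A B v L - c *\<^sub>C hmul p
  A' B v L"
  by (simp add: hmul_def scaleC_diff sum_subtractf scaleC_sum mult_ac)

lemma hmul_diff_right:
  assumes "\<And>K. endo (A K)"
  shows "hmul p A (\<lambda>L v. B L v - c *\<^sub>C B' L v) v L = hmul p A B v L - c *\<^sub>C hmul p A B' v L"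
  by (simp add: hmul_def scaleC_diff sum_subtractf scaleC_sum mult_ac
    endo_diff[OF assms] endo_scaleC[OF assms])

lemma hmul_zero_left: "hmul p (\<lambda>L v. 0) B v L = 0"
  by (simp add: hmul_def)

lemma hmul_zero_right: "(\<And>K. endo (A K)) \<Longrightarrow> hmul p A (\<lambda>L v. 0) v L = 0"
  by (simp add: hmul_def endo_zero)

lemma sum_bit2:
  "(\<Sum>p\<in>{0, 1}. \<Sum>q\<in>{0, 1}. f p q) = f p q + f p (q + 1) + f (p + 1) q + f (p + 1) (q + 1 :: bit)"
  for f :: "bit \<Rightarrow> bit \<Rightarrow> 'a::comm_monoid_add" and p :: bit
  by (cases p; cases q) (simp_all add: add_ac)

definition field_cov :: "('v::superspace \<Rightarrow> 'v) \<Rightarrow> nat \<Rightarrow> bit \<Rightarrow> 'v sfield \<Rightarrow> bool" where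
  "field_cov S i p a \<longleftrightarrow> (\<forall>n. ad S p (a n) = (\<lambda>I v. ldiff_op i (a n) I v - of_int (n + 1) *\<^sub>C
    lmul_op i (a (n + 1)) I v))"

lemma field_cov_iff:
  assumes "endo S" "op_parity 1 S" "hfield N p a"
  shows "scomm_field S a = Dbar i a \<longleftrightarrow> field_cov S i p a"
proof -
  have "scomm_field S a n I v = ad S p (a n) I v" for n I v
  proof -
    have S: "op_part 1 S = S" "op_part 0 S = (\<lambda>v. 0)"
      using op_part_same[OF assms(1,2)] op_part_other[OF assms(2), of 0] by auto
    have a: "field_part p a = a" "field_part (p + 1) a = (\<lambda>n I v. 0)"
      using field_part_same[of N a p] field_part_other[of p a "p + 1"] assms(3)
      by (auto simp: hfield_def)
    show ?thesis
      unfolding scomm_field_def sum_bit2[where p = 1 and q = p] a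
      using endo_zero[OF assms(1)] by (simp add: S a ad_def endo_zero[OF hfield_endo[OF assms(3)]])
  qed
  moreover have "Dbar i a n I v = ldiff_op i (a n) I v - of_int (n + 1) *\<^sub>C lmul_op i (a (n + 1))
    I v" for n I v
    by (simp add: Dbar_def ldiff_def lmul_def)
  ultimately show ?thesis by (simp only: field_cov_def fun_eq_iff)
qed

lemma gsign_unshift:
  assumes "L \<subseteq> {N + 1..2 * N}" shows "gsign {N + i} L = gsign {i} ((\<lambda>i. i - N) ` L)"
proof -
  have "card {(a, j). a = N + i \<and> j \<in> L \<and> j < a} = card {(a, j). a = i \<and> j \<in> (\<lambda>i. i - N) ` L \<and> j < a}"
  proof -
    have "{(a, j). a = N + i \<and> j \<in> L \<and> j < a} =
       (\<lambda>(a, j). (N + a, N + j)) ` {(a, j). a = i \<and> j \<in> (\<lambda>i. i - N) ` L \<and> j < a}" (is "?A = ?f ` ?B")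
    proof (intro set_eqI iffI)
      fix x assume "x \<in> ?A"
      then obtain j where j: "x = (N + i, j)" "j \<in> L" "j < N + i" by auto
      moreover then have "N + 1 \<le> j" using assms by auto
      ultimately have x: "x = ?f (i, j - N)" and "j - N < i" by auto
      moreover have "j - N \<in> (\<lambda>i. i - N) ` L" using j(2) by (rule imageI)
      ultimately have "(i, j - N) \<in> ?B" unfolding mem_Collect_eq prod.case by blast
      then show "x \<in> ?f ` ?B" unfolding x by (rule imageI)
    next
      fix x assume "x \<in> ?f ` ?B"
      then obtain j where j: "x = (N + i, N + (j - N))" "j \<in> L" "j - N < i" by auto
      then have "N + 1 \<le> j" using assms by auto
      then show "x \<in> ?A" using j by auto
    qed
    moreover have "inj_on ?f ?B" by (auto simp: inj_on_def)
    ultimately show ?thesis by (simp only: card_image)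
  qed
  then show ?thesis by (simp add: gsign_def)
qed

lemma ldiff_to_zeta:
  assumes "i \<in> {1..N}"
  shows "ldiff_op (N + i) (to_zeta N B) L v = to_zeta N (ldiff_op i B) L v"
proof (cases "L \<subseteq> {N + 1..2 * N}")
  case True
  have "N + i \<in> L \<longleftrightarrow> i \<in> (\<lambda>i. i - N) ` L" using True by (force simp: image_iff)
  moreover have "insert (N + i) L \<subseteq> {N + 1..2 * N}" using True assms by auto
  ultimately show ?thesis using True by (simp add: ldiff_def to_zeta_def gsign_unshift)
qed (auto simp: ldiff_def to_zeta_def)

lemma lmul_to_zeta:
  assumes "i \<in> {1..N}"
  shows "lmul_op (N + i) (to_zeta N B) L v = to_zeta N (lmul_op i B) L v"
proof (cases "L \<subseteq> {N + 1..2 * N}")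
  case True
  have "N + i \<in> L \<longleftrightarrow> i \<in> (\<lambda>i. i - N) ` L" using True by (force simp: image_iff)
  moreover have "(\<lambda>i. i - N) ` (L - {N + i}) = (\<lambda>i. i - N) ` L - {i}" using True by (force simp:
    image_iff)
  moreover have "L - {N + i} \<subseteq> {N + 1..2 * N}" using True by auto
  ultimately show ?thesis using True by (simp add: lmul_def to_zeta_def gsign_unshift)
next
  case False
  then have "\<not> L - {N + i} \<subseteq> {N + 1..2 * N}" using assms by auto
  then show ?thesis using False by (simp add: lmul_def to_zeta_def)
qed

lemma ad_to_zeta:
  assumes "endo S" shows "ad S q (to_zeta N B) L v = to_zeta N (ad S q B) L v"
  by (simp add: ad_def to_zeta_def card_image inj_on_unshift endo_zero[OF assms])

lemma ad_to_zeta_cov: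
  assumes "field_cov S i q b" "endo S" "i \<in> {1..N}"
  shows "ad S q (to_zeta N (b k)) = (\<lambda>L v. ldiff_op (N + i) (to_zeta N (b k)) L v
    - of_int (k + 1) *\<^sub>C lmul_op (N + i) (to_zeta N (b (k + 1))) L v)"
proof (intro ext)
  fix L v
  have "ad S q (to_zeta N (b k)) L v = to_zeta N (ad S q (b k)) L v" by (rule ad_to_zeta[OF assms(2)])
  also have "\<dots> = to_zeta N (ldiff_op i (b k)) L v - of_int (k + 1) *\<^sub>C to_zeta N (lmul_op i (b (k
    + 1))) L v"
    using assms(1) by (simp add: field_cov_def to_zeta_def)
  finally show "ad S q (to_zeta N (b k)) L v = ldiff_op (N + i) (to_zeta N (b k)) L v
    - of_int (k + 1) *\<^sub>C lmul_op (N + i) (to_zeta N (b (k + 1))) L v"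
    by (simp only: ldiff_to_zeta[OF assms(3)] lmul_to_zeta[OF assms(3)])
qed

lemma ldiff_to_zeta_0: "i \<in> {1..N} \<Longrightarrow> ldiff_op i (to_zeta N B) = (\<lambda>L v. 0)"
  by (auto simp: ldiff_def to_zeta_def fun_eq_iff)

lemma ldiff_field_0: "hfield N p a \<Longrightarrow> i \<in> {1..N} \<Longrightarrow> ldiff_op (N + i) (a m) = (\<lambda>L v. 0)"
  by (auto simp: ldiff_def fun_eq_iff hfield_support)

text \<open>All operators involved are graded derivations of the product; the mixed terms vanish
  because a \<theta>-derivative kills b(W) and a \<zeta>-derivative kills a(Z).\<close>

lemma covariant2_ZW:
  assumes S: "endo S" and a: "hfield N p a" and b: "hfield N q b"
    and cov: "field_cov S i p a" "field_cov S i q b" and i: "i \<in> {1..N}"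
  shows "covariant2 S N i (p + q) (\<lambda>m k L v. hmul p (a m) (to_zeta N (b k)) v L)"
  unfolding covariant2_def
proof (intro allI)
  fix m k L v
  note ea = hfield_endo[OF a]
  let ?z = "\<lambda>k. to_zeta N (b k)"
  have "ad S (p + q) (\<lambda>L v. hmul p (a m) (?z k) v L) L v =
    hmul (p + 1) (ad S p (a m)) (?z k) v L + psign p *\<^sub>C hmul p (a m) (ad S q (?z k)) v L"
    by (rule ad_hmul[OF S ea])
  also have "ad S p (a m) = (\<lambda>I v. ldiff_op i (a m) I v - of_int (m + 1) *\<^sub>C lmul_op i (a (m + 1)) I v)"
    using cov(1) unfolding field_cov_def by blast
  also note ad_to_zeta_cov[OF cov(2) S i, of k]
  finally show "ad S (p + q) (\<lambda>L v. hmul p (a m) (?z k) v L) L v =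
      total_diff N i (\<lambda>m k L. hmul p (a m) (?z k) v L) m k L"
    unfolding hmul_diff_left hmul_diff_right[OF ea]
    by (simp add: total_diff_def ldiff2_def ldiff_hmul[OF ea] lmul_hmul_left[of i]
      lmul_hmul_right[OF ea, of "N + i"]
      ldiff_to_zeta_0[OF i] ldiff_field_0[OF a i] hmul_zero_left hmul_zero_right[OF ea]
      scaleC_diff mult.commute)
qed

lemma covariant2_WZ:
  assumes S: "endo S" and a: "hfield N p a" and b: "hfield N q b"
    and cov: "field_cov S i p a" "field_cov S i q b" and i: "i \<in> {1..N}"
  shows "covariant2 S N i (p + q) (\<lambda>m k L v. hmul q (to_zeta N (b k)) (a m) v L)"
  unfolding covariant2_def
proof (intro allI)
  fix m k L v
  let ?z = "\<lambda>k. to_zeta N (b k)"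
  have eb: "endo (?z k K)" for k K by (rule to_zeta_endo[OF hfield_endo[OF b]])
  have "ad S (q + p) (\<lambda>L v. hmul q (?z k) (a m) v L) L v =
    hmul (q + 1) (ad S q (?z k)) (a m) v L + psign q *\<^sub>C hmul q (?z k) (ad S p (a m)) v L"
    by (rule ad_hmul[OF S eb])
  also have "ad S p (a m) = (\<lambda>I v. ldiff_op i (a m) I v - of_int (m + 1) *\<^sub>C lmul_op i (a (m + 1)) I v)"
    using cov(1) unfolding field_cov_def by blast
  also note ad_to_zeta_cov[OF cov(2) S i, of k]
  finally show "ad S (p + q) (\<lambda>L v. hmul q (?z k) (a m) v L) L v =
      total_diff N i (\<lambda>m k L. hmul q (?z k) (a m) v L) m k L"
    unfolding hmul_diff_left hmul_diff_right[OF eb] add.commute[of p q]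
    by (simp add: total_diff_def ldiff2_def ldiff_hmul[OF eb] lmul_hmul_left[of "N + i"]
      lmul_hmul_right[OF eb, of i]
      ldiff_to_zeta_0[OF i] ldiff_field_0[OF a i] hmul_zero_left hmul_zero_right[OF eb]
      scaleC_diff mult.commute)
qed

section \<open>The distribution whose residue is the (j|J)-product\<close>

definition jJ_dist :: "nat \<Rightarrow> int \<Rightarrow> nat set \<Rightarrow> bit \<Rightarrow> bit \<Rightarrow> 'v::superspace sfield \<Rightarrow> 'v sfield \<Rightarrow> 'v
  opdist2" where
  "jJ_dist N j J p q a b m k L v =
     zw_mul exp_zw N j J (\<lambda>m k L. hmul p (a m) (to_zeta N (b k)) v L) m k L
     - psign (p * q) *\<^sub>C zw_mul exp_wz N j J (\<lambda>m k L. hmul q (to_zeta N (b k)) (a m) v L) m k L"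

lemma to_zeta_series: "(\<And>K. is_series (\<lambda>n. b n K)) \<Longrightarrow> is_series (\<lambda>n. to_zeta N (b n) K)"
  by (cases "K \<subseteq> {N + 1..2 * N}") (simp_all add: to_zeta_def is_series_zero)

lemma conv_fin_zw_hmul:
  assumes a: "hfield N p a" and b: "hfield N q b"
  shows "coeffs_fin exp_zw (\<lambda>m k L. hmul p (a m) (to_zeta N (b k)) v L)"
  unfolding coeffs_fin_def hmul_def
  by (intro allI conv_fin_sum conv_fin_scaleC conv_fin_zw_series hfield_series[OF a]
    to_zeta_series hfield_series[OF b])

lemma conv_fin_wz_hmul:
  assumes a: "hfield N p a" and b: "hfield N q b"
  shows "coeffs_fin exp_wz (\<lambda>m k L. hmul q (to_zeta N (b k)) (a m) v L)"
  unfolding coeffs_fin_def hmul_def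
  by (intro allI conv_fin_sum conv_fin_scaleC conv_fin_wz_series hfield_series[OF a]
    to_zeta_series hfield_series[OF b])

lemma supp_ge_hmul:
  assumes a: "hfield N p a" and b: "hfield N q b"
  shows "supp_ge N 0 (hmul p (a m) (to_zeta N (b k)) v)"
    and "supp_ge N 0 (hmul q (to_zeta N (b k)) (a m) v)"
proof -
  have *: "a m K (to_zeta N (b k) (L - K) v) = 0" "to_zeta N (b k) K (a m (L - K) v) = 0"
    if "K \<subseteq> L" "\<not> L \<subseteq> {1..2 * N}" for K L
  proof -
    have sub: "{1..N} \<subseteq> {1..2 * N}" "{N + 1..2 * N} \<subseteq> {1..2 * N}" by auto
    have za: "a m K' w = 0" if "\<not> K' \<subseteq> {1..N}" for K' w
      unfolding hfield_support[OF a that] ..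
    have zb: "to_zeta N (b k) K' w = 0" if "\<not> K' \<subseteq> {N + 1..2 * N}" for K' w
      using that by (simp only: to_zeta_def if_False)
    have "\<not> K \<subseteq> {1..N} \<or> \<not> L - K \<subseteq> {N + 1..2 * N}" using that sub by blast
    then show "a m K (to_zeta N (b k) (L - K) v) = 0"
      using za zb endo_zero[OF hfield_endo[OF a]] by (elim disjE) (simp_all only: not_False_eq_True)
    have "\<not> L - K \<subseteq> {1..N} \<or> \<not> K \<subseteq> {N + 1..2 * N}" using that sub by blast
    then show "to_zeta N (b k) K (a m (L - K) v) = 0"
      using za zb endo_zero[OF to_zeta_endo[OF hfield_endo[OF b]]] by (elim disjE) (simp_all only:
        not_False_eq_True)
  qed
  have "hmul p (a m) (to_zeta N (b k)) v L = 0" "hmul q (to_zeta N (b k)) (a m) v L = 0"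
    if "\<not> L \<subseteq> {1..2 * N}" for L
    unfolding hmul_def using that by (auto intro!: sum.neutral simp: *)
  then show "supp_ge N 0 (hmul p (a m) (to_zeta N (b k)) v)"
    and "supp_ge N 0 (hmul q (to_zeta N (b k)) (a m) v)"
    unfolding supp_ge_def by blast+
qed

lemma prod_ZW_zero: "prod_ZW N (\<lambda>n I v. 0) b = (\<lambda>m k L v. 0)"
  "hfield N p a \<Longrightarrow> prod_ZW N a (\<lambda>n I v. 0) = (\<lambda>m k L v. 0)"
  "hfield N p a \<Longrightarrow> prod_WZ N a (\<lambda>n I v. 0) = (\<lambda>m k L v. 0)"
  "prod_WZ N (\<lambda>n I v. 0) b = (\<lambda>m k L v. 0)"
proof -
  have g: "gcross M (\<lambda>v. 0) = (\<lambda>v. 0)" for M by (simp add: gcross_def fun_eq_iff)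
  have z: "to_zeta N (\<lambda>I v. 0) = (\<lambda>L v. 0)" by (simp add: to_zeta_def fun_eq_iff)
  have o: "op_gmul (\<lambda>L v. 0) B = (\<lambda>L v. 0)" for B by (simp add: op_gmul_def g fun_eq_iff)
  show "prod_ZW N (\<lambda>n I v. 0) b = (\<lambda>m k L v. 0)" "prod_WZ N (\<lambda>n I v. 0) b = (\<lambda>m k L v. 0)"
    by (simp_all add: prod_ZW_def prod_WZ_def fun_eq_iff z o)
  show "hfield N p a \<Longrightarrow> prod_ZW N a (\<lambda>n I v. 0) = (\<lambda>m k L v. 0)"
    by (simp add: fun_eq_iff prod_ZW_hmul z hmul_zero_right hfield_endo)
  show "hfield N p a \<Longrightarrow> prod_WZ N a (\<lambda>n I v. 0) = (\<lambda>m k L v. 0)"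
    by (simp add: fun_eq_iff prod_WZ_hmul z hmul_zero_right to_zeta_endo hfield_endo)
qed

lemma dist_mul_zero: "dist_mul c (\<lambda>m k L v. 0) m k L v = 0"
  by (simp add: dist_mul_def case_prod_unfold)

lemma hfield_parts:
  assumes "hfield N p a" shows "field_part p a = a" "field_part (p + 1) a = (\<lambda>n I v. 0)"
  using field_part_same[of N a p] field_part_other[of p a "p + 1"] assms by (auto simp: hfield_def)

text \<open>Of the four parity summands in \<open>jJ_prod\<close> only the one with the actual
  parities survives.\<close>

lemma jJ_prod_homog:
  assumes a: "hfield N p a" and b: "hfield N q b"
  shows "jJ_prod N j J a b = res_Z N (jJ_dist N j J p q a b)"
proof -
  have fin: "finsupp (hmul p (a m) (to_zeta N (b k)) v)" "finsupp (hmul q (to_zeta N (b k)) (a m)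
    v)" for m k v
    using supp_ge_hmul[OF a b] supp_ge_finsupp by blast+
  have "dist_mul (ZW_power exp_zw N j J) (prod_ZW N a b) m k L v =
      zw_mul exp_zw N j J (\<lambda>m k L. hmul p (a m) (to_zeta N (b k)) v L) m k L"
    "dist_mul (ZW_power exp_wz N j J) (prod_WZ N b a) m k L v =
      zw_mul exp_wz N j J (\<lambda>m k L. hmul q (to_zeta N (b k)) (a m) v L) m k L" for m k L v
    using conv_fin_zw_hmul[OF a b, of v] conv_fin_wz_hmul[OF a b, of v] fin
    by (subst dist_mul_ZW_power; simp add: prod_ZW_hmul[OF a] prod_WZ_hmul[OF b])+
  then show ?thesis
    unfolding jJ_prod_def sum_bit2[where p = p and q = q] hfield_parts[OF a] hfield_parts[OF b]
    by (simp add: jJ_dist_def[abs_def] prod_ZW_zero prod_ZW_zero(2)[OF a] prod_ZW_zero(3)[OF b]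
      dist_mul_zero)
qed

lemma covariant2_diff:
  assumes "covariant2 S N i r X" "covariant2 S N i r Y" "endo S"
  shows "covariant2 S N i r (\<lambda>m k L v. X m k L v - c *\<^sub>C Y m k L v)"
proof -
  have "total_diff N i (\<lambda>m k L. X m k L v - c *\<^sub>C Y m k L v) m k L =
    total_diff N i (\<lambda>m k L. X m k L v) m k L - c *\<^sub>C total_diff N i (\<lambda>m k L. Y m k L v) m k L" for
      m k L v
    by (auto simp: total_diff_def ldiff2_def ldiff_def lmul_def scaleC_diff
        scaleC_add mult_ac)
  moreover have "ad S r (\<lambda>L v. X m k L v - c *\<^sub>C Y m k L v) L v = ad S r (X m k) L v - c *\<^sub>C ad S
    r (Y m k) L v" for m k L v
    by (simp add: ad_def endo_diff[OF assms(3)] endo_scaleC[OF assms(3)] scaleC_diff mult_ac)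
  ultimately show ?thesis
    using assms(1,2) unfolding covariant2_def by simp
qed

lemma covariant2_jJ_dist:
  assumes S: "endo S" and a: "hfield N p a" and b: "hfield N q b"
    and cov: "field_cov S i p a" "field_cov S i q b" and i: "i \<in> {1..N}" and J: "J \<subseteq> {1..N}"
  shows "covariant2 S N i (p + q + cardp J) (jJ_dist N j J p q a b)"
  unfolding jJ_dist_def[abs_def]
  by (intro covariant2_diff zw.covariant2_zw_mul wz.covariant2_zw_mul covariant2_ZW covariant2_WZ
    conv_fin_zw_hmul[OF a b] conv_fin_wz_hmul[OF a b] supp_ge_hmul[OF a b] assms)

section \<open>Covariance of the residue\<close>

definition res_index :: "nat \<Rightarrow> nat set \<Rightarrow> nat set" where
  "res_index N K = {1..N} \<union> (\<lambda>i. N + i) ` K"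

lemma card_res_index:
  assumes "K \<subseteq> {1..N}" shows "card (res_index N K) = N + card K"
proof -
  have "finite K" using assms finite_subset by blast
  then have "card (res_index N K) = card {1..N} + card ((\<lambda>i. N + i) ` K)"
    unfolding res_index_def using assms by (intro card_Un_disjoint) auto
  then show ?thesis by (simp add: card_image)
qed

text \<open>The (-1)^N is the sign of a \<zeta> variable or derivative crossing
  \<theta>^1...\<theta>^N; it accounts for the shift of parity by N under the residue.\<close>

lemma gsign_res_index:
  assumes "K \<subseteq> {1..N}" "i \<in> {1..N}"
  shows "gsign {N + i} (res_index N K) = psign (of_nat N) * gsign {i} K"
proof -
  have "{1..N} \<inter> (\<lambda>i. N + i) ` K = {}" using assms(1) by auto
  then have "gsign {N + i} (res_index N K) = gsign {N + i} {1..N} * gsign {N + i} ((\<lambda>i. N + i) ` K)"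
    unfolding res_index_def by (intro gsign_Un_right) auto
  also have "(\<lambda>i. N + i) ` K \<subseteq> {N + 1..2 * N}" using assms(1) by auto
  then have "gsign {N + i} ((\<lambda>i. N + i) ` K) = gsign {i} K"
    by (simp add: gsign_unshift image_image)
  also have "{(a, j). a = N + i \<and> j \<in> {1..N} \<and> j < a} = Pair (N + i) ` {1..N}"
    using assms(2) by auto
  then have "gsign {N + i} {1..N} = psign (of_nat N)"
    by (simp add: gsign_def psign_of_nat card_image inj_on_def)
  finally show ?thesis .
qed

text \<open>The residue of the derivative in Z is 0: a z-derivative has no z^(-1) coefficient, and a
  derivative in \<theta>^i has no monomial containing \<theta>^i. What remains is the derivative in
  W, which leaves the residue with the sign (-1)^N.\<close>

lemma field_cov_jJ_prod:
  assumes S: "endo S" and a: "hfield N p a" and b: "hfield N q b"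
    and cov: "field_cov S i p a" "field_cov S i q b" and i: "i \<in> {1..N}" and J: "J \<subseteq> {1..N}"
  shows "field_cov S i (p + q + cardp J + of_nat N) (jJ_prod N j J a b)"
  unfolding field_cov_def
proof (intro allI ext)
  fix k K v
  let ?Y = "jJ_dist N j J p q a b" and ?r = "p + q + cardp J"
  let ?R = "jJ_prod N j J a b"
  have R: "?R k K v = (if K \<subseteq> {1..N} then ?Y (- 1) k (res_index N K) v else 0)" for k K v
    by (simp add: jJ_prod_homog[OF a b] res_Z_def res_index_def)
  show "ad S (?r + of_nat N) (?R k) K v = ldiff_op i (?R k) K v - of_int (k + 1) *\<^sub>C lmul_op i (?R
    (k + 1)) K v"
  proof (cases "K \<subseteq> {1..N}")
    case True
    let ?L = "res_index N K"
    have iL: "i \<in> ?L" "N + i \<in> ?L \<longleftrightarrow> i \<in> K" using i by (auto simp: res_index_def)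
    have ins: "insert (N + i) ?L = res_index N (insert i K)" by (auto simp: res_index_def)
    have rem: "?L - {N + i} = res_index N (K - {i})" using i by (auto simp: res_index_def)
    have sub: "insert i K \<subseteq> {1..N}" "K - {i} \<subseteq> {1..N}" using True i by auto
    have "ad S ?r (?Y (- 1) k) ?L v = total_diff N i (\<lambda>m k L. ?Y m k L v) (- 1) k ?L"
      using covariant2_jJ_dist[OF assms] unfolding covariant2_def by blast
    also have "\<dots> = psign (of_nat N) *\<^sub>C (ldiff_op i (?R k) K v - of_int (k + 1) *\<^sub>C lmul_op i (?R
      (k + 1)) K v)"
      using True i sub iL
      by (auto simp: total_diff_def ldiff2_def ldiff_def lmul_def R ins rem gsign_res_index[OF
        sub(2) i]
        gsign_res_index[OF True i] mult_ac)
    finally have *: "psign (of_nat N) *\<^sub>C ad S ?r (?Y (- 1) k) ?L v =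
        ldiff_op i (?R k) K v - of_int (k + 1) *\<^sub>C lmul_op i (?R (k + 1)) K v" by simp
    have "psign (of_nat N) *\<^sub>C ad S ?r (?Y (- 1) k) ?L v = ad S (?r + of_nat N) (?R k) K v"
      using True by (simp add: ad_def R card_res_index psign_add scaleC_diff mult_ac)
    then show ?thesis using * by simp
  next
    case False
    then have "\<not> insert i K \<subseteq> {1..N}" "\<not> K - {i} \<subseteq> {1..N}" using i by auto
    then show ?thesis using False by (simp add: ad_def R ldiff_def lmul_def endo_zero[OF S])
  qed
qed

section \<open>Components of \<open>(j|J)\<close>-products\<close>

definition theta_part :: "nat \<Rightarrow> nat set \<Rightarrow> nat set" where
  "theta_part N M = M \<inter> {1..N}"

definition zeta_part :: "nat \<Rightarrow> nat set \<Rightarrow> nat set" where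
  "zeta_part N M = (\<lambda>i. i - N) ` (M - {1..N})"

lemma split_index:
  assumes "M \<subseteq> {1..2 * N}"
  shows "M - {1..N} \<subseteq> {N + 1..2 * N}" "M - (M - {1..N}) = theta_part N M" "M - theta_part N M = M
    - {1..N}"
    "card (M - {1..N}) = card (zeta_part N M)" "card (theta_part N M) + card (zeta_part N M) = card M"
    "finite M"
proof -
  show sub: "M - {1..N} \<subseteq> {N + 1..2 * N}"
  proof
    fix x assume "x \<in> M - {1..N}"
    moreover then have "x \<in> {1..2 * N}" using assms by blast
    ultimately show "x \<in> {N + 1..2 * N}" by auto
  qed
  show "M - (M - {1..N}) = theta_part N M" "M - theta_part N M = M - {1..N}"
    by (auto simp: theta_part_def)
  show card: "card (M - {1..N}) = card (zeta_part N M)"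
    unfolding zeta_part_def by (rule card_image[OF inj_on_unshift[OF sub], symmetric])
  show "finite M" using assms finite_subset by blast
  then show "card (theta_part N M) + card (zeta_part N M) = card M"
    unfolding card[symmetric] theta_part_def
    by (subst card_Un_disjoint[symmetric]) (auto simp: Int_Diff_Un)
qed

text \<open>Only one term of the sum survives, since a(Z) involves no \<zeta> and b(W) no \<theta>;
  the \<theta> variables precede the \<zeta> variables, so no reordering sign arises.\<close>

lemma hmul_ZW_component:
  assumes a: "hfield N p a" and M: "M \<subseteq> {1..2 * N}"
  shows "hmul p (a m) (to_zeta N (b k)) v M =
    psign ((p + cardp (theta_part N M)) * cardp (zeta_part N M)) *\<^sub>C
      a m (theta_part N M) (b k (zeta_part N M) v)"
proof -
  let ?f = "\<lambda>K. (gsign K (M - K) * psign ((p + cardp K) * cardp (M - K))) *\<^sub>C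
     a m K (to_zeta N (b k) (M - K) v)"
  note idx = split_index[OF M]
  have "?f K = 0" if "K \<in> Pow M - {theta_part N M}" for K
  proof (cases "K \<subseteq> {1..N}")
    case True
    have "\<not> M - K \<subseteq> {N + 1..2 * N}"
    proof
      assume *: "M - K \<subseteq> {N + 1..2 * N}"
      have "{1..N} \<inter> {N + 1..2 * N} = {}" by auto
      with * have "M \<inter> {1..N} \<subseteq> K" by blast
      with that True show False by (auto simp: theta_part_def)
    qed
    then have "to_zeta N (b k) (M - K) v = 0" by (simp only: to_zeta_def if_False)
    then show ?thesis by (simp add: endo_zero[OF hfield_endo[OF a]])
  qed (simp add: hfield_support[OF a])
  then have "hmul p (a m) (to_zeta N (b k)) v M = (\<Sum>K\<in>{theta_part N M}. ?f K)"
    unfolding hmul_def using idx(6) by (intro sum.mono_neutral_right) (auto simp: theta_part_def)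
  moreover have "gsign (theta_part N M) (M - {1..N}) = 1"
    by (rule gsign_less) (use idx(1) in \<open>fastforce simp: theta_part_def\<close>)
  moreover have "to_zeta N (b k) (M - {1..N}) v = b k (zeta_part N M) v"
    unfolding to_zeta_def zeta_part_def using idx(1) by (simp only: if_True)
  ultimately show ?thesis by (simp add: idx(3,4) del: One_nat_def)
qed

lemma hmul_WZ_component:
  assumes b: "hfield N q b" and a: "hfield N p a" and M: "M \<subseteq> {1..2 * N}"
  shows "hmul q (to_zeta N (b k)) (a m) v M =
    psign (q * cardp (theta_part N M)) *\<^sub>C b k (zeta_part N M) (a m (theta_part N M) v)"
proof -
  let ?f = "\<lambda>K. (gsign K (M - K) * psign ((q + cardp K) * cardp (M - K))) *\<^sub>C
     to_zeta N (b k) K (a m (M - K) v)"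
  note idx = split_index[OF M]
  have "?f K = 0" if "K \<in> Pow M - {M - {1..N}}" for K
  proof (cases "K \<subseteq> {N + 1..2 * N}")
    case True
    have "\<not> M - K \<subseteq> {1..N}"
    proof
      assume *: "M - K \<subseteq> {1..N}"
      have "{1..N} \<inter> {N + 1..2 * N} = {}" by auto
      with * True have "K = M - {1..N}" using that by blast
      with that show False by blast
    qed
    then have "a m (M - K) v = 0" by (simp add: hfield_support[OF a])
    then show ?thesis by (simp add: endo_zero[OF to_zeta_endo[OF hfield_endo[OF b]]])
  next
    case False
    then have "to_zeta N (b k) K (a m (M - K) v) = 0" by (simp only: to_zeta_def if_False)
    then show ?thesis by simp
  qed
  then have "hmul q (to_zeta N (b k)) (a m) v M = (\<Sum>K\<in>{M - {1..N}}. ?f K)"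
    unfolding hmul_def using idx(6) by (intro sum.mono_neutral_right) auto
  moreover have "gsign (theta_part N M) (M - {1..N}) = 1"
    by (rule gsign_less) (use idx(1) in \<open>fastforce simp: theta_part_def\<close>)
  \<comment> \<open>Bringing the \<zeta> variables behind the \<theta> variables gives a sign that
    cancels part of the crossing sign and leaves only q times the number of \<theta>
    variables.\<close>
  then have "gsign (M - {1..N}) (theta_part N M) = psign (cardp (theta_part N M) * cardp
    (zeta_part N M))"
    using gsign_swap[of "theta_part N M" "M - {1..N}"] idx(4,6) by (auto simp: theta_part_def)
  moreover have "to_zeta N (b k) (M - {1..N}) = b k (zeta_part N M)"
    unfolding to_zeta_def zeta_part_def using idx(1) by (simp only: if_True)
  ultimately show ?thesis by (simp add: idx(2,4) distrib_left distrib_right psign_add mult_ac del: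
    One_nat_def)
qed

text \<open>The sign of exchanging the two components selected by M, by their own parities;
  \<open>cross_sign\<close> below is the factor common to both orders of the product.\<close>

definition comp_sign :: "nat \<Rightarrow> bit \<Rightarrow> bit \<Rightarrow> nat set \<Rightarrow> complex" where
  "comp_sign N p q M = psign ((p + cardp (theta_part N M)) * (q + cardp (zeta_part N M)))"

definition cross_sign :: "nat \<Rightarrow> bit \<Rightarrow> nat set \<Rightarrow> complex" where
  "cross_sign N p M = psign ((p + cardp (theta_part N M)) * cardp (zeta_part N M))"

lemma comp_sign_cross_sign:
  "psign (p * q) * psign (q * cardp (theta_part N M)) = cross_sign N p M * comp_sign N p q M"
  by (simp add: comp_sign_def cross_sign_def distrib_left distrib_right psign_add mult_ac)

text \<open>T collects the variables supplied by the odd factor of (Z-W)^(j|J); the remaining ones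
  in L are supplied by a and b.\<close>

abbreviation jJ_term :: "nat \<Rightarrow> int \<Rightarrow> nat set \<Rightarrow> bit \<Rightarrow> bit \<Rightarrow> 'v::superspace sfield \<Rightarrow> 'v sfield \<Rightarrow>
    nat set \<Rightarrow> nat \<Rightarrow> nat set \<Rightarrow> int \<Rightarrow> 'v \<Rightarrow> 'v" where
  "jJ_term N j J p q a b L s T k v \<equiv>
     (zw_coeff j s * (gsign T (L - T) * odd_grass N s J T) * cross_sign N p (L - T)) *\<^sub>C
     nth_product (comp_sign N p q (L - T)) (j - int s)
       (\<lambda>n. a n (theta_part N (L - T))) (\<lambda>n. b n (zeta_part N (L - T))) k v"

lemma jJ_dist_component:
  assumes a: "hfield N p a" and b: "hfield N q b" and L: "L \<subseteq> {1..2 * N}"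
  shows "jJ_dist N j J p q a b (- 1) k L v =
    (\<Sum>s\<le>N. \<Sum>T\<in>Pow L. jJ_term N j J p q a b L s T k v)"
proof -
  let ?X = "\<lambda>m k L. hmul p (a m) (to_zeta N (b k)) v L" and ?Y = "\<lambda>m k L. hmul q (to_zeta N (b k))
    (a m) v L"
  let ?c = "\<lambda>s T. zw_coeff j s * (gsign T (L - T) * odd_grass N s J T)"
  have fin: "finite L" using L finite_subset by blast
  have zw: "zw_mul e N j J \<Phi> m k L = (\<Sum>s\<le>N. \<Sum>T\<in>Pow L. ?c s T *\<^sub>C conv e (j - int s) (\<lambda>m k. \<Phi> m k
    (L - T)) m k)"
    if "coeffs_fin e \<Phi>" "\<And>m k. finsupp (\<Phi> m k)" for e m k and \<Phi> :: "'a gdist2"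
  proof -
    have "conv e n (\<lambda>m k. odd_op N s J (\<Phi> m k) L) m k =
      (\<Sum>T\<in>Pow L. (gsign T (L - T) * odd_grass N s J T) *\<^sub>C conv e n (\<lambda>m k. \<Phi> m k (L - T)) m k)" for n s
      unfolding gact_odd_grass[OF that(2), symmetric] gact_def using fin that(1)
      by (simp add: conv_sum conv_fin_scaleC coeffs_fin_def conv_scaleC)
    then show ?thesis by (simp add: zw_mul_def scaleC_sum)
  qed
  have main: "conv exp_zw n (\<lambda>m k. ?X m k M) (- 1) k - psign (p * q) *\<^sub>C conv exp_wz n (\<lambda>m k. ?Y m
    k M) (- 1) k =
     cross_sign N p M *\<^sub>C nth_product (comp_sign N p q M) n (\<lambda>n. a n (theta_part N M)) (\<lambda>n. b n
       (zeta_part N M)) k v"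
    if "M \<subseteq> {1..2 * N}" for M n
    by (simp add: hmul_ZW_component[OF a that] hmul_WZ_component[OF b a that] conv_scaleC
      comp_sign_cross_sign
      nth_product_def scaleC_diff) (simp add: cross_sign_def)
  have "?c s T *\<^sub>C conv exp_zw n (\<lambda>m k. ?X m k (L - T)) (- 1) k -
      psign (p * q) *\<^sub>C ?c s T *\<^sub>C conv exp_wz n (\<lambda>m k. ?Y m k (L - T)) (- 1) k =
    (?c s T * cross_sign N p (L - T)) *\<^sub>C nth_product (comp_sign N p q (L - T)) n (\<lambda>n. a n
      (theta_part N (L - T))) (\<lambda>n. b n (zeta_part N (L - T))) k v"
    for n s T
  proof -
    have sub: "L - T \<subseteq> {1..2 * N}" using L by blast
    have "c *\<^sub>C u - d *\<^sub>C c *\<^sub>C w = c *\<^sub>C (u - d *\<^sub>C w)" for c d and u w :: 'a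
      by (simp add: scaleC_diff mult.commute)
    then show ?thesis by (simp only: main[OF sub] superspace.scale_scale)
  qed
  then show ?thesis
    unfolding jJ_dist_def
    by (subst zw[OF conv_fin_zw_hmul[OF a b] supp_ge_finsupp[OF supp_ge_hmul(1)[OF a b]]],
        subst zw[OF conv_fin_wz_hmul[OF a b] supp_ge_finsupp[OF supp_ge_hmul(2)[OF a b]]])
      (simp only: scaleC_sum sum_subtractf[symmetric])
qed

lemma res_index_subset: "K \<subseteq> {1..N} \<Longrightarrow> res_index N K \<subseteq> {1..2 * N}"
  by (auto simp: res_index_def)

text \<open>The reduction to ordinary products: truncation, parity, locality and the action on the
  vacuum are all read off from this finite sum.\<close>

lemma jJ_prod_component:
  assumes a: "hfield N p a" and b: "hfield N q b"
  shows "(\<lambda>k. jJ_prod N j J a b k K) = (if K \<subseteq> {1..N} then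
    \<lambda>k v. \<Sum>s\<le>N. \<Sum>T\<in>Pow (res_index N K).
     jJ_term N j J p q a b (res_index N K) s T k v
    else (\<lambda>k v. 0))"
proof -
  have "jJ_prod N j J a b k K v = (if K \<subseteq> {1..N} then jJ_dist N j J p q a b (- 1) k (res_index N
    K) v else 0)" for k v
    by (simp add: jJ_prod_homog[OF a b] res_Z_def res_index_def)
  then show ?thesis by (simp add: fun_eq_iff jJ_dist_component[OF a b res_index_subset])
qed

text \<open>A truncation bound uniform in I exists because only the finitely many subsets of {1..N}
  matter.\<close>

lemma is_field_components:
  assumes "\<And>I. is_series (\<lambda>n. a n I)" "\<And>n I. \<not> I \<subseteq> {1..N} \<Longrightarrow> a n I = (\<lambda>v. 0)"
  shows "is_field N a"
  unfolding is_field_def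
proof (intro conjI allI impI)
  show "endo (a n I)" for n I using assms(1) is_series_endo by blast
  show "a n I = (\<lambda>v. 0)" if "\<not> I \<subseteq> {1..N}" for n I using assms(2) that by blast
  fix v
  have "\<forall>I. \<exists>n0. \<forall>n<n0. a n I v = 0" using assms(1) is_series_trunc by blast
  then obtain f where f: "\<And>I n. n < f I \<Longrightarrow> a n I v = 0" by metis
  define n0 where "n0 = Min (f ` Pow {1..N})"
  have "a n I v = 0" if "n < n0" for n I
  proof (cases "I \<subseteq> {1..N}")
    case True
    then have "n0 \<le> f I" unfolding n0_def by (intro Min_le) auto
    then show ?thesis using f that by simp
  qed (simp add: assms(2))
  then show "\<exists>n0. \<forall>n<n0. \<forall>I. a n I v = 0" by blast
qed

lemma is_field_jJ_prod:
  assumes a: "hfield N p a" and b: "hfield N q b"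
  shows "is_field N (jJ_prod N j J a b)"
proof (rule is_field_components)
  show "is_series (\<lambda>n. jJ_prod N j J a b n I)" for I
    unfolding jJ_prod_component[OF a b]
    by (auto intro!: is_series_sum is_series_scaleC is_series_nth_product is_series_zero
      hfield_series[OF a] hfield_series[OF b])
  show "jJ_prod N j J a b n I = (\<lambda>v. 0)" if "\<not> I \<subseteq> {1..N}" for n I
    using that by (simp add: jJ_prod_def res_Z_def fun_eq_iff)
qed

section \<open>Parity of (j|J)-products\<close>

definition grass_parity :: "bit \<Rightarrow> grass \<Rightarrow> bool" where
  "grass_parity r g \<longleftrightarrow> (\<forall>L. g L \<noteq> 0 \<longrightarrow> finite L \<and> cardp L = r)"

lemma grass_parity_gmul:
  assumes "grass_parity r f" "grass_parity t g" shows "grass_parity (r + t) (gmul f g)"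
  unfolding grass_parity_def
proof (intro allI impI)
  fix L assume "gmul f g L \<noteq> 0"
  then have "\<exists>K\<in>Pow L. gsign K (L - K) * f K * g (L - K) \<noteq> 0"
    unfolding gmul_def by (rule contrapos_np) (simp add: sum.neutral)
  then obtain K where K: "K \<subseteq> L" "f K \<noteq> 0" "g (L - K) \<noteq> 0" by auto
  then have fin: "finite K" "finite (L - K)" and par: "cardp K = r" "cardp (L - K) = t"
    using assms unfolding grass_parity_def by blast+
  have L: "L = K \<union> (L - K)" using K(1) by blast
  have "card (K \<union> (L - K)) = card K + card (L - K)" using fin by (intro card_Un_disjoint) auto
  then show "finite L \<and> cardp L = r + t"
    using L fin par by (metis finite_UnI of_nat_add)
qed

lemma grass_parity_odd_grass:
  "grass_parity (cardp J) (odd_grass N s J)"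
proof -
  have one: "grass_parity 0 gone" by (simp add: grass_parity_def gone_def)
  have var: "grass_parity 1 (gvar i)" for i by (simp add: grass_parity_def gvar_def)
  have "grass_parity 0 (theta_zeta N)"
  proof -
    have "grass_parity 0 (gmul (gvar i) (gvar (N + i)))" for i
      using grass_parity_gmul[OF var var] by simp
    moreover have "\<exists>i. gmul (gvar i) (gvar (N + i)) L \<noteq> 0" if "theta_zeta N L \<noteq> 0" for L
      using that unfolding theta_zeta_def by (metis (mono_tags, lifting) sum.neutral)
    ultimately show ?thesis unfolding grass_parity_def by blast
  qed
  then have "grass_parity 0 ((gmul (theta_zeta N) ^^ s) gone)"
    using grass_parity_gmul[of 0 "theta_zeta N" 0] by (induction s) (simp_all add: one)
  moreover have "grass_parity 1 (theta_minus_zeta N i)" for i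
    unfolding grass_parity_def
  proof (intro allI impI)
    fix L assume "theta_minus_zeta N i L \<noteq> 0"
    then have "L = {i} \<or> L = {N + i}" by (auto simp: theta_minus_zeta_def gvar_def split: if_splits)
    then show "finite L \<and> cardp L = (1::bit)" by auto
  qed
  then have "grass_parity (of_nat (length xs)) (foldr (\<lambda>i. gmul (theta_minus_zeta N i)) xs gone)" for xs
    by (induction xs) (auto simp: one grass_parity_gmul)
  then have "grass_parity (cardp J) (odd_factor N J)"
    unfolding odd_factor_def by (metis length_sorted_list_of_set)
  ultimately show ?thesis
    unfolding odd_grass_def using grass_parity_gmul[of 0 _ "cardp J"] by fastforce
qed

text \<open>Degree count modulo 2: T has as many elements as J, the residue index has N + |K|, and
  the rest of it is divided between the two components. It gives both the parity of the product and
  the sign needed in Dong's lemma.\<close>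

lemma odd_grass_card:
  assumes "odd_grass N s J T \<noteq> 0" "K \<subseteq> {1..N}" "T \<subseteq> res_index N K"
  shows "p + q + cardp J + of_nat N + cardp K =
    (p + cardp (theta_part N (res_index N K - T))) + (q + cardp (zeta_part N (res_index N K - T)))"
proof -
  let ?L = "res_index N K"
  have L: "?L \<subseteq> {1..2 * N}" "?L - T \<subseteq> {1..2 * N}" using res_index_subset[OF assms(2)] by auto
  have "finite T" "cardp T = (cardp J :: bit)"
    using grass_parity_odd_grass[of J N s] assms(1) unfolding grass_parity_def by blast+
  moreover have "card T + card (?L - T) = N + card K"
    using card_res_index[OF assms(2)] assms(3) split_index(6)[OF L(1)]
    by (metis card_Diff_subset card_mono finite_subset le_add_diff_inverse)
  ultimately have "cardp J + cardp (?L - T) = (of_nat N + cardp K :: bit)"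
    by (metis of_nat_add)
  moreover have "cardp (?L - T) = cardp (theta_part N (?L - T)) + cardp (zeta_part N (?L - T))"
    using split_index(5)[OF L(2)] by (metis of_nat_add)
  ultimately have "of_nat N + cardp K + cardp J = cardp (theta_part N (?L - T)) + cardp (zeta_part
    N (?L - T))"
    by (metis add.commute bit_double(2))
  then have "p + q + (of_nat N + cardp K + cardp J) =
      p + q + (cardp (theta_part N (?L - T)) + cardp (zeta_part N (?L - T)))" by simp
  then show ?thesis by (simp add: add_ac)
qed

lemma graded_Sum_any: "(\<And>x. g x \<in> graded p) \<Longrightarrow> Sum_any g \<in> graded p"
  by (simp add: Sum_any.expand_set graded_sum_set)

lemma op_parity_nth_product:
  fixes A B :: "'a::superspace series"
  assumes "\<And>n. op_parity p (A n)" "\<And>n. op_parity q (B n)"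
  shows "op_parity (p + q) (nth_product \<epsilon> n A B k)"
  unfolding op_parity_def
proof (intro allI ballI)
  fix r and v :: 'a assume v: "v \<in> graded r"
  have "A m (B k v) \<in> graded (p + q + r)" "B k (A m v) \<in> graded (p + q + r)" for m k
    using op_parityD[OF assms(1) op_parityD[OF assms(2) v]] op_parityD[OF assms(2) op_parityD[OF
      assms(1) v]]
    by (simp_all add: add_ac)
  then show "nth_product \<epsilon> n A B k v \<in> graded (p + q + r)"
    unfolding nth_product_def conv_def
    by (intro graded_diff graded_scaleC graded_Sum_any) (auto simp: graded_scaleC)
qed

lemma hfield_jJ_prod:
  fixes a b :: "'a::superspace sfield"
  assumes a: "hfield N p a" and b: "hfield N q b"
  shows "hfield N (p + q + cardp J + of_nat N) (jJ_prod N j J a b)"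
  unfolding hfield_def field_parity_def
proof (intro conjI allI is_field_jJ_prod[OF a b])
  fix k K
  show "op_parity (p + q + cardp J + of_nat N + cardp K) (jJ_prod N j J a b k K)"
  proof (cases "K \<subseteq> {1..N}")
    case True
    let ?L = "res_index N K"
    show ?thesis
      unfolding fun_cong[OF jJ_prod_component[OF a b, where j = j and J = J and K = K], of k]
        op_parity_def if_P[OF True]
    proof (intro allI ballI graded_sum_set)
      fix r s T and v :: 'a assume v: "v \<in> graded r" and T: "T \<in> Pow ?L"
      let ?t = "jJ_term N j J p q a b ?L s T k v"
      show "?t \<in> graded (p + q + cardp J + of_nat N + cardp K + r)"
      proof (cases "odd_grass N s J T = 0")
        case False
        show ?thesis
          unfolding odd_grass_card[OF False True PowD[OF T], of p q]
          by (intro graded_scaleC op_parityD[OF op_parity_nth_product v] hfield_parity[OF a]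
            hfield_parity[OF b])
      qed (simp add: graded_zero)
    qed
  qed (simp add: jJ_prod_def res_Z_def op_parity_def graded_zero)
qed

text \<open>The exponents may depend on I and K; only when returning to \<open>local_pair\<close> is
  a common one needed.\<close>

definition comp_local :: "bit \<Rightarrow> bit \<Rightarrow> 'v::superspace sfield \<Rightarrow> 'v sfield \<Rightarrow> bool" where
  "comp_local p q a b \<longleftrightarrow> (\<forall>I K. mutually_local (psign ((p + cardp I) * (q + cardp K)))
     (\<lambda>n. a n I) (\<lambda>n. b n K))"

lemma comp_local_sym: "comp_local p q a b \<Longrightarrow> comp_local q p b a"
  unfolding comp_local_def by (metis mult.commute mutually_local_sym psign_square)

text \<open>Dong's lemma is applied to each term. It yields a product of two signs, which is the
  required one because by \<open>odd_grass_card\<close> the parities of the two components add up to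
  that of the product.\<close>

lemma comp_local_jJ_prod:
  assumes a: "hfield N p a" and b: "hfield N q b" and c: "hfield N r c"
    and loc: "comp_local p q a b" "comp_local p r a c" "comp_local q r b c"
  shows "comp_local (p + q + cardp J + of_nat N) r (jJ_prod N j J a b) c"
  unfolding comp_local_def
proof (intro allI)
  fix K K' :: "nat set"
  let ?g = "r + cardp K'"
  show "mutually_local (psign ((p + q + cardp J + of_nat N + cardp K) * ?g))
     (\<lambda>n. jJ_prod N j J a b n K) (\<lambda>n. c n K')"
  proof (cases "K \<subseteq> {1..N}")
    case True
    let ?L = "res_index N K"
    show ?thesis
      unfolding jJ_prod_component[OF a b] if_P[OF True]
    proof (intro mutually_local_sum hfield_series[OF c])
      fix s T assume T: "T \<in> Pow ?L"
      let ?A = "\<lambda>n. a n (theta_part N (?L - T))" and ?B = "\<lambda>n. b n (zeta_part N (?L - T))"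
      let ?c = "zw_coeff j s * (gsign T (?L - T) * odd_grass N s J T) * cross_sign N p (?L - T)"
      show "mutually_local (psign ((p + q + cardp J + of_nat N + cardp K) * ?g))
        (\<lambda>k v. ?c *\<^sub>C nth_product (comp_sign N p q (?L - T)) (j - int s) ?A ?B k v) (\<lambda>n. c n K')"
      proof (cases "odd_grass N s J T = 0")
        case False
        have sign: "psign ((x + y) * ?g) = psign (x * ?g) * psign (y * ?g)" for x y
          by (simp add: distrib_right psign_add)
        show ?thesis
          unfolding odd_grass_card[OF False True PowD[OF T], of p q] comp_sign_def
            sign[of "p + cardp (theta_part N (?L - T))" "q + cardp (zeta_part N (?L - T))"]
          using loc unfolding comp_local_def
          by (intro mutually_local_scaleC mutually_local_nth_product hfield_series[OF a]
            hfield_series[OF b] hfield_series[OF c]) blast+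
      qed (simp add: mutually_local_zero[OF hfield_series[OF c]])
    qed
  next
    case False
    then show ?thesis by (simp add: jJ_prod_component[OF a b] mutually_local_zero[OF
      hfield_series[OF c]])
  qed
qed

text \<open>On the vacuum A(z) has no negative powers of z, and neither has (z-w)^n for |w| > |z|,
  so the term B A has no residue. In the term A B, putting w = 0 leaves only z^n.\<close>

lemma nth_product_vacuum:
  assumes "\<And>m. m < 0 \<Longrightarrow> A m vac = 0" "\<And>m. m < 0 \<Longrightarrow> B m vac = 0" "is_series A" "is_series B"
  shows "k < 0 \<Longrightarrow> nth_product \<epsilon> n A B k vac = 0" "nth_product \<epsilon> n A B 0 vac = A (- 1 - n) (B 0 vac)"
proof -
  note zero = endo_zero[OF is_series_endo[OF assms(3)]] endo_zero[OF is_series_endo[OF assms(4)]]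
  have wz: "conv exp_wz n (\<lambda>m k. B k (A m vac)) (- 1) k = 0" for k
  proof -
    have "exp_wz n m' k' *\<^sub>C B (k - k') (A (- 1 - m') vac) = 0" for m' k'
      by (cases "m' < 0") (simp_all add: exp_wz_def assms(1) zero)
    then show ?thesis unfolding conv_def case_prod_unfold by (simp only: Sum_any.neutral)
  qed
  show "nth_product \<epsilon> n A B k vac = 0" if "k < 0"
  proof -
    have "exp_zw n m' k' *\<^sub>C A (- 1 - m') (B (k - k') vac) = 0" for m' k'
      using that by (cases "k' < 0") (simp_all add: exp_zw_def assms(2) zero)
    then have "conv exp_zw n (\<lambda>m k. A m (B k vac)) (- 1) k = 0"
      unfolding conv_def case_prod_unfold by (simp only: Sum_any.neutral)
    then show ?thesis by (simp add: nth_product_def wz)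
  qed
  have "(case x of (m', k') \<Rightarrow> exp_zw n m' k' *\<^sub>C A (- 1 - m') (B (0 - k') vac)) =
     (if x = (n, 0 :: int) then A (- 1 - n) (B 0 vac) else 0)" for x
  proof -
    obtain m' k' where x: "x = (m', k')" by force
    consider "k' < 0" | "k' = 0" | "k' > 0" by linarith
    then show ?thesis by cases (auto simp: x exp_zw_def assms(2) zero)
  qed
  then have "conv exp_zw n (\<lambda>m k. A m (B k vac)) (- 1) 0 = Sum_any (\<lambda>x. if x = (n, 0 :: int) then
    A (- 1 - n) (B 0 vac) else 0)"
    unfolding conv_def by (rule Sum_any.cong)
  then have "conv exp_zw n (\<lambda>m k. A m (B k vac)) (- 1) 0 = A (- 1 - n) (B 0 vac)" by simp
  then show "nth_product \<epsilon> n A B 0 vac = A (- 1 - n) (B 0 vac)" by (simp add: nth_product_def wz)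
qed

text \<open>Monomials in \<theta> alone see the product of the \<theta>^i - \<zeta>^i at \<zeta> =
  0, where it is \<theta>^J.\<close>

lemma odd_factor_theta:
  assumes "J \<subseteq> {1..N}" "T \<subseteq> {1..N}"
  shows "odd_factor N J T = (if T = J then 1 else 0)"
proof -
  have "foldr (\<lambda>i. gmul (theta_minus_zeta N i)) xs gone T = (if T = set xs then 1 else 0)"
    if "sorted_wrt (<) xs" "set xs \<subseteq> {1..N}" "T \<subseteq> {1..N}" for xs T
    using that
  proof (induction xs arbitrary: T)
    case Nil
    then show ?case by (simp add: gone_def)
  next
    case (Cons i xs)
    let ?h = "foldr (\<lambda>i. gmul (theta_minus_zeta N i)) xs gone"
    have fin: "finite T" using Cons.prems(3) finite_subset by blast
    have IH: "?h (T - {i}) = (if T - {i} = set xs then 1 else 0)"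
      using Cons.prems by (intro Cons.IH) auto
    have "theta_minus_zeta N i K = (if K = {i} then 1 else 0)" if "K \<subseteq> T" for K
    proof -
      have "N + i \<notin> {1..N}" using Cons.prems(2) by auto
      then have "K \<noteq> {N + i}" using that Cons.prems(3) by blast
      then show ?thesis by (simp add: theta_minus_zeta_def gvar_def)
    qed
    then have "gmul (theta_minus_zeta N i) ?h T = (\<Sum>K\<in>Pow T. if K = {i} then gsign {i} (T - {i}) *
      ?h (T - {i}) else 0)"
      unfolding gmul_def by (intro sum.cong) auto
    also have "\<dots> = (if i \<in> T then gsign {i} (T - {i}) * ?h (T - {i}) else 0)"
      using fin by simp
    also have "\<dots> = (if T = set (i # xs) then 1 else 0)"
    proof (cases "i \<in> T \<and> T - {i} = set xs")
      case True
      then have "gsign {i} (T - {i}) = 1" using Cons.prems(1) by (intro gsign_less) auto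
      then show ?thesis using True IH by auto
    next
      case False
      have "i \<notin> set xs" using Cons.prems(1) by auto
      with False have "T \<noteq> set (i # xs)" by auto
      then show ?thesis using False IH by auto
    qed
    finally show ?case by simp
  qed
  moreover have "finite J" using assms(1) finite_subset by blast
  ultimately show ?thesis
    using assms by (simp add: odd_factor_def)
qed

text \<open>At \<zeta> = 0 the sum of the \<theta>^i \<zeta>^i vanishes, so no positive power
  contributes.\<close>

lemma odd_grass_theta:
  assumes "J \<subseteq> {1..N}" "T \<subseteq> {1..N}"
  shows "odd_grass N s J T = (if s = 0 \<and> T = J then 1 else 0)"
proof (cases s)
  case 0
  have fin: "finite T" using assms(2) finite_subset by blast
  have "gmul gone g T = (\<Sum>K\<in>Pow T. if K = {} then g T else 0)" for g
    unfolding gmul_def by (intro sum.cong) (auto simp: gone_def)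
  then show ?thesis using fin 0 by (simp add: odd_grass_def odd_factor_theta[OF assms])
next
  case (Suc s')
  have vanish: "gmul f g T = 0" if "\<And>T. T \<subseteq> {1..N} \<Longrightarrow> f T = 0" "T \<subseteq> {1..N}" for f g T
    unfolding gmul_def by (rule sum.neutral) (use that in auto)
  have tz: "theta_zeta N T = 0" if "T \<subseteq> {1..N}" for T
    unfolding theta_zeta_def
  proof (rule sum.neutral, rule ballI)
    fix i assume i: "i \<in> {1..N}"
    have "gvar (N + i) (T - K) = 0" for K
    proof -
      have "N + i \<notin> {1..N}" using i by auto
      then have "T - K \<noteq> {N + i}" using that by blast
      then show ?thesis by (simp add: gvar_def)
    qed
    then show "gmul (gvar i) (gvar (N + i)) T = 0" by (simp add: gmul_def)
  qed
  have "gmul (theta_zeta N) g T = 0" if "T \<subseteq> {1..N}" for g T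
    by (rule vanish[OF _ that]) (rule tz)
  then have "gmul (gmul (theta_zeta N) g) h T = 0" for g h
    by (rule vanish[OF _ assms(2)])
  then show ?thesis by (simp add: odd_grass_def Suc)
qed

text \<open>At W = 0 only the term s = 0, T = J is left, and the product becomes the residue of z^j
  \<theta>^J a(Z)x. This is the coefficient of a(Z)x at z^(-1-j) and the complement of J, with the
  sign \<sigma>(J) from completing \<theta>^J to \<theta>^1...\<theta>^N.\<close>

lemma creates_jJ_prod:
  assumes a: "hfield N p a" and b: "hfield N q b" and J: "J \<subseteq> {1..N}"
    and vac: "\<And>n I. n < 0 \<Longrightarrow> a n I vac = 0" "creates vac b x"
  shows "creates vac (jJ_prod N j J a b) (sigma N J *\<^sub>C fmode N a j J x)"
  unfolding creates_def
proof (intro conjI allI impI)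
  have vac_b: "\<And>n I. n < 0 \<Longrightarrow> b n I vac = 0" "b 0 {} vac = x" using vac(2) by (auto simp: creates_def)
  note np = nth_product_vacuum[where A = "\<lambda>n. a n _" and B = "\<lambda>n. b n _" and vac = vac,
    OF vac(1) vac_b(1) hfield_series[OF a] hfield_series[OF b]]
  fix n K assume "n < (0 :: int)"
  then show "jJ_prod N j J a b n K vac = 0"
    using fun_cong[OF jJ_prod_component[OF a b, where j = j and J = J and K = K], of n] by (simp
      add: np)
next
  have vac_b: "\<And>n I. n < 0 \<Longrightarrow> b n I vac = 0" "b 0 {} vac = x" using vac(2) by (auto simp: creates_def)
  note np = nth_product_vacuum[where A = "\<lambda>n. a n _" and B = "\<lambda>n. b n _" and vac = vac,
    OF vac(1) vac_b(1) hfield_series[OF a] hfield_series[OF b]]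
  have res: "res_index N {} = {1..N}" by (simp add: res_index_def)
  have parts: "theta_part N ({1..N} - T) = {1..N} - T" "zeta_part N ({1..N} - T) = {}" for T
    by (auto simp: theta_part_def zeta_part_def)
  have "jJ_prod N j J a b 0 {} vac = (\<Sum>s\<le>N. \<Sum>T\<in>Pow {1..N}.
     (zw_coeff j s * (gsign T ({1..N} - T) * odd_grass N s J T) * cross_sign N p ({1..N} - T)) *\<^sub>C
       a (- 1 - (j - int s)) ({1..N} - T) x)"
    unfolding fun_cong[OF jJ_prod_component[OF a b, where j = j and J = J and K = "{}"], of 0]
      if_P[OF empty_subsetI] res
    by (simp only: np parts vac_b(2))
  also have "\<dots> = (\<Sum>s\<le>N. if s = 0 then gsign J ({1..N} - J) *\<^sub>C a (- 1 - j) ({1..N} - J) x else 0)"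
  proof (rule sum.cong[OF refl])
    fix s
    have "(\<Sum>T\<in>Pow {1..N}. (zw_coeff j s * (gsign T ({1..N} - T) * odd_grass N s J T) * cross_sign
      N p ({1..N} - T)) *\<^sub>C
        a (- 1 - (j - int s)) ({1..N} - T) x) =
      (\<Sum>T\<in>Pow {1..N}. if T = J then (if s = 0 then gsign J ({1..N} - J) *\<^sub>C a (- 1 - j) ({1..N} -
        J) x else 0) else 0)"
      by (rule sum.cong[OF refl])
        (auto simp: odd_grass_theta[OF J] zw_coeff_def cross_sign_def parts simp del: One_nat_def)
    also have "\<dots> = (if s = 0 then gsign J ({1..N} - J) *\<^sub>C a (- 1 - j) ({1..N} - J) x else 0)"
      using J by simp
    finally show "(\<Sum>T\<in>Pow {1..N}. (zw_coeff j s * (gsign T ({1..N} - T) * odd_grass N s J T) *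
      cross_sign N p ({1..N} - T)) *\<^sub>C
        a (- 1 - (j - int s)) ({1..N} - T) x) = (if s = 0 then gsign J ({1..N} - J) *\<^sub>C a (- 1 -
          j) ({1..N} - J) x else 0)" .
  qed
  also have "\<dots> = sigma N J *\<^sub>C fmode N a j J x" by (simp add: sigma_def fmode_def)
  finally show "jJ_prod N j J a b 0 {} vac = sigma N J *\<^sub>C fmode N a j J x" .
qed

section \<open>Existence and uniqueness\<close>

lemma dist_mul_zw_power:
  "dist_mul (\<lambda>m k L. exp_zw (int n) m k * gone L) X m k L v =
    (if finite L then (shift_diff ^^ n) (\<lambda>m k. X m k L v) m k else 0)"
proof (cases "finite L")
  case True
  have "(\<Sum>K\<in>Pow L. (gsign K (L - K) * (exp_zw (int n) m' k' * gone K)) *\<^sub>C X (m - m') (k - k') (L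
    - K) v) =
     exp_zw (int n) m' k' *\<^sub>C X (m - m') (k - k') L v" for m' k'
  proof -
    have "(\<Sum>K\<in>Pow L. (gsign K (L - K) * (exp_zw (int n) m' k' * gone K)) *\<^sub>C X (m - m') (k - k')
      (L - K) v) =
      (\<Sum>K\<in>Pow L. if K = {} then exp_zw (int n) m' k' *\<^sub>C X (m - m') (k - k') L v else 0)"
      by (rule sum.cong) (auto simp: gone_def)
    then show ?thesis using True by simp
  qed
  then have "dist_mul (\<lambda>m k L. exp_zw (int n) m k * gone L) X m k L v = conv exp_zw (int n) (\<lambda>m k.
    X m k L v) m k"
    by (simp add: dist_mul_def conv_def)
  then show ?thesis using True by (simp add: zw.conv_int)
qed (simp add: dist_mul_def finite_Pow_iff case_prod_unfold)

text \<open>Each Grassmann coefficient of the supercommutator contains only one pair of components,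
  and both orders share the invertible factor \<open>cross_sign\<close>; hence locality can be
  tested component by component in either direction.\<close>

lemma homog_comm:
  assumes a: "hfield N p a" and b: "hfield N q b"
  shows "prod_ZW N a b m k L v - psign (p * q) *\<^sub>C prod_WZ N b a m k L v =
   (if L \<subseteq> {1..2 * N} then cross_sign N p L *\<^sub>C
     (a m (theta_part N L) (b k (zeta_part N L) v) - comp_sign N p q L *\<^sub>C b k (zeta_part N L) (a
       m (theta_part N L) v))
    else 0)"
proof (cases "L \<subseteq> {1..2 * N}")
  case True
  have "psign (p * q) *\<^sub>C psign (q * cardp (theta_part N L)) *\<^sub>C w = cross_sign N p L *\<^sub>C
    comp_sign N p q L *\<^sub>C w" for w :: 'a
    by (simp only: superspace.scale_scale comp_sign_cross_sign)
  moreover have "hmul p (a m) (to_zeta N (b k)) v L = cross_sign N p L *\<^sub>C a m (theta_part N L) (b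
    k (zeta_part N L) v)"
    unfolding cross_sign_def by (rule hmul_ZW_component[OF a True])
  ultimately show ?thesis using True
    by (simp only: prod_ZW_hmul[OF a] prod_WZ_hmul[OF b] hmul_WZ_component[OF b a True]
       scaleC_diff if_True)
next
  case False
  have "hmul p (a m) (to_zeta N (b k)) v L = 0" "hmul q (to_zeta N (b k)) (a m) v L = 0"
    using supp_ge_hmul[OF a b] False unfolding supp_ge_def by blast+
  then show ?thesis using False by (simp add: prod_ZW_hmul[OF a] prod_WZ_hmul[OF b])
qed

lemma parts_subset:
  assumes "L \<subseteq> {1..2 * N}" shows "theta_part N L \<subseteq> {1..N}" "zeta_part N L \<subseteq> {1..N}"
proof -
  show "theta_part N L \<subseteq> {1..N}" by (auto simp: theta_part_def)
  have "(\<lambda>i. i - N) ` {N + 1..2 * N} \<subseteq> {1..N}" by auto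
  then show "zeta_part N L \<subseteq> {1..N}"
    unfolding zeta_part_def using split_index(1)[OF assms] by blast
qed

text \<open>\<open>local_pair\<close> asks for one exponent valid for all coefficients: the maximum
  over the finitely many parities and subsets of {1..N}.\<close>

lemma local_pairI:
  assumes a: "\<And>p. hfield N p (field_part p a)" and b: "\<And>p. hfield N p (field_part p b)"
    and loc: "\<And>p q. comp_local p q (field_part p a) (field_part q b)"
  shows "local_pair N a b"
proof -
  let ?a = "\<lambda>p. field_part p a" and ?b = "\<lambda>q. field_part q b"
  let ?d = "\<lambda>p q I K v m k. ?a p m I (?b q k K v) - psign ((p + cardp I) * (q + cardp K)) *\<^sub>C ?b q
    k K (?a p m I v)"
  define R where "R p q I K = (SOME r. \<forall>n\<ge>r. \<forall>v. (shift_diff ^^ n) (?d p q I K v) = (\<lambda>m k. 0))"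
    for p q I K
  have R: "(shift_diff ^^ n) (?d p q I K v) = (\<lambda>m k. 0)" if "R p q I K \<le> n" for p q I K n v
  proof -
    have "\<exists>r. \<forall>n\<ge>r. \<forall>v. (shift_diff ^^ n) (?d p q I K v) = (\<lambda>m k. 0)"
      by (rule mutually_localD) (use loc in \<open>simp add: comp_local_def\<close>)
    from someI_ex[OF this] show ?thesis using that unfolding R_def by blast
  qed
  define n where "n = Max ((\<lambda>(p, q, I, K). R p q I K) ` ({0, 1} \<times> {0, 1} \<times> Pow {1..N} \<times> Pow {1..N}))"
  have n: "R p q I K \<le> n" if "I \<subseteq> {1..N}" "K \<subseteq> {1..N}" for p q I K
  proof -
    have "(p, q, I, K) \<in> {0, 1} \<times> {0, 1} \<times> Pow {1..N} \<times> Pow {1..N}"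
      using that by (cases p; cases q) auto
    then have "(\<lambda>(p, q, I, K). R p q I K) (p, q, I, K) \<le> n"
      unfolding n_def by (intro Max_ge imageI) auto
    then show ?thesis by simp
  qed
  have C: "(shift_diff ^^ n) (\<lambda>m k. prod_ZW N (?a p) (?b q) m k L v - psign (p * q) *\<^sub>C prod_WZ N
    (?b q) (?a p) m k L v) = (\<lambda>m k. 0)"
    for p q L v
  proof (cases "L \<subseteq> {1..2 * N}")
    case True
    show ?thesis
      unfolding homog_comm[OF a b] if_P[OF True] shift_diff_funpow_scaleC comp_sign_def
        R[OF n[OF parts_subset[OF True]]] by simp
  qed (simp add: homog_comm[OF a b] shift_diff_funpow_zero)
  have "(shift_diff ^^ n) (\<lambda>m k. comm_ZW N a b m k L v) = (\<lambda>m k. 0)" for L v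
    unfolding comm_ZW_def sum_bit2[where p = 0 and q = 0] shift_diff_funpow_add C by simp
  then show ?thesis
    unfolding local_pair_def dist_mul_zw_power by (intro exI[of _ n]) simp
qed

lemma mutually_local_zero_right: "is_series A \<Longrightarrow> mutually_local \<epsilon> A (\<lambda>n v. 0)"
  unfolding mutually_local_def by (rule exI[of _ 0]) (simp add: endo_zero[OF is_series_endo])

lemma local_pairD:
  assumes a: "hfield N p a" and b: "hfield N q b" and loc: "local_pair N a b"
  shows "comp_local p q a b"
proof -
  obtain n where n: "\<And>L v. finite L \<Longrightarrow> (shift_diff ^^ n) (\<lambda>m k. comm_ZW N a b m k L v) = (\<lambda>m k. 0)"
  proof -
    obtain n where n: "\<And>m k L v. (if finite L then (shift_diff ^^ n) (\<lambda>m k. comm_ZW N a b m k L v)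
      m k else 0) = 0"
      using loc unfolding local_pair_def dist_mul_zw_power by blast
    have "(shift_diff ^^ n) (\<lambda>m k. comm_ZW N a b m k L v) = (\<lambda>m k. 0)" if "finite L" for L v
      using n[of L v] that by (simp add: fun_eq_iff)
    with that show thesis by blast
  qed
  have comm: "comm_ZW N a b m k L v = prod_ZW N a b m k L v - psign (p * q) *\<^sub>C prod_WZ N b a m k
    L v" for m k L v
    unfolding comm_ZW_def sum_bit2[where p = p and q = q] hfield_parts[OF a] hfield_parts[OF b]
    by (simp add: prod_ZW_zero prod_ZW_zero(2)[OF a] prod_ZW_zero(3)[OF b])
  show ?thesis
    unfolding comp_local_def
  proof (intro allI)
    fix I K :: "nat set"
    let ?\<epsilon> = "psign ((p + cardp I) * (q + cardp K))"
    show "mutually_local ?\<epsilon> (\<lambda>n. a n I) (\<lambda>n. b n K)"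
    proof (cases "I \<subseteq> {1..N} \<and> K \<subseteq> {1..N}")
      case True
      \<comment> \<open>The set with \<theta> part I and \<zeta> part K; the coefficient at L
        isolates this pair of components.\<close>
      define L where "L = I \<union> (\<lambda>i. N + i) ` K"
      have L: "L \<subseteq> {1..2 * N}" using True by (auto simp: L_def subset_iff)
      have "(\<lambda>i. N + i) ` K \<inter> {1..N} = {}" using True by auto
      then have th: "theta_part N L = I" and ze: "L - {1..N} = (\<lambda>i. N + i) ` K"
        using True unfolding L_def theta_part_def by blast+
      have ze: "zeta_part N L = K" by (simp add: zeta_part_def ze image_image del: One_nat_def)
      have "(\<lambda>m k. comm_ZW N a b m k L v) = (\<lambda>m k. cross_sign N p L *\<^sub>C (a m I (b k K v) - ?\<epsilon> *\<^sub>C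
        b k K (a m I v)))" for v
        unfolding comm homog_comm[OF a b] if_P[OF L] th ze comp_sign_def ..
      then have "(\<lambda>m k. cross_sign N p L *\<^sub>C (shift_diff ^^ n) (\<lambda>m k. a m I (b k K v) - ?\<epsilon> *\<^sub>C b k
        K (a m I v)) m k) = (\<lambda>m k. 0)" for v
        using n[OF split_index(6)[OF L], of v] by (simp only: shift_diff_funpow_scaleC)
      then have "(shift_diff ^^ n) (\<lambda>m k. a m I (b k K v) - ?\<epsilon> *\<^sub>C b k K (a m I v)) = (\<lambda>m k. 0)" for v
        by (simp add: fun_eq_iff cross_sign_def)
      then show ?thesis unfolding mutually_local_def by blast
    next
      case False
      then consider "\<not> I \<subseteq> {1..N}" | "\<not> K \<subseteq> {1..N}" by blast
      then show ?thesis
        using mutually_local_zero[OF hfield_series[OF b]] mutually_local_zero_right[OF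
          hfield_series[OF a]]
        by cases (simp_all only: hfield_support[OF a] hfield_support[OF b] not_False_eq_True)
    qed
  qed
qed

text \<open>The shape c x + y of the induction rule for spans, so that one closure lemma for each
  property covers sums and multiples.\<close>

definition fcomb :: "complex \<Rightarrow> 'v::superspace sfield \<Rightarrow> 'v sfield \<Rightarrow> 'v sfield" where
  "fcomb c a b n I v = c *\<^sub>C a n I v + b n I v"

lemma hfield_fcomb:
  assumes a: "hfield N p a" and b: "hfield N p b" shows "hfield N p (fcomb c a b)"
  unfolding hfield_def
proof
  show "is_field N (fcomb c a b)"
  proof (rule is_field_components)
    show "is_series (\<lambda>n. fcomb c a b n I)" for I
      unfolding fcomb_def[abs_def]
      by (intro is_series_add is_series_scaleC hfield_series[OF a] hfield_series[OF b])
    show "fcomb c a b n I = (\<lambda>v. 0)" if "\<not> I \<subseteq> {1..N}" for n I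
      by (simp add: fcomb_def fun_eq_iff hfield_support[OF a that] hfield_support[OF b that])
  qed
  show "field_parity p (fcomb c a b)"
    using hfield_parity[OF a] hfield_parity[OF b]
    by (simp add: field_parity_def fcomb_def op_parity_def graded_add graded_scaleC)
qed

lemma field_cov_fcomb:
  assumes "endo S" "field_cov S i p a" "field_cov S i p b" shows "field_cov S i p (fcomb c a b)"
proof -
  have "ad S p (fcomb c a b n) I v = c *\<^sub>C ad S p (a n) I v + ad S p (b n) I v" for n I v
    by (simp add: ad_def fcomb_def endo_add[OF assms(1)] endo_scaleC[OF assms(1)]
      scaleC_add scaleC_diff mult_ac)
  moreover have "ldiff_op i (fcomb c a b n) I v = c *\<^sub>C ldiff_op i (a n) I v + ldiff_op i (b n) I v"
    "lmul_op i (fcomb c a b n) I v = c *\<^sub>C lmul_op i (a n) I v + lmul_op i (b n) I v" for n I v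
    by (simp_all add: ldiff_def lmul_def fcomb_def scaleC_add mult_ac)
  moreover have "ad S p (a n) I v = ldiff_op i (a n) I v - of_int (n + 1) *\<^sub>C lmul_op i (a (n + 1)) I v"
    "ad S p (b n) I v = ldiff_op i (b n) I v - of_int (n + 1) *\<^sub>C lmul_op i (b (n + 1)) I v" for n I v
    using assms(2,3) unfolding field_cov_def by simp_all
  ultimately show ?thesis
    unfolding field_cov_def by (intro allI ext)
      (simp add: scaleC_add scaleC_diff mult_ac)
qed

lemma creates_fcomb: "creates vac a x \<Longrightarrow> creates vac b y \<Longrightarrow> creates vac (fcomb c a b) (c *\<^sub>C x + y)"
  by (simp add: creates_def fcomb_def)

lemma comp_local_fcomb_left:
  assumes "comp_local p q a c" "comp_local p q b c" "hfield N q c" shows "comp_local p q (fcomb d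
    a b) c"
  using assms(1,2) unfolding comp_local_def fcomb_def[abs_def]
  by (intro allI mutually_local_add mutually_local_scaleC hfield_series[OF assms(3)]) blast+

lemma comp_local_fcomb_right:
  assumes "comp_local q p c a" "comp_local q p c b" "hfield N q c" shows "comp_local q p c (fcomb
    d a b)"
  by (rule comp_local_sym[OF comp_local_fcomb_left[OF comp_local_sym[OF assms(1)]
    comp_local_sym[OF assms(2)] assms(3)]])

lemma hfield_zero: "hfield N p (\<lambda>n I v. 0)"
  by (simp add: hfield_def is_field_def field_parity_def)

lemma field_cov_zero: "endo S \<Longrightarrow> field_cov S i p (\<lambda>n I v. 0)"
  by (simp add: field_cov_def ad_def ldiff_def lmul_def endo_zero fun_eq_iff)

lemma comp_local_zero: "hfield N q c \<Longrightarrow> comp_local p q (\<lambda>n I v. 0) c" "hfield N q c \<Longrightarrow> comp_local q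
  p c (\<lambda>n I v. 0)"
  by (simp_all add: comp_local_def mutually_local_zero mutually_local_zero_right hfield_series)

lemma hfield_id: "hfield N 0 (id_field :: 'v::superspace sfield)"
proof -
  have "(id_field n I :: 'v \<Rightarrow> 'v) = (if n = 0 \<and> I = {} then (\<lambda>v. v) else (\<lambda>v. 0))" for n I
    by (intro ext) (simp add: id_field_def)
  moreover have "endo (\<lambda>v :: 'v. v)" by (rule endoI) auto
  ultimately show ?thesis
    by (auto simp: hfield_def is_field_def field_parity_def op_parity_def graded_zero intro!:
      exI[of _ 0])
qed

lemma field_cov_id: "endo S \<Longrightarrow> field_cov S i 0 id_field"
  by (auto simp: field_cov_def ad_def id_field_def ldiff_def lmul_def fun_eq_iff endo_zero simp
    del: of_int_add)

lemma creates_id: "creates vac id_field vac"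
  by (simp add: creates_def id_field_def)

lemma comp_local_id:
  assumes "hfield N p a" shows "comp_local p 0 a id_field"
  unfolding comp_local_def mutually_local_def
  by (intro allI exI[of _ 0]) (auto simp: id_field_def fun_eq_iff endo_zero[OF hfield_endo[OF assms]])

text \<open>Multiplication by z - w is injective on distributions bounded below in w: the relation f
  m k = f (m+1) (k-1), iterated, reaches the region where f vanishes.\<close>

lemma shift_diff_funpow_eq_0:
  assumes "(shift_diff ^^ r) f = (\<lambda>m k. 0)" "\<And>m k. k < k0 \<Longrightarrow> f m k = 0"
  shows "f m k = 0"
proof -
  have step: "f m k = 0" if "shift_diff f = (\<lambda>m k. 0)" "\<And>m k. k < k0 \<Longrightarrow> f m k = 0" for f m k
  proof (cases "k < k0")
    case False
    have "f m (k0 + int t) = 0" for t m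
    proof (induction t arbitrary: m)
      case 0
      have "shift_diff f (m + 1) k0 = 0" by (simp only: that(1))
      then show ?case using that(2)[of "k0 - 1" "m + 1"] by (simp add: shift_diff_def)
    next
      case (Suc t)
      have "shift_diff f (m + 1) (k0 + int (Suc t)) = 0" by (simp only: that(1))
      then show ?case using Suc[of "m + 1"] by (simp add: shift_diff_def)
    qed
    from this[where t = "nat (k - k0)" and m = m] False show ?thesis by simp
  qed (simp add: that(2))
  have trunc: "(shift_diff ^^ r) f m k = 0" if "k < k0" for r m k
    using that by (induction r arbitrary: m k) (simp_all add: shift_diff_def assms(2))
  have "(shift_diff ^^ r) f = (\<lambda>m k. 0) \<Longrightarrow> f m k = 0" for r
  proof (induction r)
    case (Suc r)
    have "(shift_diff ^^ r) f = (\<lambda>m k. 0)"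
    proof (intro ext)
      fix m k
      show "(shift_diff ^^ r) f m k = 0"
        by (rule step[OF _ trunc]) (use Suc.prems in simp_all)
    qed
    then show ?case by (rule Suc.IH)
  qed (simp add: fun_eq_iff)
  then show ?thesis using assms(1) .
qed

section \<open>Fields generated by the given family\<close>

locale susy_fields =
  fixes N :: nat
    and vac :: "'v::superspace"
    and S :: "nat \<Rightarrow> 'v \<Rightarrow> 'v"
    and A :: "'i set"
    and F :: "'i \<Rightarrow> 'v sfield"
    and par :: "'i \<Rightarrow> bit"
    and avec :: "'i \<Rightarrow> 'v"
  assumes N_pos: "1 \<le> N"
    and vac_even: "vac \<in> graded 0"
    and S_endo: "i \<in> {1..N} \<Longrightarrow> endo (S i)"
    and S_odd: "i \<in> {1..N} \<Longrightarrow> op_parity 1 (S i)"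
    and S_vac: "i \<in> {1..N} \<Longrightarrow> S i vac = 0"
    and F_field: "\<alpha> \<in> A \<Longrightarrow> hfield N (par \<alpha>) (F \<alpha>)"
    and F_creates: "\<alpha> \<in> A \<Longrightarrow> creates vac (F \<alpha>) (avec \<alpha>)"
    and F_cov: "\<alpha> \<in> A \<Longrightarrow> i \<in> {1..N} \<Longrightarrow> field_cov (S i) i (par \<alpha>) (F \<alpha>)"
    and F_local: "\<alpha> \<in> A \<Longrightarrow> \<beta> \<in> A \<Longrightarrow> comp_local (par \<alpha>) (par \<beta>) (F \<alpha>) (F \<beta>)"
    and F_span: "superspace.span (word_vector N vac F ` words N A) = UNIV"
begin

text \<open>Locality is demanded with the generators only: it suffices for uniqueness, and it is
  what can be checked for the fields of a competing structure.\<close>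

definition admissible :: "bit \<Rightarrow> 'v \<Rightarrow> 'v sfield \<Rightarrow> bool" where
  "admissible p x a \<longleftrightarrow> hfield N p a \<and> (\<forall>i\<in>{1..N}. field_cov (S i) i p a) \<and> creates vac a x \<and>
     (\<forall>\<alpha>\<in>A. comp_local (par \<alpha>) p (F \<alpha>) a)"

lemma admissible_fcomb:
  assumes "admissible p x a" "admissible p y b" shows "admissible p (c *\<^sub>C x + y) (fcomb c a b)"
  using assms unfolding admissible_def
  by (auto intro!: hfield_fcomb field_cov_fcomb creates_fcomb comp_local_fcomb_right S_endo F_field)

lemma words_Cons: "(\<alpha>, j, J) # ws \<in> words N A \<longleftrightarrow> \<alpha> \<in> A \<and> J \<subseteq> {1..N} \<and> ws \<in> words N A"
  by (auto simp: words_def)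

lemma words_induct [consumes 1, case_names Nil Cons]:
  assumes "ws \<in> words N A" "P []"
    and "\<And>\<alpha> j J ws. \<alpha> \<in> A \<Longrightarrow> J \<subseteq> {1..N} \<Longrightarrow> ws \<in> words N A \<Longrightarrow> P ws \<Longrightarrow> P ((\<alpha>, j, J) # ws)"
  shows "P ws"
  using assms(1) by (induction ws) (auto intro: assms(2,3) simp: words_Cons simp del: One_nat_def)

text \<open>A field is determined by its value on the vacuum: the covariance equations propagate
  \<open>a(Z)|0\<rangle>|\<^bsub>Z=0\<^esub> = 0\<close> to \<open>a(Z)|0\<rangle> = 0\<close>, and locality propagates this to all words.\<close>

lemma admissible_zero:
  assumes adm: "admissible p 0 a" shows "a n I v = 0"
proof -
  have a: "hfield N p a" and cov: "\<And>i. i \<in> {1..N} \<Longrightarrow> field_cov (S i) i p a"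
    and neg: "\<And>n I. n < 0 \<Longrightarrow> a n I vac = 0" and zero: "a 0 {} vac = 0"
    and loc: "\<And>\<alpha>. \<alpha> \<in> A \<Longrightarrow> comp_local (par \<alpha>) p (F \<alpha>) a"
    using adm by (auto simp: admissible_def creates_def)
  note ea = hfield_endo[OF a]
  \<comment> \<open>On the vacuum the term with S on the right drops out, so S a(Z) and the
    covariant derivative of a(Z) agree there.\<close>
  have eq: "psign (cardp I) *\<^sub>C S i (a n I vac) = ldiff_op i (a n) I vac - of_int (n + 1) *\<^sub>C
    lmul_op i (a (n + 1)) I vac"
    if "i \<in> {1..N}" for i n I
  proof -
    have "ad (S i) p (a n) I vac = ldiff_op i (a n) I vac - of_int (n + 1) *\<^sub>C lmul_op i (a (n +
      1)) I vac"
      using cov[OF that] unfolding field_cov_def by simp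
    then show ?thesis by (simp add: ad_def S_vac[OF that] endo_zero[OF ea])
  qed
  \<comment> \<open>For i outside I the equation expresses the coefficient at
    \<open>insert i I\<close> by S applied to the one at I, so everything reduces to I = {}.\<close>
  have all_I: "a n I vac = 0" if "a n {} vac = 0" for n I
  proof (cases "I \<subseteq> {1..N}")
    case True
    then have "finite I" using finite_subset by blast
    then show ?thesis using True
    proof (induction I rule: finite_induct)
      case (insert i I)
      have i: "i \<in> {1..N}" using insert by auto
      have "gsign {i} I *\<^sub>C a n (insert i I) vac = 0"
        using eq[OF i, of I n] insert by (simp add: ldiff_def lmul_def endo_zero[OF S_endo[OF i]])
      then show ?case by simp
    qed (simp add: that)
  qed (simp add: hfield_support[OF a])
  have vac_nat: "a (int n) {} vac = 0" for n
  proof (induction n)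
    case (Suc n)
    have 1: "1 \<in> {1..N}" using N_pos by simp
    \<comment> \<open>At i = 1, I = {1} the part \<theta>^1 \<partial>/\<partial>z enters and links
      n + 1 to n; having a variable \<theta>^1 requires N \<ge> 1.\<close>
    have "of_int (int n + 1) *\<^sub>C a (int n + 1) {} vac = 0"
      using eq[OF 1, of "{1}" "int n"] all_I[OF Suc]
      by (simp add: ldiff_def lmul_def endo_zero[OF S_endo[OF 1]] del: One_nat_def of_int_add
        of_int_1 of_int_of_nat_eq)
    moreover have "of_int (int n + 1) = (of_nat (Suc n) :: complex)" by simp
    then have "of_int (int n + 1) \<noteq> (0 :: complex)" by (simp only: of_nat_neq_0 not_False_eq_True)
    ultimately show ?case by (simp add: add.commute del: of_int_add)
  qed (simp add: zero)
  have vac0: "a n I vac = 0" for n I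
    using neg[of n I] all_I[OF vac_nat[of "nat n"]] by (cases "n < 0") auto
  have word: "a n I (word_vector N vac F ws) = 0" if "ws \<in> words N A" for ws n I
    using that
  proof (induction ws arbitrary: n I rule: words_induct)
    case Nil
    then show ?case by (simp add: word_vector_def vac0)
  next
    case (Cons \<alpha> j J ws)
    note \<alpha> = Cons.hyps(1) and ws = Cons.hyps(3)
    let ?u = "word_vector N vac F ws" and ?K = "{1..N} - J"
    note F = F_field[OF \<alpha>]
    have "mutually_local (psign ((p + cardp I) * (par \<alpha> + cardp ?K))) (\<lambda>n. a n I) (\<lambda>n. F \<alpha> n ?K)"
      using comp_local_sym[OF loc[OF \<alpha>]] by (simp add: comp_local_def)
    then obtain r where "(shift_diff ^^ r) (\<lambda>m k. a m I (F \<alpha> k ?K ?u) -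
        psign ((p + cardp I) * (par \<alpha> + cardp ?K)) *\<^sub>C F \<alpha> k ?K (a m I ?u)) = (\<lambda>m k. 0)"
      unfolding mutually_local_def by blast
    \<comment> \<open>By induction \<open>a\<close> kills \<open>?u\<close>, so only one order is
      left in the locality relation. It is truncated in the exponent of F, hence zero.\<close>
    then have r: "(shift_diff ^^ r) (\<lambda>m k. a m I (F \<alpha> k ?K ?u)) = (\<lambda>m k. 0)"
      by (simp add: Cons.IH endo_zero[OF hfield_endo[OF F]])
    obtain k0 where k0: "\<forall>k<k0. F \<alpha> k ?K ?u = 0"
      using is_series_trunc[OF hfield_series[OF F]] by blast
    have "a m I (F \<alpha> k ?K ?u) = 0" for m k
    proof (rule shift_diff_funpow_eq_0[OF r, of k0])
      show "a m I (F \<alpha> k ?K ?u) = 0" if "k < k0" for m k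
        unfolding k0[rule_format, OF that] by (rule endo_zero[OF ea])
    qed
    then show ?case by (simp add: word_vector_def fmode_def)
  qed
  have "v \<in> superspace.span (word_vector N vac F ` words N A)" using F_span by simp
  then show ?thesis
    by (induction rule: superspace.span_induct_alt)
      (auto simp: endo_zero[OF ea] endo_add[OF ea] endo_scaleC[OF ea] word)
qed

lemma admissible_unique:
  assumes "admissible p x a" "admissible p x b" shows "a = b"
proof (intro ext)
  fix n I v
  have "admissible p 0 (fcomb (- 1) a b)" using admissible_fcomb[OF assms, of "- 1"] by simp
  from admissible_zero[OF this, of n I v] show "a n I v = b n I v" by (simp add: fcomb_def)
qed

text \<open>The mode at (j|J) is a coefficient at the complement of J, which has N - |J| elements;
  modulo 2 this is the summand given here.\<close>

definition word_parity :: "'i word \<Rightarrow> bit" where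
  "word_parity ws = sum_list (map (\<lambda>(\<alpha>, j, J). par \<alpha> + cardp J + of_nat N) ws)"

lemma word_vector_graded: "ws \<in> words N A \<Longrightarrow> word_vector N vac F ws \<in> graded (word_parity ws)"
proof (induction ws rule: words_induct)
  case Nil
  then show ?case by (simp add: word_vector_def word_parity_def vac_even)
next
  case (Cons \<alpha> j J ws)
  note \<alpha> = Cons.hyps(1) and J = Cons.hyps(2) and ws = Cons.hyps(3)
  have "card J + card ({1..N} - J) = N"
    using card_Un_disjoint[of J "{1..N} - J"] J finite_subset[OF J] by (simp add: Un_absorb1)
  then have "cardp J + cardp ({1..N} - J) = (of_nat N :: bit)" by (metis of_nat_add)
  then have "cardp ({1..N} - J) = cardp J + (of_nat N :: bit)" by (metis bit_double(2))
  then have par: "par \<alpha> + cardp ({1..N} - J) + word_parity ws = word_parity ((\<alpha>, j, J) # ws)"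
    by (simp add: word_parity_def add_ac)
  have "F \<alpha> (- 1 - j) ({1..N} - J) (word_vector N vac F ws) \<in> graded (par \<alpha> + cardp ({1..N} - J) +
    word_parity ws)"
    by (rule op_parityD[OF hfield_parity[OF F_field[OF \<alpha>]] Cons.IH])
  then show ?case unfolding par by (simp add: word_vector_def fmode_def)
qed

text \<open>Every letter contributes its \<sigma>(J) to the created vector. As the total sign
  squares to 1, it can be moved to the field, which is the form in which the formula for Y has
  it.\<close>

lemma admissible_word:
  "ws \<in> words N A \<Longrightarrow> admissible (word_parity ws) (word_sign N ws *\<^sub>C word_vector N vac F ws)
    (word_field N F ws)"
proof (induction ws rule: words_induct)
  case Nil
  then show ?case
    by (auto simp: admissible_def word_parity_def word_sign_def word_vector_def word_field_def hfield_id
      creates_id intro!: field_cov_id comp_local_id S_endo F_field)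
next
  case (Cons \<alpha> j J ws)
  note \<alpha> = Cons.hyps(1) and J = Cons.hyps(2) and ws = Cons.hyps(3)
  let ?u = "word_field N F ws"
  note F = F_field[OF \<alpha>]
  have u: "hfield N (word_parity ws) ?u" "\<And>i. i \<in> {1..N} \<Longrightarrow> field_cov (S i) i (word_parity ws) ?u"
    "creates vac ?u (word_sign N ws *\<^sub>C word_vector N vac F ws)"
    "\<And>\<beta>. \<beta> \<in> A \<Longrightarrow> comp_local (par \<beta>) (word_parity ws) (F \<beta>) ?u"
    using Cons.IH by (auto simp: admissible_def)
  have par: "word_parity ((\<alpha>, j, J) # ws) = par \<alpha> + word_parity ws + cardp J + of_nat N"
    by (simp add: word_parity_def add_ac)
  have field: "word_field N F ((\<alpha>, j, J) # ws) = jJ_prod N j J (F \<alpha>) ?u"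
    by (simp add: word_field_def)
  have vec: "word_sign N ((\<alpha>, j, J) # ws) *\<^sub>C word_vector N vac F ((\<alpha>, j, J) # ws) =
      sigma N J *\<^sub>C fmode N (F \<alpha>) j J (word_sign N ws *\<^sub>C word_vector N vac F ws)"
    by (simp add: word_sign_def word_vector_def fmode_def endo_scaleC[OF hfield_endo[OF F]])
  show ?case unfolding admissible_def par field vec
  proof (intro conjI ballI)
    show "hfield N (par \<alpha> + word_parity ws + cardp J + of_nat N) (jJ_prod N j J (F \<alpha>) ?u)"
      by (rule hfield_jJ_prod[OF F u(1)])
    show "field_cov (S i) i (par \<alpha> + word_parity ws + cardp J + of_nat N) (jJ_prod N j J (F \<alpha>) ?u)"
      if i: "i \<in> {1..N}" for i
      by (rule field_cov_jJ_prod[OF S_endo[OF i] F u(1) F_cov[OF \<alpha> i] u(2)[OF i] i J])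
    show "creates vac (jJ_prod N j J (F \<alpha>) ?u) (sigma N J *\<^sub>C fmode N (F \<alpha>) j J (word_sign N ws
      *\<^sub>C word_vector N vac F ws))"
      using F_creates[OF \<alpha>] by (intro creates_jJ_prod[OF F u(1) J _ u(3)]) (simp add: creates_def)
    show "comp_local (par \<beta>) (par \<alpha> + word_parity ws + cardp J + of_nat N) (F \<beta>) (jJ_prod N j J (F
      \<alpha>) ?u)"
      if \<beta>: "\<beta> \<in> A" for \<beta>
      by (intro comp_local_sym[OF comp_local_jJ_prod[OF F u(1) F_field[OF \<beta>]]] u(4) F_local \<alpha> \<beta>
        comp_local_sym[OF u(4)[OF \<beta>]])
  qed
qed

lemma comp_local_word:
  assumes "ws \<in> words N A" "hfield N r c" "\<And>\<alpha>. \<alpha> \<in> A \<Longrightarrow> comp_local (par \<alpha>) r (F \<alpha>) c"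
  shows "comp_local (word_parity ws) r (word_field N F ws) c"
  using assms(1)
proof (induction ws rule: words_induct)
  case Nil
  then show ?case
    using comp_local_sym[OF comp_local_id[OF assms(2)]] by (simp add: word_parity_def word_field_def)
next
  case (Cons \<alpha> j J ws)
  note \<alpha> = Cons.hyps(1) and ws = Cons.hyps(3)
  have u: "hfield N (word_parity ws) (word_field N F ws)" "comp_local (par \<alpha>) (word_parity ws) (F
    \<alpha>) (word_field N F ws)"
    using admissible_word[OF ws] \<alpha> by (auto simp: admissible_def)
  have "word_parity ((\<alpha>, j, J) # ws) = par \<alpha> + word_parity ws + cardp J + of_nat N"
    "word_field N F ((\<alpha>, j, J) # ws) = jJ_prod N j J (F \<alpha>) (word_field N F ws)"
    by (simp_all add: word_parity_def word_field_def add_ac)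
  then show ?case
    by (simp only:) (rule comp_local_jJ_prod[OF F_field[OF \<alpha>] u(1) assms(2) u(2) assms(3)[OF \<alpha>]
      Cons.IH])
qed

text \<open>Quantifying over all b that are local with the generators makes the condition linear in
  a alone. One induction over the span then gives mutual locality of any two states, since the
  second field is itself an instance of b.\<close>

definition state_field :: "bit \<Rightarrow> 'v \<Rightarrow> 'v sfield \<Rightarrow> bool" where
  "state_field p x a \<longleftrightarrow> admissible p x a \<and>
    (\<forall>r b. hfield N r b \<longrightarrow> (\<forall>\<alpha>\<in>A. comp_local (par \<alpha>) r (F \<alpha>) b) \<longrightarrow> comp_local p r a b)"

lemma state_field_fcomb:
  assumes "state_field p x a" "state_field p y b" shows "state_field p (c *\<^sub>C x + y) (fcomb c a b)"
  using assms unfolding state_field_def by (auto intro: admissible_fcomb comp_local_fcomb_left)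

lemma state_field_zero: "state_field p 0 (\<lambda>n I v. 0)"
  unfolding state_field_def admissible_def
  by (auto simp: hfield_zero creates_def intro!: field_cov_zero S_endo comp_local_zero F_field)

lemma state_field_word:
  assumes "ws \<in> words N A"
  shows "state_field (word_parity ws) (word_vector N vac F ws) (\<lambda>n I v. word_sign N ws *\<^sub>C
    word_field N F ws n I v)"
proof -
  have sq: "word_sign N ws * word_sign N ws = 1"
    by (induction ws) (auto simp: word_sign_def sigma_def mult_ac)
  have "state_field (word_parity ws) (word_sign N ws *\<^sub>C word_vector N vac F ws) (word_field N F ws)"
    using admissible_word[OF assms] comp_local_word[OF assms] by (auto simp: state_field_def)
  from state_field_fcomb[OF this state_field_zero, of "word_sign N ws"] show ?thesis
    by (simp add: fcomb_def[abs_def] sq)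
qed

text \<open>The parts are used because a combination of words may mix parities; each word is
  homogeneous, so it either enters the part p or does not affect it.\<close>

lemma state_field_part: "\<exists>a. state_field p (part p x) a"
proof -
  have "x \<in> superspace.span (word_vector N vac F ` words N A)" using F_span by simp
  then show ?thesis
  proof (induction rule: superspace.span_induct_alt)
    case base
    then show ?case using state_field_zero by auto
  next
    case (step c w y)
    then obtain ws b where ws: "ws \<in> words N A" "w = word_vector N vac F ws" and b: "state_field p
      (part p y) b"
      by blast
    have part: "part p (c *\<^sub>C w + y) = c *\<^sub>C part p w + part p y" by (simp add: part_add part_scaleC)
    show ?case
    proof (cases "word_parity ws = p")
      case True
      then have "part p w = w" using word_vector_graded[OF ws(1)] ws(2) by (simp add: part_same)
      then show ?thesis using state_field_fcomb[OF state_field_word[OF ws(1)], where c = c] b True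
        ws(2) part by auto
    next
      case False
      then have "part p w = 0" using word_vector_graded[OF ws(1)] ws(2) by (simp add: part_other)
      then show ?thesis using b part by auto
    qed
  qed
qed

definition hstate :: "bit \<Rightarrow> 'v \<Rightarrow> 'v sfield" where
  "hstate p x = (SOME a. state_field p x a)"

lemma hstate: "x \<in> graded p \<Longrightarrow> state_field p x (hstate p x)"
  using state_field_part[of p x] unfolding hstate_def by (metis part_same someI_ex)

lemma hstate_part: "state_field p (part p x) (hstate p (part p x))"
  by (rule hstate) simp

text \<open>All identities for Y come from here: for homogeneous x, any admissible field creating x
  is the chosen one, so linearity, the formula on words and uniqueness amount to exhibiting
  admissible fields.\<close>

lemma hstate_eqI:
  assumes "admissible p x a" "x \<in> graded p" shows "hstate p x = a"
  using admissible_unique[OF _ assms(1)] hstate[OF assms(2)] by (auto simp: state_field_def)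

lemma hstate_zero: "hstate p 0 = (\<lambda>n I v. 0)"
  using state_field_zero by (intro hstate_eqI) (auto simp: state_field_def graded_zero)

definition Y :: "'v \<Rightarrow> 'v sfield" where
  "Y x n I v = hstate 0 (part 0 x) n I v + hstate 1 (part 1 x) n I v"

lemma Y_homog:
  assumes "x \<in> graded p" shows "Y x = hstate p x"
proof -
  have "part p x = x" "part (p + 1) x = 0" using assms by (auto simp: part_same part_other)
  then show ?thesis
    by (cases p) (auto simp: Y_def fun_eq_iff hstate_zero)
qed

lemma hfield_hstate: "hfield N p (hstate p (part p x))"
  using hstate_part by (auto simp: state_field_def admissible_def)

lemma field_part_Y: "field_part p (Y x) = hstate p (part p x)"
proof -
  have "field_part p (Y x) n I v = field_part p (hstate p (part p x)) n I v +
      field_part p (hstate (p + 1) (part (p + 1) x)) n I v" for n I v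
    unfolding field_part_def Y_def[abs_def] op_part_add by (cases p) (simp_all add: add.commute)
  then show ?thesis
    using hfield_parts(1)[OF hfield_hstate, of p x] hfield_parts(2)[OF hfield_hstate, of "p + 1" x]
    by (simp add: fun_eq_iff add.assoc)
qed

lemma hstate_add: "hstate p (part p (x + y)) = fcomb 1 (hstate p (part p x)) (hstate p (part p y))"
  using state_field_fcomb[OF hstate_part[of p x] hstate_part[of p y], of 1]
  by (intro hstate_eqI) (simp_all add: state_field_def part_add graded_add)

lemma hstate_scaleC: "hstate p (part p (c *\<^sub>C x)) = fcomb c (hstate p (part p x)) (\<lambda>n I v. 0)"
  using state_field_fcomb[OF hstate_part[of p x] state_field_zero, of c]
  by (intro hstate_eqI) (simp_all add: state_field_def part_scaleC graded_scaleC)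

lemma Y_covariance:
  assumes i: "i \<in> {1..N}" shows "scomm_field (S i) (Y x) = Dbar i (Y x)"
proof -
  let ?a = "hstate 0 (part 0 x)" and ?b = "hstate 1 (part 1 x)"
  have h: "scomm_field (S i) (hstate p (part p x)) = Dbar i (hstate p (part p x))" for p
    using hstate_part[of p x] i field_cov_iff[OF S_endo[OF i] S_odd[OF i] hfield_hstate]
    by (auto simp: state_field_def admissible_def)
  have Y: "Y x n I = (\<lambda>v. ?a n I v + ?b n I v)" for n I by (simp add: Y_def fun_eq_iff)
  have "scomm_field (S i) (Y x) n I v = scomm_field (S i) ?a n I v + scomm_field (S i) ?b n I v"
    for n I v
    by (simp add: scomm_field_def field_part_def Y op_part_add endo_add[OF endo_op_part[OF
      S_endo[OF i]]]
      scaleC_add algebra_simps)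
  moreover have "Dbar i (Y x) n I v = Dbar i ?a n I v + Dbar i ?b n I v" for n I v
    by (simp add: Dbar_def Y scaleC_add)
  ultimately show ?thesis by (simp add: fun_eq_iff h)
qed

lemma susy_vertex_algebra_Y: "susy_vertex_algebra N vac S Y"
proof
  show "1 \<le> N" "vac \<in> graded 0" by (rule N_pos vac_even)+
  show "endo (S i)" "op_parity 1 (S i)" "S i vac = 0" if "i \<in> {1..N}" for i
    using that by (rule S_endo S_odd S_vac)+
  show "is_field N (Y x)" for x
  proof (rule is_field_components)
    show "is_series (\<lambda>n. Y x n I)" for I
      unfolding Y_def[abs_def] by (intro is_series_add hfield_series[OF hfield_hstate])
    show "Y x n I = (\<lambda>v. 0)" if "\<not> I \<subseteq> {1..N}" for n I
      by (simp add: Y_def fun_eq_iff hfield_support[OF hfield_hstate that])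
  qed
  show "Y (x + y) n I v = Y x n I v + Y y n I v" for x y n I v
    by (simp add: Y_def hstate_add fcomb_def)
  show "Y (c *\<^sub>C x) n I v = c *\<^sub>C Y x n I v" for c x n I v
    by (simp add: Y_def hstate_scaleC fcomb_def scaleC_add)
  show "field_parity p (Y x)" if "x \<in> graded p" for x p
    using hstate[OF that] by (simp add: Y_homog[OF that] state_field_def admissible_def hfield_def)
  show "creates vac (Y x) x" for x
  proof -
    have "creates vac (hstate p (part p x)) (part p x)" for p
      using hstate_part[of p x] by (simp add: state_field_def admissible_def)
    then show ?thesis using part_sum[of 0 x] by (simp add: creates_def Y_def)
  qed
  show "scomm_field (S i) (Y x) = Dbar i (Y x)" if "i \<in> {1..N}" for i x
    using that by (rule Y_covariance)
  show "local_pair N (Y x) (Y y)" for x y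
  proof (rule local_pairI; unfold field_part_Y)
    show "hfield N p (hstate p (part p x))" "hfield N p (hstate p (part p y))" for p
      by (rule hfield_hstate)+
    \<comment> \<open>The strong locality clause of the field of x is applied to the field of y, of
      which only locality with the generators is needed.\<close>
    show "comp_local p q (hstate p (part p x)) (hstate q (part q y))" for p q
      using hstate_part[of p x] hstate_part[of q y] by (auto simp: state_field_def admissible_def)
  qed
qed

lemma Y_word:
  assumes "ws \<in> words N A"
  shows "Y (word_vector N vac F ws) n I v = word_sign N ws *\<^sub>C word_field N F ws n I v"
proof -
  have "hstate (word_parity ws) (word_vector N vac F ws) = (\<lambda>n I v. word_sign N ws *\<^sub>C word_field
    N F ws n I v)"
    using state_field_word[OF assms] by (intro hstate_eqI word_vector_graded[OF assms]) (simp add: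
      state_field_def)
  then show ?thesis by (simp add: Y_homog[OF word_vector_graded[OF assms]])
qed

lemma Y_avec:
  assumes "\<alpha> \<in> A" shows "Y (avec \<alpha>) = F \<alpha>"
proof -
  have "avec \<alpha> = F \<alpha> 0 {} vac" using F_creates[OF assms] by (simp add: creates_def)
  then have gr: "avec \<alpha> \<in> graded (par \<alpha>)"
    using op_parityD[OF hfield_parity[OF F_field[OF assms], of "{}" 0] vac_even] by simp
  have "admissible (par \<alpha>) (avec \<alpha>) (F \<alpha>)"
    using assms by (auto simp: admissible_def intro: F_field F_cov F_creates F_local)
  then show ?thesis by (simp add: Y_homog[OF gr] hstate_eqI[OF _ gr])
qed

text \<open>Each \<open>Y' x\<close> with x homogeneous is admissible: its locality with a generator
  F \<alpha> is the locality axiom for the pair \<open>Y' (avec \<alpha>)\<close>,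
  \<open>Y' x\<close>.\<close>

lemma Y_unique:
  assumes "susy_vertex_algebra N vac S Y'" "\<And>\<alpha>. \<alpha> \<in> A \<Longrightarrow> Y' (avec \<alpha>) = F \<alpha>"
  shows "Y' = Y"
proof -
  interpret Y': susy_vertex_algebra N vac S Y' by (rule assms(1))
  have homog: "Y' x = Y x" if x: "x \<in> graded p" for p x
  proof -
    have field: "hfield N p (Y' x)" using Y'.Y_field Y'.Y_parity[OF x] by (simp add: hfield_def)
    have "admissible p x (Y' x)"
      unfolding admissible_def
    proof (intro conjI ballI field Y'.Y_vac)
      show "field_cov (S i) i p (Y' x)" if "i \<in> {1..N}" for i
        using Y'.S_covariance[OF that] field_cov_iff[OF S_endo[OF that] S_odd[OF that] field] by blast
      show "comp_local (par \<alpha>) p (F \<alpha>) (Y' x)" if "\<alpha> \<in> A" for \<alpha>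
        using Y'.locality[of "avec \<alpha>" x] unfolding assms(2)[OF that]
        by (rule local_pairD[OF F_field[OF that] field])
    qed
    then show ?thesis by (simp add: Y_homog[OF x] hstate_eqI[OF _ x])
  qed
  show ?thesis
  proof (intro ext)
    fix x n I v
    have "Y' (part 0 x + part (0 + 1) x) n I v = Y (part 0 x) n I v + Y (part (0 + 1) x) n I v"
      by (simp only: Y'.Y_add homog[OF part_graded])
    also have "\<dots> = Y (part 0 x + part (0 + 1) x) n I v"
      by (rule susy_vertex_algebra.Y_add[OF susy_vertex_algebra_Y, symmetric])
    finally show "Y' x n I v = Y x n I v" unfolding part_sum .
  qed
qed

end

theorem theorem4p29:
  fixes N :: nat
    and vac :: "'v::superspace"
    and T :: "'v \<Rightarrow> 'v"
    and S :: "nat \<Rightarrow> 'v \<Rightarrow> 'v"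
    and A :: "'i set"
    and F :: "'i \<Rightarrow> 'v sfield"
    and avec :: "'i \<Rightarrow> 'v"
  assumes "1 \<le> N"
    and "vac \<in> graded 0"
    and "endo T" and "op_parity 0 T"
    and "\<forall>i\<in>{1..N}. endo (S i) \<and> op_parity 1 (S i)"
    and "\<forall>i\<in>{1..N}. \<forall>j\<in>{1..N}. \<forall>v.
           scomm (S i) (S j) v = (if i = j then 2 *\<^sub>C T v else 0)"
    and "\<forall>i\<in>{1..N}. S i vac = 0"
    and "\<forall>\<alpha>\<in>A. is_field N (F \<alpha>) \<and> (\<exists>p. field_parity p (F \<alpha>))"
    and "\<forall>\<alpha>\<in>A. creates vac (F \<alpha>) (avec \<alpha>)"
    and "\<forall>\<alpha>\<in>A. \<forall>i\<in>{1..N}. scomm_field (S i) (F \<alpha>) = Dbar i (F \<alpha>)"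
    and "\<forall>\<alpha>\<in>A. \<forall>\<beta>\<in>A. local_pair N (F \<alpha>) (F \<beta>)"
    and "superspace.span (word_vector N vac F ` words N A) = UNIV"
  shows "\<exists>Y. susy_vertex_algebra N vac S Y \<and>
           (\<forall>ws\<in>words N A. \<forall>n I v.
              Y (word_vector N vac F ws) n I v = word_sign N ws *\<^sub>C word_field N F ws n I v) \<and>
           (\<forall>\<alpha>\<in>A. Y (avec \<alpha>) = F \<alpha>) \<and>
           (\<forall>Y'. susy_vertex_algebra N vac S Y' \<and> (\<forall>\<alpha>\<in>A. Y' (avec \<alpha>) = F \<alpha>) \<longrightarrow> Y' = Y)"
proof -
  \<comment> \<open>The parities have to be chosen, since a zero field has both.\<close>
  obtain par where par: "\<And>\<alpha>. \<alpha> \<in> A \<Longrightarrow> hfield N (par \<alpha>) (F \<alpha>)"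
    using assms(8) unfolding hfield_def by metis
  interpret susy_fields N vac S A F par avec
  proof
    show "hfield N (par \<alpha>) (F \<alpha>)" if "\<alpha> \<in> A" for \<alpha> using that by (rule par)
    show "field_cov (S i) i (par \<alpha>) (F \<alpha>)" if "\<alpha> \<in> A" "i \<in> {1..N}" for \<alpha> i
      using field_cov_iff[OF _ _ par[OF that(1)], of "S i" i] assms(5,10) that by auto
    show "comp_local (par \<alpha>) (par \<beta>) (F \<alpha>) (F \<beta>)" if "\<alpha> \<in> A" "\<beta> \<in> A" for \<alpha> \<beta>
      using assms(11) that by (intro local_pairD[OF par par]) auto
  qed (use assms in auto)
  show ?thesis
    using susy_vertex_algebra_Y Y_word Y_avec Y_unique by (intro exI[of _ Y]) blast
qed

end
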